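(* Let $\mathsf{M}$ be a monoidal model category. Then its arrow category $\operatorname{Arr}(\mathsf{M})$, equipped with the pushout product monoidal structure and the projective model structure, is a monoidal model category.
   Context: A monoidal model category is a bicomplete symmetric monoidal closed category $(\mathsf{M},\otimes,\mathbb{1},\operatorname{Hom})$, with initial object $\varnothing$, equipped with a model structure satisfying the pushout product axiom: for any cofibrations $f:X_0\to X_1$ and $g:Y_0\to Y_1$, the pushout product map $$f\,\square\, g:\ (X_0\otimes Y_1)\coprod_{X_0\otimes Y_0}(X_1\otimes Y_0)\to X_1\otimes Y_1$$ is a cofibration, and if in addition $f$ or $g$ is a weak equivalence then $f\,\square\, g$ is a trivial cofibration (a cofibration that is also a weak equivalence). No cofibrant generation and no unit axiom is assumed as part of the definition. The arrow category $\operatorname{Arr}(\mathsf{M})$ has as objects the maps of $\mathsf{M}$; a morphism $\alpha:f\to g$ from $f:X_0\to X_1$ to $g:Y_0\to Y_1$ is a commutative square, i.e. a pair $\alpha_0:X_0\to Y_0$, $\alpha_1:X_1\to Y_1$ with $g\alpha_0=\alpha_1 f$. The pushout product monoidal structure on $\operatorname{Arr}(\mathsf{M})$ has monoidal product $f\,\square\, g$ (the pushout product above) and monoidal unit $\varnothing\to\mathbb{1}$; it is a symmetric monoidal closed structure. The projective model structure on $\operatorname{Arr}(\mathsf{M})$ is the (existing, for any model category $\mathsf{M}$) model structure in which $\alpha:f\to g$ is a weak equivalence (resp. fibration) if and only if both $\alpha_0$ and $\alpha_1$ are weak equivalences (resp. fibrations) in $\mathsf{M}$. Its (trivial) cofibrations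 are the maps $\alpha$ such that $\alpha_0$ and the induced map $X_1\coprod_{X_0}Y_0\to Y_1$ (given by $\alpha_1$ and $g$) are (trivial) cofibrations in $\mathsf{M}$. *)

theory Defs
  imports Main "HOL-Library.Equipollence" "HOL-Library.Infinite_Typeclass"
begin

section \<open>Categories\<close>

text \<open>
  A category is a record of carriers and operations; all operations are only meaningful on the
  carriers. Composition \<open>g \<bullet>\<^bsub>C\<^esub> f\<close> is in the usual (right-to-left) order.
\<close>

record ('o, 'a) precategory =
  Ob :: "'o set"
  Ar :: "'a set"
  Dom :: "'a \<Rightarrow> 'o"
  Cod :: "'a \<Rightarrow> 'o"
  Id :: "'o \<Rightarrow> 'a"
  Comp :: "'a \<Rightarrow> 'a \<Rightarrow> 'a"  (infixr "\<bullet>\<index>" 70)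

definition hom :: "('o, 'a, 'm) precategory_scheme \<Rightarrow> 'o \<Rightarrow> 'o \<Rightarrow> 'a set" where
  "hom C x y = {f \<in> Ar C. Dom C f = x \<and> Cod C f = y}"

locale category =
  fixes C :: "('o, 'a, 'm) precategory_scheme" (structure)
  assumes dom_in_Ob: "f \<in> Ar C \<Longrightarrow> Dom C f \<in> Ob C"
    and cod_in_Ob: "f \<in> Ar C \<Longrightarrow> Cod C f \<in> Ob C"
    and id_in_hom: "x \<in> Ob C \<Longrightarrow> Id C x \<in> hom C x x"
    and comp_in_hom: "\<lbrakk>f \<in> hom C x y; g \<in> hom C y z\<rbrakk> \<Longrightarrow> g \<bullet> f \<in> hom C x z"
    and comp_id_right: "f \<in> hom C x y \<Longrightarrow> f \<bullet> Id C x = f"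
    and comp_id_left: "f \<in> hom C x y \<Longrightarrow> Id C y \<bullet> f = f"
    and comp_assoc:
      "\<lbrakk>f \<in> hom C w x; g \<in> hom C x y; h \<in> hom C y z\<rbrakk> \<Longrightarrow> (h \<bullet> g) \<bullet> f = h \<bullet> (g \<bullet> f)"

definition is_iso :: "('o, 'a, 'm) precategory_scheme \<Rightarrow> 'a \<Rightarrow> bool" where
  "is_iso C f \<longleftrightarrow> f \<in> Ar C \<and>
     (\<exists>g \<in> hom C (Cod C f) (Dom C f).
        g \<bullet>\<^bsub>C\<^esub> f = Id C (Dom C f) \<and> f \<bullet>\<^bsub>C\<^esub> g = Id C (Cod C f))"

locale functor_between = C: category C + D: category D
  for C :: "('o, 'a, 'm) precategory_scheme" and D :: "('p, 'b, 'n) precategory_scheme" +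
  fixes Fo :: "'o \<Rightarrow> 'p" and Fa :: "'a \<Rightarrow> 'b"
  assumes map_ob: "x \<in> Ob C \<Longrightarrow> Fo x \<in> Ob D"
    and map_hom: "f \<in> hom C x y \<Longrightarrow> Fa f \<in> hom D (Fo x) (Fo y)"
    and map_id: "x \<in> Ob C \<Longrightarrow> Fa (Id C x) = Id D (Fo x)"
    and map_comp:
      "\<lbrakk>f \<in> hom C x y; g \<in> hom C y z\<rbrakk> \<Longrightarrow> Fa (g \<bullet>\<^bsub>C\<^esub> f) = Fa g \<bullet>\<^bsub>D\<^esub> Fa f"

text \<open>\<open>F : C \<rightarrow> D\<close> is left adjoint to \<open>G : D \<rightarrow> C\<close>, by the natural bijection
  \<open>\<phi> x y : D(F x, y) \<rightarrow> C(x, G y)\<close>.\<close>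

locale adjunction = F: functor_between C D Fo Fa + G: functor_between D C Go Ga
  for C :: "('o, 'a, 'm) precategory_scheme" and D :: "('p, 'b, 'n) precategory_scheme"
    and Fo :: "'o \<Rightarrow> 'p" and Fa :: "'a \<Rightarrow> 'b" and Go :: "'p \<Rightarrow> 'o" and Ga :: "'b \<Rightarrow> 'a" +
  fixes \<phi> :: "'o \<Rightarrow> 'p \<Rightarrow> 'b \<Rightarrow> 'a"
  assumes bij: "\<lbrakk>x \<in> Ob C; y \<in> Ob D\<rbrakk> \<Longrightarrow> bij_betw (\<phi> x y) (hom D (Fo x) y) (hom C x (Go y))"
    and natural:
      "\<lbrakk>x \<in> Ob C; y \<in> Ob D; k \<in> hom C x' x; h \<in> hom D y y'; f \<in> hom D (Fo x) y\<rbrakk> \<Longrightarrow>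
        \<phi> x' y' (h \<bullet>\<^bsub>D\<^esub> (f \<bullet>\<^bsub>D\<^esub> Fa k)) = Ga h \<bullet>\<^bsub>C\<^esub> (\<phi> x y f \<bullet>\<^bsub>C\<^esub> k)"


section \<open>Limits and colimits\<close>

definition is_cocone ::
  "('j, 'u, 'm) precategory_scheme \<Rightarrow> ('o, 'a, 'n) precategory_scheme \<Rightarrow> ('j \<Rightarrow> 'o) \<Rightarrow> ('u \<Rightarrow> 'a) \<Rightarrow>
   'o \<Rightarrow> ('j \<Rightarrow> 'a) \<Rightarrow> bool" where
  "is_cocone J C Do Da x l \<longleftrightarrow> x \<in> Ob C \<and> (\<forall>j \<in> Ob J. l j \<in> hom C (Do j) x) \<and>
     (\<forall>u \<in> Ar J. l (Cod J u) \<bullet>\<^bsub>C\<^esub> Da u = l (Dom J u))"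

definition is_cone ::
  "('j, 'u, 'm) precategory_scheme \<Rightarrow> ('o, 'a, 'n) precategory_scheme \<Rightarrow> ('j \<Rightarrow> 'o) \<Rightarrow> ('u \<Rightarrow> 'a) \<Rightarrow>
   'o \<Rightarrow> ('j \<Rightarrow> 'a) \<Rightarrow> bool" where
  "is_cone J C Do Da x l \<longleftrightarrow> x \<in> Ob C \<and> (\<forall>j \<in> Ob J. l j \<in> hom C x (Do j)) \<and>
     (\<forall>u \<in> Ar J. Da u \<bullet>\<^bsub>C\<^esub> l (Dom J u) = l (Cod J u))"

definition is_colimit ::
  "('j, 'u, 'm) precategory_scheme \<Rightarrow> ('o, 'a, 'n) precategory_scheme \<Rightarrow> ('j \<Rightarrow> 'o) \<Rightarrow> ('u \<Rightarrow> 'a) \<Rightarrow>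
   'o \<Rightarrow> ('j \<Rightarrow> 'a) \<Rightarrow> bool" where
  "is_colimit J C Do Da x l \<longleftrightarrow> is_cocone J C Do Da x l \<and>
     (\<forall>y m. is_cocone J C Do Da y m \<longrightarrow>
        (\<exists>!h. h \<in> hom C x y \<and> (\<forall>j \<in> Ob J. h \<bullet>\<^bsub>C\<^esub> l j = m j)))"

definition is_limit ::
  "('j, 'u, 'm) precategory_scheme \<Rightarrow> ('o, 'a, 'n) precategory_scheme \<Rightarrow> ('j \<Rightarrow> 'o) \<Rightarrow> ('u \<Rightarrow> 'a) \<Rightarrow>
   'o \<Rightarrow> ('j \<Rightarrow> 'a) \<Rightarrow> bool" where
  "is_limit J C Do Da x l \<longleftrightarrow> is_cone J C Do Da x l \<and>
     (\<forall>y m. is_cone J C Do Da y m \<longrightarrow>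
        (\<exists>!h. h \<in> hom C y x \<and> (\<forall>j \<in> Ob J. l j \<bullet>\<^bsub>C\<^esub> h = m j)))"

text \<open>
  Size is measured by an arbitrary infinite type \<open>'i\<close>: a category is small if it has fewer than
  \<open>|'i|\<close> arrows. For \<open>|'i|\<close> an inaccessible cardinal this is smallness with respect to the
  corresponding Grothendieck universe. Up to isomorphism every such category has its objects and
  arrows in \<open>'i\<close>, so it is enough to consider index categories of that form.
\<close>

definition bicomplete :: "'i::infinite itself \<Rightarrow> ('o, 'a, 'm) precategory_scheme \<Rightarrow> bool" where
  "bicomplete small C \<longleftrightarrow> category C \<and>
     (\<forall>(J :: ('i, 'i) precategory) Do Da.
        functor_between J C Do Da \<and> Ar J \<prec> (UNIV :: 'i set) \<longrightarrow>
          (\<exists>x l. is_limit J C Do Da x l) \<and> (\<exists>x l. is_colimit J C Do Da x l))"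

definition is_initial :: "('o, 'a, 'm) precategory_scheme \<Rightarrow> 'o \<Rightarrow> bool" where
  "is_initial C x \<longleftrightarrow> x \<in> Ob C \<and> (\<forall>y \<in> Ob C. \<exists>!f. f \<in> hom C x y)"

definition initial_ob :: "('o, 'a, 'm) precategory_scheme \<Rightarrow> 'o" where
  "initial_ob C = (SOME x. is_initial C x)"

definition initial_ar :: "('o, 'a, 'm) precategory_scheme \<Rightarrow> 'o \<Rightarrow> 'a" where
  "initial_ar C y = (THE f. f \<in> hom C (initial_ob C) y)"

text \<open>\<open>i\<close> and \<open>j\<close> are the coprojections of a pushout of the span
  \<open>Cod f \<leftarrow> Dom f = Dom g \<rightarrow> Cod g\<close>.\<close>

definition is_pushout :: "('o, 'a, 'm) precategory_scheme \<Rightarrow> 'a \<Rightarrow> 'a \<Rightarrow> 'a \<Rightarrow> 'a \<Rightarrow> bool" where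
  "is_pushout C f g i j \<longleftrightarrow>
     f \<in> Ar C \<and> g \<in> Ar C \<and> i \<in> Ar C \<and> j \<in> Ar C \<and> Dom C f = Dom C g \<and>
     Dom C i = Cod C f \<and> Dom C j = Cod C g \<and> Cod C i = Cod C j \<and>
     i \<bullet>\<^bsub>C\<^esub> f = j \<bullet>\<^bsub>C\<^esub> g \<and>
     (\<forall>y u v. u \<in> hom C (Cod C f) y \<and> v \<in> hom C (Cod C g) y \<and> u \<bullet>\<^bsub>C\<^esub> f = v \<bullet>\<^bsub>C\<^esub> g \<longrightarrow>
        (\<exists>!h. h \<in> hom C (Cod C i) y \<and> h \<bullet>\<^bsub>C\<^esub> i = u \<and> h \<bullet>\<^bsub>C\<^esub> j = v))"

definition pushout :: "('o, 'a, 'm) precategory_scheme \<Rightarrow> 'a \<Rightarrow> 'a \<Rightarrow> 'a \<times> 'a" where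
  "pushout C f g = (SOME (i, j). is_pushout C f g i j)"

definition po_in1 :: "('o, 'a, 'm) precategory_scheme \<Rightarrow> 'a \<Rightarrow> 'a \<Rightarrow> 'a" where
  "po_in1 C f g = fst (pushout C f g)"

definition po_in2 :: "('o, 'a, 'm) precategory_scheme \<Rightarrow> 'a \<Rightarrow> 'a \<Rightarrow> 'a" where
  "po_in2 C f g = snd (pushout C f g)"

definition po_ob :: "('o, 'a, 'm) precategory_scheme \<Rightarrow> 'a \<Rightarrow> 'a \<Rightarrow> 'o" where
  "po_ob C f g = Cod C (po_in1 C f g)"

definition po_desc :: "('o, 'a, 'm) precategory_scheme \<Rightarrow> 'a \<Rightarrow> 'a \<Rightarrow> 'a \<Rightarrow> 'a \<Rightarrow> 'a" where
  "po_desc C f g u v =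
     (THE h. h \<in> hom C (po_ob C f g) (Cod C u) \<and>
        h \<bullet>\<^bsub>C\<^esub> po_in1 C f g = u \<and> h \<bullet>\<^bsub>C\<^esub> po_in2 C f g = v)"


section \<open>Symmetric monoidal closed categories\<close>

record ('o, 'a) premonoidal = "('o, 'a) precategory" +
  TensOb :: "'o \<Rightarrow> 'o \<Rightarrow> 'o"  (infixr "\<odot>\<index>" 75)
  TensAr :: "'a \<Rightarrow> 'a \<Rightarrow> 'a"  (infixr "\<otimes>\<index>" 75)
  Unit :: "'o"
  Assoc :: "'o \<Rightarrow> 'o \<Rightarrow> 'o \<Rightarrow> 'a"
  LUnit :: "'o \<Rightarrow> 'a"
  RUnit :: "'o \<Rightarrow> 'a"
  Braid :: "'o \<Rightarrow> 'o \<Rightarrow> 'a"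

locale symmetric_monoidal_category = category S
  for S :: "('o, 'a, 'm) premonoidal_scheme" (structure) +
  assumes tensor_ob: "\<lbrakk>x \<in> Ob S; y \<in> Ob S\<rbrakk> \<Longrightarrow> x \<odot> y \<in> Ob S"
    and tensor_hom:
      "\<lbrakk>f \<in> hom S x x'; g \<in> hom S y y'\<rbrakk> \<Longrightarrow> f \<otimes> g \<in> hom S (x \<odot> y) (x' \<odot> y')"
    and tensor_id: "\<lbrakk>x \<in> Ob S; y \<in> Ob S\<rbrakk> \<Longrightarrow> Id S x \<otimes> Id S y = Id S (x \<odot> y)"
    and tensor_comp:
      "\<lbrakk>f \<in> hom S x x'; f' \<in> hom S x' x''; g \<in> hom S y y'; g' \<in> hom S y' y''\<rbrakk> \<Longrightarrow>
        (f' \<bullet> f) \<otimes> (g' \<bullet> g) = (f' \<otimes> g') \<bullet> (f \<otimes> g)"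
    and unit_ob: "Unit S \<in> Ob S"
    and assoc_hom:
      "\<lbrakk>x \<in> Ob S; y \<in> Ob S; z \<in> Ob S\<rbrakk> \<Longrightarrow> Assoc S x y z \<in> hom S ((x \<odot> y) \<odot> z) (x \<odot> (y \<odot> z))"
    and assoc_iso: "\<lbrakk>x \<in> Ob S; y \<in> Ob S; z \<in> Ob S\<rbrakk> \<Longrightarrow> is_iso S (Assoc S x y z)"
    and assoc_natural:
      "\<lbrakk>f \<in> hom S x x'; g \<in> hom S y y'; h \<in> hom S z z'\<rbrakk> \<Longrightarrow>
        Assoc S x' y' z' \<bullet> ((f \<otimes> g) \<otimes> h) = (f \<otimes> (g \<otimes> h)) \<bullet> Assoc S x y z"
    and lunit_hom: "x \<in> Ob S \<Longrightarrow> LUnit S x \<in> hom S (Unit S \<odot> x) x"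
    and lunit_iso: "x \<in> Ob S \<Longrightarrow> is_iso S (LUnit S x)"
    and lunit_natural: "f \<in> hom S x y \<Longrightarrow> LUnit S y \<bullet> (Id S (Unit S) \<otimes> f) = f \<bullet> LUnit S x"
    and runit_hom: "x \<in> Ob S \<Longrightarrow> RUnit S x \<in> hom S (x \<odot> Unit S) x"
    and runit_iso: "x \<in> Ob S \<Longrightarrow> is_iso S (RUnit S x)"
    and runit_natural: "f \<in> hom S x y \<Longrightarrow> RUnit S y \<bullet> (f \<otimes> Id S (Unit S)) = f \<bullet> RUnit S x"
    and braid_hom: "\<lbrakk>x \<in> Ob S; y \<in> Ob S\<rbrakk> \<Longrightarrow> Braid S x y \<in> hom S (x \<odot> y) (y \<odot> x)"
    and braid_natural:
      "\<lbrakk>f \<in> hom S x x'; g \<in> hom S y y'\<rbrakk> \<Longrightarrow> Braid S x' y' \<bullet> (f \<otimes> g) = (g \<otimes> f) \<bullet> Braid S x y"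
    and braid_symmetric: "\<lbrakk>x \<in> Ob S; y \<in> Ob S\<rbrakk> \<Longrightarrow> Braid S y x \<bullet> Braid S x y = Id S (x \<odot> y)"
    and pentagon:
      "\<lbrakk>w \<in> Ob S; x \<in> Ob S; y \<in> Ob S; z \<in> Ob S\<rbrakk> \<Longrightarrow>
        Assoc S w x (y \<odot> z) \<bullet> Assoc S (w \<odot> x) y z =
        (Id S w \<otimes> Assoc S x y z) \<bullet> (Assoc S w (x \<odot> y) z \<bullet> (Assoc S w x y \<otimes> Id S z))"
    and triangle:
      "\<lbrakk>x \<in> Ob S; y \<in> Ob S\<rbrakk> \<Longrightarrow>
        (Id S x \<otimes> LUnit S y) \<bullet> Assoc S x (Unit S) y = RUnit S x \<otimes> Id S y"
    and hexagon:
      "\<lbrakk>x \<in> Ob S; y \<in> Ob S; z \<in> Ob S\<rbrakk> \<Longrightarrow>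
        Assoc S y z x \<bullet> (Braid S x (y \<odot> z) \<bullet> Assoc S x y z) =
        (Id S y \<otimes> Braid S x z) \<bullet> (Assoc S y x z \<bullet> (Braid S x y \<otimes> Id S z))"

text \<open>Closedness: every functor \<open>- \<otimes> y\<close> has a right adjoint (the internal hom \<open>Hom(y, -)\<close>).\<close>

locale symmetric_monoidal_closed_category = symmetric_monoidal_category +
  assumes closed:
    "y \<in> Ob S \<Longrightarrow> \<exists>Go Ga \<phi>. adjunction S S (\<lambda>x. x \<odot> y) (\<lambda>f. f \<otimes> Id S y) Go Ga \<phi>"


section \<open>The pushout product\<close>

text \<open>For \<open>f : X0 \<rightarrow> X1\<close> and \<open>g : Y0 \<rightarrow> Y1\<close>, the domain of the pushout product is the pushout of
  \<open>X0 \<otimes> Y1 \<leftarrow> X0 \<otimes> Y0 \<rightarrow> X1 \<otimes> Y0\<close>; \<open>pp_in1\<close> and \<open>pp_in2\<close> are the coprojections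
  from \<open>X0 \<otimes> Y1\<close> and \<open>X1 \<otimes> Y0\<close>.\<close>

definition pp_leg1 :: "('o, 'a, 'm) premonoidal_scheme \<Rightarrow> 'a \<Rightarrow> 'a \<Rightarrow> 'a" where
  "pp_leg1 S f g = Id S (Dom S f) \<otimes>\<^bsub>S\<^esub> g"

definition pp_leg2 :: "('o, 'a, 'm) premonoidal_scheme \<Rightarrow> 'a \<Rightarrow> 'a \<Rightarrow> 'a" where
  "pp_leg2 S f g = f \<otimes>\<^bsub>S\<^esub> Id S (Dom S g)"

definition pp_dom :: "('o, 'a, 'm) premonoidal_scheme \<Rightarrow> 'a \<Rightarrow> 'a \<Rightarrow> 'o" where
  "pp_dom S f g = po_ob S (pp_leg1 S f g) (pp_leg2 S f g)"

definition pp_in1 :: "('o, 'a, 'm) premonoidal_scheme \<Rightarrow> 'a \<Rightarrow> 'a \<Rightarrow> 'a" where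
  "pp_in1 S f g = po_in1 S (pp_leg1 S f g) (pp_leg2 S f g)"

definition pp_in2 :: "('o, 'a, 'm) premonoidal_scheme \<Rightarrow> 'a \<Rightarrow> 'a \<Rightarrow> 'a" where
  "pp_in2 S f g = po_in2 S (pp_leg1 S f g) (pp_leg2 S f g)"

definition pp_desc :: "('o, 'a, 'm) premonoidal_scheme \<Rightarrow> 'a \<Rightarrow> 'a \<Rightarrow> 'a \<Rightarrow> 'a \<Rightarrow> 'a" where
  "pp_desc S f g u v = po_desc S (pp_leg1 S f g) (pp_leg2 S f g) u v"

definition pushout_product :: "('o, 'a, 'm) premonoidal_scheme \<Rightarrow> 'a \<Rightarrow> 'a \<Rightarrow> 'a" where
  "pushout_product S f g =
     pp_desc S f g (f \<otimes>\<^bsub>S\<^esub> Id S (Cod S g)) (Id S (Cod S f) \<otimes>\<^bsub>S\<^esub> g)"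


section \<open>Monoidal model categories\<close>

definition lifts_against :: "('o, 'a, 'm) precategory_scheme \<Rightarrow> 'a \<Rightarrow> 'a \<Rightarrow> bool" where
  "lifts_against C i p \<longleftrightarrow>
     (\<forall>u \<in> hom C (Dom C i) (Dom C p). \<forall>v \<in> hom C (Cod C i) (Cod C p).
        p \<bullet>\<^bsub>C\<^esub> u = v \<bullet>\<^bsub>C\<^esub> i \<longrightarrow>
        (\<exists>h \<in> hom C (Cod C i) (Dom C p). h \<bullet>\<^bsub>C\<^esub> i = u \<and> p \<bullet>\<^bsub>C\<^esub> h = v))"

definition is_retract :: "('o, 'a, 'm) precategory_scheme \<Rightarrow> 'a \<Rightarrow> 'a \<Rightarrow> bool" where
  "is_retract C f g \<longleftrightarrow> f \<in> Ar C \<and> g \<in> Ar C \<and>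
     (\<exists>s\<^sub>0 \<in> hom C (Dom C f) (Dom C g). \<exists>s\<^sub>1 \<in> hom C (Cod C f) (Cod C g).
      \<exists>r\<^sub>0 \<in> hom C (Dom C g) (Dom C f). \<exists>r\<^sub>1 \<in> hom C (Cod C g) (Cod C f).
        g \<bullet>\<^bsub>C\<^esub> s\<^sub>0 = s\<^sub>1 \<bullet>\<^bsub>C\<^esub> f \<and> f \<bullet>\<^bsub>C\<^esub> r\<^sub>0 = r\<^sub>1 \<bullet>\<^bsub>C\<^esub> g \<and>
        r\<^sub>0 \<bullet>\<^bsub>C\<^esub> s\<^sub>0 = Id C (Dom C f) \<and> r\<^sub>1 \<bullet>\<^bsub>C\<^esub> s\<^sub>1 = Id C (Cod C f))"

locale model_structure = category C
  for C :: "('o, 'a, 'm) precategory_scheme" (structure) +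
  fixes Weq Cof Fib :: "'a set"
  assumes weq_ar: "Weq \<subseteq> Ar C" and cof_ar: "Cof \<subseteq> Ar C" and fib_ar: "Fib \<subseteq> Ar C"
    and two_of_three_comp:
      "\<lbrakk>f \<in> hom C x y; g \<in> hom C y z; f \<in> Weq; g \<in> Weq\<rbrakk> \<Longrightarrow> g \<bullet> f \<in> Weq"
    and two_of_three_left:
      "\<lbrakk>f \<in> hom C x y; g \<in> hom C y z; f \<in> Weq; g \<bullet> f \<in> Weq\<rbrakk> \<Longrightarrow> g \<in> Weq"
    and two_of_three_right:
      "\<lbrakk>f \<in> hom C x y; g \<in> hom C y z; g \<in> Weq; g \<bullet> f \<in> Weq\<rbrakk> \<Longrightarrow> f \<in> Weq"
    and retract_weq: "\<lbrakk>is_retract C f g; g \<in> Weq\<rbrakk> \<Longrightarrow> f \<in> Weq"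
    and retract_cof: "\<lbrakk>is_retract C f g; g \<in> Cof\<rbrakk> \<Longrightarrow> f \<in> Cof"
    and retract_fib: "\<lbrakk>is_retract C f g; g \<in> Fib\<rbrakk> \<Longrightarrow> f \<in> Fib"
    and lift_cof_tfib: "\<lbrakk>i \<in> Cof; p \<in> Fib \<inter> Weq\<rbrakk> \<Longrightarrow> lifts_against C i p"
    and lift_tcof_fib: "\<lbrakk>i \<in> Cof \<inter> Weq; p \<in> Fib\<rbrakk> \<Longrightarrow> lifts_against C i p"
    and factor_cof_tfib:
      "f \<in> hom C x y \<Longrightarrow>
        \<exists>z i p. i \<in> hom C x z \<and> p \<in> hom C z y \<and> i \<in> Cof \<and> p \<in> Fib \<inter> Weq \<and> f = p \<bullet> i"
    and factor_tcof_fib: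
      "f \<in> hom C x y \<Longrightarrow>
        \<exists>z i p. i \<in> hom C x z \<and> p \<in> hom C z y \<and> i \<in> Cof \<inter> Weq \<and> p \<in> Fib \<and> f = p \<bullet> i"

locale monoidal_model_category =
  symmetric_monoidal_closed_category S + model_structure S Weq Cof Fib
  for small :: "'i::infinite itself"
    and S :: "('o, 'a, 'm) premonoidal_scheme" (structure) and Weq Cof Fib :: "'a set" +
  assumes bicomplete: "bicomplete small S"
    and pushout_product_cof: "\<lbrakk>f \<in> Cof; g \<in> Cof\<rbrakk> \<Longrightarrow> pushout_product S f g \<in> Cof"
    and pushout_product_tcof:
      "\<lbrakk>f \<in> Cof; g \<in> Cof; f \<in> Weq \<or> g \<in> Weq\<rbrakk> \<Longrightarrow> pushout_product S f g \<in> Cof \<inter> Weq"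


section \<open>The arrow category\<close>

text \<open>A morphism of arrows \<open>f \<rightarrow> g\<close> is a commutative square, stored together with its source and
  target as \<open>(f, g, \<alpha>\<^sub>0, \<alpha>\<^sub>1)\<close>.\<close>

type_synonym 'a square = "'a \<times> 'a \<times> 'a \<times> 'a"

definition sq_src :: "'a square \<Rightarrow> 'a" where "sq_src = (\<lambda>(f, g, \<alpha>\<^sub>0, \<alpha>\<^sub>1). f)"
definition sq_trg :: "'a square \<Rightarrow> 'a" where "sq_trg = (\<lambda>(f, g, \<alpha>\<^sub>0, \<alpha>\<^sub>1). g)"
definition sq0 :: "'a square \<Rightarrow> 'a" where "sq0 = (\<lambda>(f, g, \<alpha>\<^sub>0, \<alpha>\<^sub>1). \<alpha>\<^sub>0)"
definition sq1 :: "'a square \<Rightarrow> 'a" where "sq1 = (\<lambda>(f, g, \<alpha>\<^sub>0, \<alpha>\<^sub>1). \<alpha>\<^sub>1)"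

definition squares :: "('o, 'a, 'm) precategory_scheme \<Rightarrow> 'a square set" where
  "squares C = {(f, g, \<alpha>\<^sub>0, \<alpha>\<^sub>1). f \<in> Ar C \<and> g \<in> Ar C \<and>
     \<alpha>\<^sub>0 \<in> hom C (Dom C f) (Dom C g) \<and> \<alpha>\<^sub>1 \<in> hom C (Cod C f) (Cod C g) \<and>
     g \<bullet>\<^bsub>C\<^esub> \<alpha>\<^sub>0 = \<alpha>\<^sub>1 \<bullet>\<^bsub>C\<^esub> f}"

text \<open>The structure morphisms of the pushout product are those of \<open>S\<close> on codomains, and are
  determined on domains by compatibility with the coprojections of the pushouts. In
  \<open>arr_assoc0\<close> these are the coprojections of \<open>X0 \<otimes> Y1 \<otimes> Z1\<close>, \<open>X1 \<otimes> Y0 \<otimes> Z1\<close> and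
  \<open>X1 \<otimes> Y1 \<otimes> Z0\<close>. In the unitors, the other summand \<open>\<emptyset> \<otimes> Y1\<close> (resp. \<open>X1 \<otimes> \<emptyset>\<close>) is
  initial since \<open>\<otimes>\<close> is closed, so it imposes no condition.\<close>

definition arr_tensor :: "('o, 'a, 'm) premonoidal_scheme \<Rightarrow> 'a square \<Rightarrow> 'a square \<Rightarrow> 'a square" where
  "arr_tensor S = (\<lambda>(f, f', \<alpha>\<^sub>0, \<alpha>\<^sub>1) (g, g', \<beta>\<^sub>0, \<beta>\<^sub>1).
     (pushout_product S f g, pushout_product S f' g',
      pp_desc S f g (pp_in1 S f' g' \<bullet>\<^bsub>S\<^esub> (\<alpha>\<^sub>0 \<otimes>\<^bsub>S\<^esub> \<beta>\<^sub>1)) (pp_in2 S f' g' \<bullet>\<^bsub>S\<^esub> (\<alpha>\<^sub>1 \<otimes>\<^bsub>S\<^esub> \<beta>\<^sub>0)),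
      \<alpha>\<^sub>1 \<otimes>\<^bsub>S\<^esub> \<beta>\<^sub>1))"

definition arr_unit :: "('o, 'a, 'm) premonoidal_scheme \<Rightarrow> 'a" where
  "arr_unit S = initial_ar S (Unit S)"

definition arr_assoc0 :: "('o, 'a, 'm) premonoidal_scheme \<Rightarrow> 'a \<Rightarrow> 'a \<Rightarrow> 'a \<Rightarrow> 'a" where
  "arr_assoc0 S f g h =
     (let fg = pushout_product S f g; gh = pushout_product S g h in
      THE k. k \<in> hom S (pp_dom S fg h) (pp_dom S f gh) \<and>
        k \<bullet>\<^bsub>S\<^esub> (pp_in1 S fg h \<bullet>\<^bsub>S\<^esub> (pp_in1 S f g \<otimes>\<^bsub>S\<^esub> Id S (Cod S h))) =
          pp_in1 S f gh \<bullet>\<^bsub>S\<^esub> Assoc S (Dom S f) (Cod S g) (Cod S h) \<and>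
        k \<bullet>\<^bsub>S\<^esub> (pp_in1 S fg h \<bullet>\<^bsub>S\<^esub> (pp_in2 S f g \<otimes>\<^bsub>S\<^esub> Id S (Cod S h))) =
          pp_in2 S f gh \<bullet>\<^bsub>S\<^esub> ((Id S (Cod S f) \<otimes>\<^bsub>S\<^esub> pp_in1 S g h)
            \<bullet>\<^bsub>S\<^esub> Assoc S (Cod S f) (Dom S g) (Cod S h)) \<and>
        k \<bullet>\<^bsub>S\<^esub> pp_in2 S fg h =
          pp_in2 S f gh \<bullet>\<^bsub>S\<^esub> ((Id S (Cod S f) \<otimes>\<^bsub>S\<^esub> pp_in2 S g h)
            \<bullet>\<^bsub>S\<^esub> Assoc S (Cod S f) (Cod S g) (Dom S h)))"

definition arr_assoc :: "('o, 'a, 'm) premonoidal_scheme \<Rightarrow> 'a \<Rightarrow> 'a \<Rightarrow> 'a \<Rightarrow> 'a square" where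
  "arr_assoc S f g h =
     (pushout_product S (pushout_product S f g) h,
      pushout_product S f (pushout_product S g h),
      arr_assoc0 S f g h,
      Assoc S (Cod S f) (Cod S g) (Cod S h))"

definition arr_lunit :: "('o, 'a, 'm) premonoidal_scheme \<Rightarrow> 'a \<Rightarrow> 'a square" where
  "arr_lunit S g =
     (pushout_product S (arr_unit S) g, g,
      THE k. k \<in> hom S (pp_dom S (arr_unit S) g) (Dom S g) \<and>
        k \<bullet>\<^bsub>S\<^esub> pp_in2 S (arr_unit S) g = LUnit S (Dom S g),
      LUnit S (Cod S g))"

definition arr_runit :: "('o, 'a, 'm) premonoidal_scheme \<Rightarrow> 'a \<Rightarrow> 'a square" where
  "arr_runit S f =
     (pushout_product S f (arr_unit S), f,
      THE k. k \<in> hom S (pp_dom S f (arr_unit S)) (Dom S f) \<and>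
        k \<bullet>\<^bsub>S\<^esub> pp_in1 S f (arr_unit S) = RUnit S (Dom S f),
      RUnit S (Cod S f))"

definition arr_braid :: "('o, 'a, 'm) premonoidal_scheme \<Rightarrow> 'a \<Rightarrow> 'a \<Rightarrow> 'a square" where
  "arr_braid S f g =
     (pushout_product S f g, pushout_product S g f,
      pp_desc S f g
        (pp_in2 S g f \<bullet>\<^bsub>S\<^esub> Braid S (Dom S f) (Cod S g))
        (pp_in1 S g f \<bullet>\<^bsub>S\<^esub> Braid S (Cod S f) (Dom S g)),
      Braid S (Cod S f) (Cod S g))"

text \<open>The arrow category with the pushout product monoidal structure.\<close>

definition Arr :: "('o, 'a, 'm) premonoidal_scheme \<Rightarrow> ('a, 'a square) premonoidal" where
  "Arr S = \<lparr>
     Ob = Ar S,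
     Ar = squares S,
     Dom = sq_src,
     Cod = sq_trg,
     Id = (\<lambda>f. (f, f, Id S (Dom S f), Id S (Cod S f))),
     Comp = (\<lambda>\<beta> \<alpha>. (sq_src \<alpha>, sq_trg \<beta>, sq0 \<beta> \<bullet>\<^bsub>S\<^esub> sq0 \<alpha>, sq1 \<beta> \<bullet>\<^bsub>S\<^esub> sq1 \<alpha>)),
     TensOb = pushout_product S,
     TensAr = arr_tensor S,
     Unit = arr_unit S,
     Assoc = arr_assoc S,
     LUnit = arr_lunit S,
     RUnit = arr_runit S,
     Braid = arr_braid S\<rparr>"

text \<open>The projective model structure.\<close>

definition proj_weq :: "('o, 'a, 'm) precategory_scheme \<Rightarrow> 'a set \<Rightarrow> 'a square set" where
  "proj_weq C Weq = {\<alpha> \<in> squares C. sq0 \<alpha> \<in> Weq \<and> sq1 \<alpha> \<in> Weq}"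

definition proj_fib :: "('o, 'a, 'm) precategory_scheme \<Rightarrow> 'a set \<Rightarrow> 'a square set" where
  "proj_fib C Fib = {\<alpha> \<in> squares C. sq0 \<alpha> \<in> Fib \<and> sq1 \<alpha> \<in> Fib}"

text \<open>For \<open>\<alpha> : f \<rightarrow> g\<close> the corner map is \<open>X1 \<squnion>\<^bsub>X0\<^esub> Y0 \<rightarrow> Y1\<close>, induced by \<open>\<alpha>\<^sub>1\<close> and \<open>g\<close>.\<close>

definition corner_map :: "('o, 'a, 'm) precategory_scheme \<Rightarrow> 'a square \<Rightarrow> 'a" where
  "corner_map C \<alpha> = po_desc C (sq_src \<alpha>) (sq0 \<alpha>) (sq1 \<alpha>) (sq_trg \<alpha>)"

definition proj_cof :: "('o, 'a, 'm) precategory_scheme \<Rightarrow> 'a set \<Rightarrow> 'a square set" where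
  "proj_cof C Cof = {\<alpha> \<in> squares C. sq0 \<alpha> \<in> Cof \<and> corner_map C \<alpha> \<in> Cof}"

end

theory Submission
  imports Defs
begin

text \<open>
  An arrow \<open>f : X\<^sub>0 \<rightarrow> X\<^sub>1\<close> is a functor on the poset \<open>{0 < 1}\<close>, and the pushout product
  is Day convolution over the monoid \<open>({0, 1}, min)\<close>: the arrow \<open>f \<box> g\<close> is the universal recipient of maps
  \<open>X\<^sub>a \<otimes> Y\<^sub>b \<rightarrow> (f \<box> g)\<^bsub>min a b\<^esub>\<close> natural in \<open>a\<close> and \<open>b\<close>. Indexing by booleans (\<open>False\<close> for the domain, \<open>True\<close> for
  the codomain), these maps are the coprojections \<open>pin f g a b\<close>, landing in the component \<open>a \<and> b\<close>.

  Since \<open>M\<close> is closed and symmetric, tensoring with an object on either side is a left adjoint, so it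
  preserves pushouts and jointly epic families. Hence a morphism out of an iterated pushout product is
  determined by its composites with iterated coprojections. On these, the structure morphisms of
  \<open>Arr M\<close> are those of \<open>M\<close>, for all indices at once, and each coherence law of \<open>Arr M\<close> becomes the same
  law of \<open>M\<close>. The functor \<open>- \<box> g\<close> has a right adjoint because morphisms \<open>f \<box> g \<rightarrow> t\<close> amount to maps from
  \<open>X\<^sub>0 \<otimes> Y\<^sub>1\<close>, \<open>X\<^sub>1 \<otimes> Y\<^sub>0\<close> and \<open>X\<^sub>1 \<otimes> Y\<^sub>1\<close>, whose transposes form a map into the arrow
  \<open>Hom(Y\<^sub>1, T\<^sub>0) \<rightarrow> Hom(Y\<^sub>1, T\<^sub>1) \<times>\<^bsub>Hom(Y\<^sub>0, T\<^sub>1)\<^esub> Hom(Y\<^sub>0, T\<^sub>0)\<close> (\<open>Arr_closed\<close>). Limits and colimits are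
  computed in each component.

  For the projective model structure, lifts and factorizations are built in two steps: the component
  on domains is treated by the corresponding axiom of \<open>M\<close>, and the component on codomains by the axiom
  of \<open>M\<close> applied to a corner map (\<open>Arr_lifts\<close>, \<open>Arr_factor\<close>).

  For the pushout product axiom, (trivial) cofibrations are detected by left lifting against trivial
  fibrations (fibrations). A lifting problem of \<open>\<alpha> \<box> \<beta>\<close> against \<open>p\<close> unfolds to one in two variables, in which
  no pushout occurs (\<open>lifts2\<close>). Its solution consists of three maps, and they can be found one after the
  other, each by lifting a pushout product of \<open>M\<close> (\<open>two_variable_lift\<close>): first on domains by
  \<open>\<alpha>\<^sub>0 \<box> \<beta>\<^sub>1\<close>, then by \<open>corner \<alpha> \<box> \<beta>\<^sub>0\<close>, both against \<open>p\<^sub>0\<close>, and last on codomains by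
  \<open>corner \<alpha> \<box> corner \<beta>\<close> against \<open>p\<^sub>1\<close>. The four maps \<open>\<alpha>\<^sub>0\<close>, \<open>corner \<alpha>\<close>, \<open>\<beta>\<^sub>0\<close>, \<open>corner \<beta>\<close> are cofibrations by
  definition, and so is \<open>\<beta>\<^sub>1\<close>, a composite of a pushout of \<open>\<beta>\<^sub>0\<close> with \<open>corner \<beta>\<close>; all of those coming from a
  trivial cofibration are trivial. So the pushout product axiom of \<open>M\<close> applies to each of the three.
\<close>

section \<open>Composition in a category\<close>

text \<open>Composites are handled through \<open>Ar\<close>, \<open>Dom\<close> and \<open>Cod\<close> instead of hom-sets: the side conditions of the
  category laws then become equations between objects that the simplifier settles by rewriting.\<close>

lemma hom_iff: "f \<in> hom C x y \<longleftrightarrow> f \<in> Ar C \<and> Dom C f = x \<and> Cod C f = y"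
  by (auto simp: hom_def)

context category
begin

lemma dom_Ob [simp]: "f \<in> Ar C \<Longrightarrow> Dom C f \<in> Ob C"
  and cod_Ob [simp]: "f \<in> Ar C \<Longrightarrow> Cod C f \<in> Ob C"
  by (auto intro: dom_in_Ob cod_in_Ob)

lemma id_arrow [simp]:
  assumes "x \<in> Ob C"
  shows "Id C x \<in> Ar C" "Dom C (Id C x) = x" "Cod C (Id C x) = x"
  using id_in_hom[OF assms] by (auto simp: hom_iff)

lemma comp_arrow [simp]:
  assumes "f \<in> Ar C" "g \<in> Ar C" "Dom C g = Cod C f"
  shows "g \<bullet> f \<in> Ar C" "Dom C (g \<bullet> f) = Dom C f" "Cod C (g \<bullet> f) = Cod C g"
  using comp_in_hom[of f "Dom C f" "Cod C f" g "Cod C g"] assms by (auto simp: hom_iff)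

lemma comp_id [simp]:
  assumes "f \<in> Ar C"
  shows "x = Dom C f \<Longrightarrow> f \<bullet> Id C x = f" "y = Cod C f \<Longrightarrow> Id C y \<bullet> f = f"
  using comp_id_right[of f] comp_id_left[of f] assms by (auto simp: hom_iff)

lemma assoc [simp]:
  assumes "f \<in> Ar C" "g \<in> Ar C" "h \<in> Ar C" "Dom C g = Cod C f" "Dom C h = Cod C g"
  shows "(h \<bullet> g) \<bullet> f = h \<bullet> (g \<bullet> f)"
  by (rule comp_assoc[of _ "Dom C f" "Cod C f" _ "Cod C g" _ "Cod C h"])
    (use assms in \<open>auto simp: hom_iff\<close>)

text \<open>The simplifier nests composites to the right, so an equation \<open>g \<bullet> f = h\<close> does not match inside a longer
  composite. This rule and the next give its continuations.\<close>

lemma comp_chain: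
  assumes "g \<bullet> f = h" "f \<in> Ar C" "g \<in> Ar C" "k \<in> Ar C" "Dom C g = Cod C f" "Dom C f = Cod C k"
  shows "g \<bullet> (f \<bullet> k) = h \<bullet> k"
  using assms assoc[of k f g] by simp

lemma comp_chain_eq:
  assumes "g \<bullet> f = g' \<bullet> f'" "f \<in> Ar C" "g \<in> Ar C" "f' \<in> Ar C" "g' \<in> Ar C" "k \<in> Ar C"
    "Dom C g = Cod C f" "Dom C g' = Cod C f'" "Dom C f = Cod C k" "Dom C f' = Cod C k"
  shows "g \<bullet> (f \<bullet> k) = g' \<bullet> (f' \<bullet> k)"
  using assms assoc[of k f g] assoc[of k f' g'] by simp

lemma is_isoI:
  assumes "f \<in> Ar C" "g \<in> Ar C" "Dom C g = Cod C f" "Cod C g = Dom C f"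
    "g \<bullet> f = Id C (Dom C f)" "f \<bullet> g = Id C (Cod C f)"
  shows "is_iso C f"
  using assms by (auto simp: is_iso_def hom_iff)

lemma is_isoE:
  assumes "is_iso C f"
  obtains g where "f \<in> Ar C" "g \<in> Ar C" "Dom C g = Cod C f" "Cod C g = Dom C f"
    "g \<bullet> f = Id C (Dom C f)" "f \<bullet> g = Id C (Cod C f)"
  using assms by (auto simp: is_iso_def hom_iff)

end

section \<open>Left adjoints and jointly epic families\<close>

text \<open>Uniqueness of maps out of a colimit, separated from existence. Unlike a universal property, joint
  epicness is stable under replacing a member by a jointly epic family into its domain, which is how
  iterated pushout products are reached.\<close>

definition jointly_epic :: "('o, 'a, 'm) precategory_scheme \<Rightarrow> 'a set \<Rightarrow> 'o \<Rightarrow> bool" where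
  "jointly_epic C I x \<longleftrightarrow> x \<in> Ob C \<and> (\<forall>i \<in> I. i \<in> Ar C \<and> Cod C i = x) \<and>
     (\<forall>k \<in> Ar C. \<forall>k' \<in> Ar C. Dom C k = x \<and> Dom C k' = x \<and> Cod C k = Cod C k' \<and>
        (\<forall>i \<in> I. k \<bullet>\<^bsub>C\<^esub> i = k' \<bullet>\<^bsub>C\<^esub> i) \<longrightarrow> k = k')"

lemma jointly_epicD:
  assumes "jointly_epic C I x" "k \<in> Ar C" "k' \<in> Ar C" "Dom C k = x" "Dom C k' = x"
    "Cod C k = Cod C k'" "\<And>i. i \<in> I \<Longrightarrow> k \<bullet>\<^bsub>C\<^esub> i = k' \<bullet>\<^bsub>C\<^esub> i"
  shows "k = k'"
  using assms unfolding jointly_epic_def by blast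

context category
begin

lemma is_pushoutD:
  assumes "is_pushout C f g i j"
  shows "f \<in> Ar C" "g \<in> Ar C" "i \<in> Ar C" "j \<in> Ar C" "Dom C f = Dom C g"
    "Dom C i = Cod C f" "Dom C j = Cod C g" "Cod C i = Cod C j" "i \<bullet> f = j \<bullet> g"
  using assms by (auto simp: is_pushout_def)

lemma is_pushout_desc:
  assumes "is_pushout C f g i j" "u \<in> Ar C" "v \<in> Ar C" "Dom C u = Cod C f" "Dom C v = Cod C g"
    "Cod C u = Cod C v" "u \<bullet> f = v \<bullet> g"
  obtains h where "h \<in> Ar C" "Dom C h = Cod C i" "Cod C h = Cod C v" "h \<bullet> i = u" "h \<bullet> j = v"
proof -
  have "\<exists>!h. h \<in> hom C (Cod C i) (Cod C v) \<and> h \<bullet> i = u \<and> h \<bullet> j = v"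
  proof -
    have "u \<in> hom C (Cod C f) (Cod C v)" "v \<in> hom C (Cod C g) (Cod C v)"
      using assms by (auto simp: hom_iff)
    thus ?thesis using assms(1,7) unfolding is_pushout_def by blast
  qed
  then obtain h where "h \<in> hom C (Cod C i) (Cod C v)" "h \<bullet> i = u" "h \<bullet> j = v" by blast
  thus thesis using that by (auto simp: hom_iff)
qed

lemma pushout_jointly_epic:
  assumes po: "is_pushout C f g i j"
  shows "jointly_epic C {i, j} (Cod C i)"
  unfolding jointly_epic_def
proof (intro conjI ballI impI)
  note ar = is_pushoutD[OF po]
  fix k k' assume k: "k \<in> Ar C" "k' \<in> Ar C" "Dom C k = Cod C i \<and> Dom C k' = Cod C i \<and>
    Cod C k = Cod C k' \<and> (\<forall>l\<in>{i, j}. k \<bullet> l = k' \<bullet> l)"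
  have "\<exists>!h. h \<in> hom C (Cod C i) (Cod C k) \<and> h \<bullet> i = k \<bullet> i \<and> h \<bullet> j = k \<bullet> j"
  proof -
    have "(k \<bullet> i) \<bullet> f = (k \<bullet> j) \<bullet> g" using k ar by simp
    moreover have "k \<bullet> i \<in> hom C (Cod C f) (Cod C k)" "k \<bullet> j \<in> hom C (Cod C g) (Cod C k)"
      using k ar by (auto simp: hom_iff)
    ultimately show ?thesis using po unfolding is_pushout_def by blast
  qed
  thus "k = k'" using k by (auto simp: hom_iff)
qed (use is_pushoutD[OF po] in auto)

lemma is_pushoutI:
  assumes "f \<in> Ar C" "g \<in> Ar C" "i \<in> Ar C" "j \<in> Ar C" "Dom C f = Dom C g"
    "Dom C i = Cod C f" "Dom C j = Cod C g" "Cod C i = Cod C j" "i \<bullet> f = j \<bullet> g"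
    "\<And>u v. u \<in> Ar C \<Longrightarrow> v \<in> Ar C \<Longrightarrow> Dom C u = Cod C f \<Longrightarrow> Dom C v = Cod C g \<Longrightarrow>
      Cod C u = Cod C v \<Longrightarrow> u \<bullet> f = v \<bullet> g \<Longrightarrow>
      \<exists>h \<in> Ar C. Dom C h = Cod C i \<and> Cod C h = Cod C v \<and> h \<bullet> i = u \<and> h \<bullet> j = v"
    "jointly_epic C {i, j} (Cod C i)"
  shows "is_pushout C f g i j"
proof -
  have "\<exists>!h. h \<in> hom C (Cod C i) y \<and> h \<bullet> i = u \<and> h \<bullet> j = v"
    if "u \<in> hom C (Cod C f) y \<and> v \<in> hom C (Cod C g) y \<and> u \<bullet> f = v \<bullet> g" for y u v
  proof -
    note uv = that
    obtain h where "h \<in> hom C (Cod C i) y" "h \<bullet> i = u" "h \<bullet> j = v"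
    proof -
      have "\<exists>h \<in> Ar C. Dom C h = Cod C i \<and> Cod C h = Cod C v \<and> h \<bullet> i = u \<and> h \<bullet> j = v"
        by (rule assms(10)) (use uv in \<open>auto simp: hom_iff\<close>)
      thus thesis using that uv by (auto simp: hom_iff)
    qed
    moreover have "k = k'" if "k \<in> hom C (Cod C i) y \<and> k \<bullet> i = u \<and> k \<bullet> j = v"
      "k' \<in> hom C (Cod C i) y \<and> k' \<bullet> i = u \<and> k' \<bullet> j = v" for k k'
      by (rule jointly_epicD[OF assms(11)]) (use that in \<open>auto simp: hom_iff\<close>)
    ultimately show ?thesis by blast
  qed
  thus ?thesis using assms(1-9) by (auto simp: is_pushout_def)
qed

end

context functor_between
begin

lemma map_arrow [simp]:
  assumes "f \<in> Ar C"
  shows "Fa f \<in> Ar D" "Dom D (Fa f) = Fo (Dom C f)" "Cod D (Fa f) = Fo (Cod C f)"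
  using map_hom[of f "Dom C f" "Cod C f"] assms by (auto simp: hom_iff)

lemma map_compose:
  assumes "f \<in> Ar C" "g \<in> Ar C" "Dom C g = Cod C f"
  shows "Fa (g \<bullet>\<^bsub>C\<^esub> f) = Fa g \<bullet>\<^bsub>D\<^esub> Fa f"
  using map_comp[of f "Dom C f" "Cod C f" g "Cod C g"] assms by (auto simp: hom_iff)

declare map_ob [simp] map_id [simp]

end

text \<open>A left adjoint, given by a universal arrow from the functor to each object \<open>y\<close>. For exhibiting a right
  adjoint this is easier than \<open>adjunction\<close>, since the functoriality and naturality of the right adjoint are consequences.\<close>

locale left_adjoint = functor_between +
  assumes couniversal: "y \<in> Ob D \<Longrightarrow> \<exists>g e. g \<in> Ob C \<and> e \<in> hom D (Fo g) y \<and>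
    (\<forall>x \<in> Ob C. \<forall>k \<in> hom D (Fo x) y. \<exists>!k'. k' \<in> hom C x g \<and> e \<bullet>\<^bsub>D\<^esub> Fa k' = k)"
begin

text \<open>A choice of transposes: \<open>tr x\<close> is inverse to \<open>k \<mapsto> e \<bullet> F k\<close> on the maps \<open>F x \<rightarrow> y\<close>. Working with the universal
  arrow \<open>e\<close> avoids naming a right adjoint functor.\<close>

lemma transposition:
  assumes "y \<in> Ob D"
  obtains g e tr where "g \<in> Ob C" "e \<in> Ar D" "Dom D e = Fo g" "Cod D e = y"
    "\<And>x k. x \<in> Ob C \<Longrightarrow> k \<in> Ar D \<Longrightarrow> Dom D k = Fo x \<Longrightarrow> Cod D k = y \<Longrightarrow>
      tr x k \<in> Ar C \<and> Dom C (tr x k) = x \<and> Cod C (tr x k) = g \<and> e \<bullet>\<^bsub>D\<^esub> Fa (tr x k) = k"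
    "\<And>k k'. k \<in> Ar C \<Longrightarrow> k' \<in> Ar C \<Longrightarrow> Dom C k = Dom C k' \<Longrightarrow> Cod C k = g \<Longrightarrow> Cod C k' = g \<Longrightarrow>
      e \<bullet>\<^bsub>D\<^esub> Fa k = e \<bullet>\<^bsub>D\<^esub> Fa k' \<Longrightarrow> k = k'"
proof -
  obtain g e where ge: "g \<in> Ob C" "e \<in> hom D (Fo g) y"
    and u: "\<And>x k. x \<in> Ob C \<Longrightarrow> k \<in> hom D (Fo x) y \<Longrightarrow> \<exists>!k'. k' \<in> hom C x g \<and> e \<bullet>\<^bsub>D\<^esub> Fa k' = k"
    using couniversal[OF assms] by blast
  let ?tr = "\<lambda>x k. THE k'. k' \<in> hom C x g \<and> e \<bullet>\<^bsub>D\<^esub> Fa k' = k"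
  have tr: "?tr x k \<in> hom C x g \<and> e \<bullet>\<^bsub>D\<^esub> Fa (?tr x k) = k"
    if "x \<in> Ob C" "k \<in> hom D (Fo x) y" for x k
    using theI'[OF u[OF that]] .
  show thesis
  proof
    show "g \<in> Ob C" "e \<in> Ar D" "Dom D e = Fo g" "Cod D e = y" using ge by (auto simp: hom_iff)
    show "?tr x k \<in> Ar C \<and> Dom C (?tr x k) = x \<and> Cod C (?tr x k) = g \<and> e \<bullet>\<^bsub>D\<^esub> Fa (?tr x k) = k"
      if "x \<in> Ob C" "k \<in> Ar D" "Dom D k = Fo x" "Cod D k = y" for x k
      using tr[of x k] that by (auto simp: hom_iff)
    show "k = k'" if "k \<in> Ar C" "k' \<in> Ar C" "Dom C k = Dom C k'" "Cod C k = g" "Cod C k' = g"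
      "e \<bullet>\<^bsub>D\<^esub> Fa k = e \<bullet>\<^bsub>D\<^esub> Fa k'" for k k'
    proof -
      have "\<exists>!k''. k'' \<in> hom C (Dom C k) g \<and> e \<bullet>\<^bsub>D\<^esub> Fa k'' = e \<bullet>\<^bsub>D\<^esub> Fa k"
        by (rule u) (use that ge in \<open>auto simp: hom_iff\<close>)
      thus ?thesis using that by (auto simp: hom_iff)
    qed
  qed
qed

text \<open>If \<open>k \<bullet> F i = k' \<bullet> F i\<close>, then the transposes of \<open>k\<close> and \<open>k'\<close> agree after \<open>i\<close>; hence they agree.\<close>

lemma preserves_jointly_epic:
  assumes I: "jointly_epic C I x"
  shows "jointly_epic D (Fa ` I) (Fo x)"
  unfolding jointly_epic_def
proof (intro conjI ballI impI)
  have x: "x \<in> Ob C" and Ii: "\<And>i. i \<in> I \<Longrightarrow> i \<in> Ar C \<and> Cod C i = x"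
    using I by (auto simp: jointly_epic_def)
  show "Fo x \<in> Ob D" using x by simp
  fix i assume "i \<in> Fa ` I"
  thus "i \<in> Ar D" "Cod D i = Fo x" using Ii by auto
next
  fix k k' assume k: "k \<in> Ar D" "k' \<in> Ar D" and
    kk: "Dom D k = Fo x \<and> Dom D k' = Fo x \<and> Cod D k = Cod D k' \<and> (\<forall>i\<in>Fa ` I. k \<bullet>\<^bsub>D\<^esub> i = k' \<bullet>\<^bsub>D\<^esub> i)"
  have x: "x \<in> Ob C" and Ii: "\<And>i. i \<in> I \<Longrightarrow> i \<in> Ar C \<and> Cod C i = x"
    using I by (auto simp: jointly_epic_def)
  obtain g e tr where e: "g \<in> Ob C" "e \<in> Ar D" "Dom D e = Fo g" "Cod D e = Cod D k"
    and tr: "\<And>x h. x \<in> Ob C \<Longrightarrow> h \<in> Ar D \<Longrightarrow> Dom D h = Fo x \<Longrightarrow> Cod D h = Cod D k \<Longrightarrow>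
      tr x h \<in> Ar C \<and> Dom C (tr x h) = x \<and> Cod C (tr x h) = g \<and> e \<bullet>\<^bsub>D\<^esub> Fa (tr x h) = h"
    and u: "\<And>k k'. k \<in> Ar C \<Longrightarrow> k' \<in> Ar C \<Longrightarrow> Dom C k = Dom C k' \<Longrightarrow> Cod C k = g \<Longrightarrow> Cod C k' = g \<Longrightarrow>
      e \<bullet>\<^bsub>D\<^esub> Fa k = e \<bullet>\<^bsub>D\<^esub> Fa k' \<Longrightarrow> k = k'"
    by (rule transposition[OF D.cod_in_Ob[OF k(1)]]) (rule that)
  have t: "tr x k \<in> Ar C" "Dom C (tr x k) = x" "Cod C (tr x k) = g" "e \<bullet>\<^bsub>D\<^esub> Fa (tr x k) = k"
    "tr x k' \<in> Ar C" "Dom C (tr x k') = x" "Cod C (tr x k') = g" "e \<bullet>\<^bsub>D\<^esub> Fa (tr x k') = k'"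
    using tr[of x k] tr[of x k'] k kk x by auto
  have "tr x k = tr x k'"
  proof (rule jointly_epicD[OF I])
    fix i assume i: "i \<in> I"
    show "tr x k \<bullet>\<^bsub>C\<^esub> i = tr x k' \<bullet>\<^bsub>C\<^esub> i"
    proof (rule u)
      have "e \<bullet>\<^bsub>D\<^esub> Fa (tr x k \<bullet>\<^bsub>C\<^esub> i) = (e \<bullet>\<^bsub>D\<^esub> Fa (tr x k)) \<bullet>\<^bsub>D\<^esub> Fa i"
        using t(1-3) e Ii[OF i] by (simp add: map_compose)
      moreover have "e \<bullet>\<^bsub>D\<^esub> Fa (tr x k' \<bullet>\<^bsub>C\<^esub> i) = (e \<bullet>\<^bsub>D\<^esub> Fa (tr x k')) \<bullet>\<^bsub>D\<^esub> Fa i"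
        using t(5-7) e Ii[OF i] by (simp add: map_compose)
      ultimately show "e \<bullet>\<^bsub>D\<^esub> Fa (tr x k \<bullet>\<^bsub>C\<^esub> i) = e \<bullet>\<^bsub>D\<^esub> Fa (tr x k' \<bullet>\<^bsub>C\<^esub> i)"
        using kk i t by auto
    qed (use t Ii[OF i] in auto)
  qed (use t in auto)
  thus "k = k'" using t by metis
qed

lemma preserves_pushout:
  assumes po: "is_pushout C f g i j"
  shows "is_pushout D (Fa f) (Fa g) (Fa i) (Fa j)"
proof (rule D.is_pushoutI)
  note ar [simp] = C.is_pushoutD[OF po]
  have je: "jointly_epic D (Fa ` {i, j}) (Fo (Cod C i))"
    by (rule preserves_jointly_epic[OF C.pushout_jointly_epic[OF po]])
  thus "jointly_epic D {Fa i, Fa j} (Cod D (Fa i))" by simp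
  show "Fa i \<bullet>\<^bsub>D\<^esub> Fa f = Fa j \<bullet>\<^bsub>D\<^esub> Fa g"
    using map_compose[of f i] map_compose[of g j] by simp
  fix u v assume uv: "u \<in> Ar D" "v \<in> Ar D" "Dom D u = Cod D (Fa f)" "Dom D v = Cod D (Fa g)"
    "Cod D u = Cod D v" "u \<bullet>\<^bsub>D\<^esub> Fa f = v \<bullet>\<^bsub>D\<^esub> Fa g"
  have y: "Cod D v \<in> Ob D" using uv by simp
  obtain z e tr where e: "z \<in> Ob C" "e \<in> Ar D" "Dom D e = Fo z" "Cod D e = Cod D v"
    and tr: "\<And>x h. x \<in> Ob C \<Longrightarrow> h \<in> Ar D \<Longrightarrow> Dom D h = Fo x \<Longrightarrow> Cod D h = Cod D v \<Longrightarrow>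
      tr x h \<in> Ar C \<and> Dom C (tr x h) = x \<and> Cod C (tr x h) = z \<and> e \<bullet>\<^bsub>D\<^esub> Fa (tr x h) = h"
    and un: "\<And>k k'. k \<in> Ar C \<Longrightarrow> k' \<in> Ar C \<Longrightarrow> Dom C k = Dom C k' \<Longrightarrow> Cod C k = z \<Longrightarrow> Cod C k' = z \<Longrightarrow>
      e \<bullet>\<^bsub>D\<^esub> Fa k = e \<bullet>\<^bsub>D\<^esub> Fa k' \<Longrightarrow> k = k'"
    by (rule transposition[OF y]) (rule that)
  define u' where "u' = tr (Cod C f) u"
  define v' where "v' = tr (Cod C g) v"
  have t: "u' \<in> Ar C" "Dom C u' = Cod C f" "Cod C u' = z" "e \<bullet>\<^bsub>D\<^esub> Fa u' = u"
    "v' \<in> Ar C" "Dom C v' = Cod C g" "Cod C v' = z" "e \<bullet>\<^bsub>D\<^esub> Fa v' = v"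
    using tr[of "Cod C f" u] tr[of "Cod C g" v] uv by (auto simp: u'_def v'_def)
  have "u' \<bullet>\<^bsub>C\<^esub> f = v' \<bullet>\<^bsub>C\<^esub> g"
  proof (rule un)
    have "e \<bullet>\<^bsub>D\<^esub> Fa (u' \<bullet>\<^bsub>C\<^esub> f) = (e \<bullet>\<^bsub>D\<^esub> Fa u') \<bullet>\<^bsub>D\<^esub> Fa f"
      using t(1-3) e by (simp add: map_compose)
    moreover have "e \<bullet>\<^bsub>D\<^esub> Fa (v' \<bullet>\<^bsub>C\<^esub> g) = (e \<bullet>\<^bsub>D\<^esub> Fa v') \<bullet>\<^bsub>D\<^esub> Fa g"
      using t(5-7) e by (simp add: map_compose)
    ultimately show "e \<bullet>\<^bsub>D\<^esub> Fa (u' \<bullet>\<^bsub>C\<^esub> f) = e \<bullet>\<^bsub>D\<^esub> Fa (v' \<bullet>\<^bsub>C\<^esub> g)"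
      using uv t by simp
  qed (use t in auto)
  then obtain h where h: "h \<in> Ar C" "Dom C h = Cod C i" "Cod C h = z" "h \<bullet>\<^bsub>C\<^esub> i = u'" "h \<bullet>\<^bsub>C\<^esub> j = v'"
    using C.is_pushout_desc[OF po, of u' v'] t by metis
  have "(e \<bullet>\<^bsub>D\<^esub> Fa h) \<bullet>\<^bsub>D\<^esub> Fa i = u" "(e \<bullet>\<^bsub>D\<^esub> Fa h) \<bullet>\<^bsub>D\<^esub> Fa j = v"
    using h e t map_compose[of i h] map_compose[of j h] by auto
  moreover have "e \<bullet>\<^bsub>D\<^esub> Fa h \<in> Ar D" "Dom D (e \<bullet>\<^bsub>D\<^esub> Fa h) = Cod D (Fa i)"
    "Cod D (e \<bullet>\<^bsub>D\<^esub> Fa h) = Cod D v" using h e by auto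
  ultimately show "\<exists>h \<in> Ar D. Dom D h = Cod D (Fa i) \<and> Cod D h = Cod D v \<and>
     h \<bullet>\<^bsub>D\<^esub> Fa i = u \<and> h \<bullet>\<^bsub>D\<^esub> Fa j = v" by blast
qed (use C.is_pushoutD[OF po] in auto)

lemma preserves_initial:
  assumes "is_initial C x"
  shows "is_initial D (Fo x)"
  unfolding is_initial_def
proof (intro conjI ballI)
  have x: "x \<in> Ob C" and i: "\<And>y. y \<in> Ob C \<Longrightarrow> \<exists>!f. f \<in> hom C x y"
    using assms by (auto simp: is_initial_def)
  show "Fo x \<in> Ob D" using x by simp
  fix y assume y: "y \<in> Ob D"
  obtain z e tr where e: "z \<in> Ob C" "e \<in> Ar D" "Dom D e = Fo z" "Cod D e = y"
    and tr: "\<And>x h. x \<in> Ob C \<Longrightarrow> h \<in> Ar D \<Longrightarrow> Dom D h = Fo x \<Longrightarrow> Cod D h = y \<Longrightarrow>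
      tr x h \<in> Ar C \<and> Dom C (tr x h) = x \<and> Cod C (tr x h) = z \<and> e \<bullet>\<^bsub>D\<^esub> Fa (tr x h) = h"
    and "\<And>k k'. k \<in> Ar C \<Longrightarrow> k' \<in> Ar C \<Longrightarrow> Dom C k = Dom C k' \<Longrightarrow> Cod C k = z \<Longrightarrow> Cod C k' = z \<Longrightarrow>
      e \<bullet>\<^bsub>D\<^esub> Fa k = e \<bullet>\<^bsub>D\<^esub> Fa k' \<Longrightarrow> k = k'"
    by (rule transposition[OF y]) (rule that)
  obtain f where f0: "f \<in> hom C x z" and f: "\<And>f'. f' \<in> hom C x z \<Longrightarrow> f' = f"
    using i[OF e(1)] by (elim ex1E) blast
  have "e \<bullet>\<^bsub>D\<^esub> Fa f \<in> hom D (Fo x) y" using e f0 by (simp add: hom_iff)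
  moreover have "k = e \<bullet>\<^bsub>D\<^esub> Fa f" if "k \<in> hom D (Fo x) y" for k
  proof -
    have k: "tr x k \<in> hom C x z" "e \<bullet>\<^bsub>D\<^esub> Fa (tr x k) = k" using tr[OF x, of k] that by (simp_all add: hom_iff)
    thus ?thesis using f[OF k(1)] by simp
  qed
  ultimately show "\<exists>!k. k \<in> hom D (Fo x) y" by blast
qed

text \<open>The right adjoint sends \<open>h : y \<rightarrow> y'\<close> to the transpose of \<open>h \<bullet> e y\<close>; functoriality and naturality follow
  from uniqueness of transposes.\<close>

lemma has_right_adjoint: "\<exists>Go Ga \<phi>. adjunction C D Fo Fa Go Ga \<phi>"
proof -
  have "\<forall>y \<in> Ob D. \<exists>g e. g \<in> Ob C \<and> e \<in> hom D (Fo g) y \<and>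
    (\<forall>x \<in> Ob C. \<forall>k \<in> hom D (Fo x) y. \<exists>!k'. k' \<in> hom C x g \<and> e \<bullet>\<^bsub>D\<^esub> Fa k' = k)"
    using couniversal by blast
  then obtain G e where G: "\<And>y. y \<in> Ob D \<Longrightarrow> G y \<in> Ob C"
    and e: "\<And>y. y \<in> Ob D \<Longrightarrow> e y \<in> hom D (Fo (G y)) y"
    and u: "\<And>x y k. y \<in> Ob D \<Longrightarrow> x \<in> Ob C \<Longrightarrow> k \<in> hom D (Fo x) y \<Longrightarrow>
      \<exists>!k'. k' \<in> hom C x (G y) \<and> e y \<bullet>\<^bsub>D\<^esub> Fa k' = k"
    by metis
  define \<phi> where "\<phi> x y k = (THE k'. k' \<in> hom C x (G y) \<and> e y \<bullet>\<^bsub>D\<^esub> Fa k' = k)" for x y k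
  have \<phi>: "\<phi> x y k \<in> hom C x (G y)" "e y \<bullet>\<^bsub>D\<^esub> Fa (\<phi> x y k) = k"
    if "y \<in> Ob D" "x \<in> Ob C" "k \<in> hom D (Fo x) y" for x y k
    using theI'[OF u[OF that]] unfolding \<phi>_def by auto
  have \<phi>_eq: "\<phi> x y k = k'"
    if "y \<in> Ob D" "k' \<in> hom C x (G y)" "e y \<bullet>\<^bsub>D\<^esub> Fa k' = k" for x y k k'
  proof -
    have "x \<in> Ob C" "k \<in> hom D (Fo x) y" using that e[of y] by (auto simp: hom_iff)
    from u[OF that(1) this] \<phi>[OF that(1) this] that(2,3) show ?thesis by blast
  qed
  define Ga where "Ga h = \<phi> (G (Dom D h)) (Cod D h) (h \<bullet>\<^bsub>D\<^esub> e (Dom D h))" for h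
  have e': "e y \<in> Ar D" "Dom D (e y) = Fo (G y)" "Cod D (e y) = y" if "y \<in> Ob D" for y
    using e[OF that] by (auto simp: hom_iff)
  have Ga: "Ga h \<in> Ar C" "Dom C (Ga h) = G (Dom D h)" "Cod C (Ga h) = G (Cod D h)"
    "e (Cod D h) \<bullet>\<^bsub>D\<^esub> Fa (Ga h) = h \<bullet>\<^bsub>D\<^esub> e (Dom D h)" if "h \<in> Ar D" for h
    using \<phi>[of "Cod D h" "G (Dom D h)" "h \<bullet>\<^bsub>D\<^esub> e (Dom D h)"] that e' G
    by (auto simp: Ga_def hom_iff)
  have "adjunction C D Fo Fa G Ga \<phi>"
  proof unfold_locales
    show "G x \<in> Ob C" if "x \<in> Ob D" for x using G that .
    show "Ga f \<in> hom C (G x) (G y)" if "f \<in> hom D x y" for f x y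
      using that Ga by (auto simp: hom_iff)
    show "Ga (Id D x) = Id C (G x)" if "x \<in> Ob D" for x
      unfolding Ga_def by (rule \<phi>_eq) (use that G e' in \<open>auto simp: hom_iff\<close>)
    show "Ga (g \<bullet>\<^bsub>D\<^esub> f) = Ga g \<bullet>\<^bsub>C\<^esub> Ga f" if "f \<in> hom D x y" "g \<in> hom D y z" for f g x y z
    proof -
      have fg: "f \<in> Ar D" "Dom D f = x" "Cod D f = y" "g \<in> Ar D" "Dom D g = y" "Cod D g = z"
        using that by (auto simp: hom_iff)
      have xyz: "x \<in> Ob D" "y \<in> Ob D" "z \<in> Ob D" using fg by auto
      have "e z \<bullet>\<^bsub>D\<^esub> Fa (Ga g \<bullet>\<^bsub>C\<^esub> Ga f) = (e z \<bullet>\<^bsub>D\<^esub> Fa (Ga g)) \<bullet>\<^bsub>D\<^esub> Fa (Ga f)"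
        using Ga(1-3)[of f] Ga(1-3)[of g] fg e' xyz by (simp add: map_compose)
      also have "\<dots> = g \<bullet>\<^bsub>D\<^esub> (e y \<bullet>\<^bsub>D\<^esub> Fa (Ga f))"
        using Ga[of f] Ga[of g] fg e' xyz by simp
      also have "\<dots> = (g \<bullet>\<^bsub>D\<^esub> f) \<bullet>\<^bsub>D\<^esub> e x" using Ga[of f] fg e' xyz by simp
      finally have "e z \<bullet>\<^bsub>D\<^esub> Fa (Ga g \<bullet>\<^bsub>C\<^esub> Ga f) = (g \<bullet>\<^bsub>D\<^esub> f) \<bullet>\<^bsub>D\<^esub> e x" .
      hence "\<phi> (G x) z ((g \<bullet>\<^bsub>D\<^esub> f) \<bullet>\<^bsub>D\<^esub> e x) = Ga g \<bullet>\<^bsub>C\<^esub> Ga f"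
        by (intro \<phi>_eq) (use fg xyz Ga in \<open>auto simp: hom_iff\<close>)
      thus ?thesis unfolding Ga_def[of "g \<bullet>\<^bsub>D\<^esub> f"] using fg by simp
    qed
    show "bij_betw (\<phi> x y) (hom D (Fo x) y) (hom C x (G y))" if "x \<in> Ob C" "y \<in> Ob D" for x y
    proof (rule bij_betw_byWitness[where f' = "\<lambda>k'. e y \<bullet>\<^bsub>D\<^esub> Fa k'"])
      show "\<forall>k \<in> hom D (Fo x) y. e y \<bullet>\<^bsub>D\<^esub> Fa (\<phi> x y k) = k" using \<phi> that by blast
      show "\<forall>k' \<in> hom C x (G y). \<phi> x y (e y \<bullet>\<^bsub>D\<^esub> Fa k') = k'" using \<phi>_eq that by blast
      show "\<phi> x y ` hom D (Fo x) y \<subseteq> hom C x (G y)" using \<phi> that by blast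
      show "(\<lambda>k'. e y \<bullet>\<^bsub>D\<^esub> Fa k') ` hom C x (G y) \<subseteq> hom D (Fo x) y"
        using that e' by (auto simp: hom_iff)
    qed
    show "\<phi> x' y' (h \<bullet>\<^bsub>D\<^esub> (f \<bullet>\<^bsub>D\<^esub> Fa k)) = Ga h \<bullet>\<^bsub>C\<^esub> (\<phi> x y f \<bullet>\<^bsub>C\<^esub> k)"
      if "x \<in> Ob C" "y \<in> Ob D" "k \<in> hom C x' x" "h \<in> hom D y y'" "f \<in> hom D (Fo x) y"
      for x y k x' h y' f
    proof (rule \<phi>_eq)
      have p: "\<phi> x y f \<in> Ar C" "Dom C (\<phi> x y f) = x" "Cod C (\<phi> x y f) = G y"
         "e y \<bullet>\<^bsub>D\<^esub> Fa (\<phi> x y f) = f" using \<phi>[of y x f] that by (auto simp: hom_iff)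
      have kh: "k \<in> Ar C" "Dom C k = x'" "Cod C k = x" "h \<in> Ar D" "Dom D h = y" "Cod D h = y'"
        "f \<in> Ar D" "Dom D f = Fo x" "Cod D f = y"
        using that by (auto simp: hom_iff)
      have y': "y' \<in> Ob D" "x' \<in> Ob C" using kh by auto
      show "y' \<in> Ob D" by fact
      show "Ga h \<bullet>\<^bsub>C\<^esub> (\<phi> x y f \<bullet>\<^bsub>C\<^esub> k) \<in> hom C x' (G y')"
        using p(1-3) kh Ga(1-3)[of h] by (auto simp: hom_iff)
      have "e y' \<bullet>\<^bsub>D\<^esub> Fa (Ga h \<bullet>\<^bsub>C\<^esub> (\<phi> x y f \<bullet>\<^bsub>C\<^esub> k)) =
        (e y' \<bullet>\<^bsub>D\<^esub> Fa (Ga h)) \<bullet>\<^bsub>D\<^esub> (Fa (\<phi> x y f) \<bullet>\<^bsub>D\<^esub> Fa k)"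
        using p(1-3) kh Ga(1-3)[of h] e' y' by (simp add: map_compose)
      also have "\<dots> = h \<bullet>\<^bsub>D\<^esub> ((e y \<bullet>\<^bsub>D\<^esub> Fa (\<phi> x y f)) \<bullet>\<^bsub>D\<^esub> Fa k)"
        using p(1-3) kh Ga[of h] e' y' that(2) by simp
      also have "\<dots> = h \<bullet>\<^bsub>D\<^esub> (f \<bullet>\<^bsub>D\<^esub> Fa k)" using p by simp
      finally show "e y' \<bullet>\<^bsub>D\<^esub> Fa (Ga h \<bullet>\<^bsub>C\<^esub> (\<phi> x y f \<bullet>\<^bsub>C\<^esub> k)) = h \<bullet>\<^bsub>D\<^esub> (f \<bullet>\<^bsub>D\<^esub> Fa k)" .
    qed
  qed
  thus ?thesis by blast
qed

end

text \<open>The universal arrow at \<open>y\<close> is the counit, the map corresponding to the identity of \<open>G y\<close>.\<close>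

lemma (in adjunction) is_left_adjoint: "left_adjoint C D Fo Fa"
proof (intro_locales, unfold left_adjoint_axioms_def, intro allI impI)
  fix y assume y: "y \<in> Ob D"
  have b: "bij_betw (\<phi> (Go y) y) (hom D (Fo (Go y)) y) (hom C (Go y) (Go y))"
    using bij y G.map_ob by blast
  have "Id C (Go y) \<in> hom C (Go y) (Go y)" using y by (simp add: hom_iff)
  with b obtain e where e: "e \<in> hom D (Fo (Go y)) y" "\<phi> (Go y) y e = Id C (Go y)"
    unfolding bij_betw_def by (metis imageE)
  have key: "\<phi> x y (e \<bullet>\<^bsub>D\<^esub> Fa k) = k" if "k \<in> hom C x (Go y)" for x k
  proof -
    have "Id D y \<in> hom D y y" using y by (simp add: hom_iff)
    from natural[OF _ y that this e(1)]
    have "\<phi> x y (Id D y \<bullet>\<^bsub>D\<^esub> (e \<bullet>\<^bsub>D\<^esub> Fa k)) = Ga (Id D y) \<bullet>\<^bsub>C\<^esub> (\<phi> (Go y) y e \<bullet>\<^bsub>C\<^esub> k)"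
      using y by simp
    thus ?thesis using that e y by (simp add: hom_iff)
  qed
  have "\<exists>!k'. k' \<in> hom C x (Go y) \<and> e \<bullet>\<^bsub>D\<^esub> Fa k' = k" if x: "x \<in> Ob C" and k: "k \<in> hom D (Fo x) y" for x k
  proof -
    have b: "bij_betw (\<phi> x y) (hom D (Fo x) y) (hom C x (Go y))" using bij x y by blast
    hence m: "\<phi> x y k \<in> hom C x (Go y)" using k by (auto simp: bij_betw_def)
    have "e \<bullet>\<^bsub>D\<^esub> Fa (\<phi> x y k) \<in> hom D (Fo x) y" using m e by (auto simp: hom_iff)
    hence *: "e \<bullet>\<^bsub>D\<^esub> Fa (\<phi> x y k) = k"
      using key[OF m] b k unfolding bij_betw_def inj_on_def by blast
    show ?thesis
    proof (rule ex1I)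
      show "\<phi> x y k \<in> hom C x (Go y) \<and> e \<bullet>\<^bsub>D\<^esub> Fa (\<phi> x y k) = k" using m * ..
      show "k' = \<phi> x y k" if "k' \<in> hom C x (Go y) \<and> e \<bullet>\<^bsub>D\<^esub> Fa k' = k" for k'
        using key[of k' x] that by metis
    qed
  qed
  thus "\<exists>g e. g \<in> Ob C \<and> e \<in> hom D (Fo g) y \<and>
    (\<forall>x \<in> Ob C. \<forall>k \<in> hom D (Fo x) y. \<exists>!k'. k' \<in> hom C x g \<and> e \<bullet>\<^bsub>D\<^esub> Fa k' = k)"
    using e y G.map_ob by blast
qed

section \<open>Pushouts, pullbacks and initial objects in bicomplete categories\<close>

locale category_with_pushouts = category +
  assumes pushout_exists: "\<lbrakk>f \<in> Ar C; g \<in> Ar C; Dom C f = Dom C g\<rbrakk> \<Longrightarrow> \<exists>i j. is_pushout C f g i j"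
begin

lemma is_pushout_po:
  assumes "f \<in> Ar C" "g \<in> Ar C" "Dom C f = Dom C g"
  shows "is_pushout C f g (po_in1 C f g) (po_in2 C f g)"
proof -
  have "\<exists>p. case p of (i, j) \<Rightarrow> is_pushout C f g i j" using pushout_exists[OF assms] by auto
  hence "case pushout C f g of (i, j) \<Rightarrow> is_pushout C f g i j"
    unfolding pushout_def by (rule someI_ex)
  thus ?thesis by (simp add: po_in1_def po_in2_def case_prod_beta)
qed

lemma po_arrow [simp]:
  assumes "f \<in> Ar C" "g \<in> Ar C" "Dom C f = Dom C g"
  shows "po_in1 C f g \<in> Ar C" "Dom C (po_in1 C f g) = Cod C f" "Cod C (po_in1 C f g) = po_ob C f g"
    "po_in2 C f g \<in> Ar C" "Dom C (po_in2 C f g) = Cod C g" "Cod C (po_in2 C f g) = po_ob C f g"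
    "po_ob C f g \<in> Ob C"
  using is_pushoutD[OF is_pushout_po[OF assms]] by (auto simp: po_ob_def)

lemma po_commutes:
  assumes "f \<in> Ar C" "g \<in> Ar C" "Dom C f = Dom C g"
  shows "po_in1 C f g \<bullet> f = po_in2 C f g \<bullet> g"
  using is_pushoutD[OF is_pushout_po[OF assms]] by auto

lemma po_ext:
  assumes "f \<in> Ar C" "g \<in> Ar C" "Dom C f = Dom C g"
    and "k \<in> Ar C" "k' \<in> Ar C" "Dom C k = po_ob C f g" "Dom C k' = po_ob C f g" "Cod C k = Cod C k'"
    and "k \<bullet> po_in1 C f g = k' \<bullet> po_in1 C f g" "k \<bullet> po_in2 C f g = k' \<bullet> po_in2 C f g"
  shows "k = k'"
  by (rule jointly_epicD[OF pushout_jointly_epic[OF is_pushout_po[OF assms(1-3)]]])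
    (use assms in auto)

lemma po_desc:
  assumes "f \<in> Ar C" "g \<in> Ar C" "Dom C f = Dom C g"
    and "u \<in> Ar C" "v \<in> Ar C" "Dom C u = Cod C f" "Dom C v = Cod C g" "Cod C u = Cod C v"
    and "u \<bullet> f = v \<bullet> g"
  shows "po_desc C f g u v \<in> Ar C" "Dom C (po_desc C f g u v) = po_ob C f g"
    "Cod C (po_desc C f g u v) = Cod C v"
    "po_desc C f g u v \<bullet> po_in1 C f g = u" "po_desc C f g u v \<bullet> po_in2 C f g = v"
proof -
  let ?P = "\<lambda>h. h \<in> hom C (po_ob C f g) (Cod C u) \<and> h \<bullet> po_in1 C f g = u \<and> h \<bullet> po_in2 C f g = v"
  have "\<exists>!h. ?P h"
  proof (rule ex_ex1I)
    show "\<exists>h. ?P h"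
      by (rule is_pushout_desc[OF is_pushout_po[OF assms(1-3)] assms(4-9)])
        (use assms in \<open>auto simp: hom_iff\<close>)
    show "k = k'" if "?P k" "?P k'" for k k'
      by (rule po_ext[OF assms(1-3)]) (use that in \<open>auto simp: hom_iff\<close>)
  qed
  from theI'[OF this] show "po_desc C f g u v \<in> Ar C" "Dom C (po_desc C f g u v) = po_ob C f g"
    "Cod C (po_desc C f g u v) = Cod C v"
    "po_desc C f g u v \<bullet> po_in1 C f g = u" "po_desc C f g u v \<bullet> po_in2 C f g = v"
    using assms(8) by (auto simp: hom_iff po_desc_def)
qed

end

definition is_pullback :: "('o, 'a, 'm) precategory_scheme \<Rightarrow> 'a \<Rightarrow> 'a \<Rightarrow> 'a \<Rightarrow> 'a \<Rightarrow> bool" where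
  "is_pullback C f g p q \<longleftrightarrow>
     f \<in> Ar C \<and> g \<in> Ar C \<and> p \<in> Ar C \<and> q \<in> Ar C \<and> Cod C f = Cod C g \<and>
     Cod C p = Dom C f \<and> Cod C q = Dom C g \<and> Dom C p = Dom C q \<and>
     f \<bullet>\<^bsub>C\<^esub> p = g \<bullet>\<^bsub>C\<^esub> q \<and>
     (\<forall>y u v. u \<in> hom C y (Dom C f) \<and> v \<in> hom C y (Dom C g) \<and> f \<bullet>\<^bsub>C\<^esub> u = g \<bullet>\<^bsub>C\<^esub> v \<longrightarrow>
        (\<exists>!h. h \<in> hom C y (Dom C p) \<and> p \<bullet>\<^bsub>C\<^esub> h = u \<and> q \<bullet>\<^bsub>C\<^esub> h = v))"

text \<open>Index categories must have their objects and arrows in \<open>'i\<close>, an arbitrary infinite type, so the shape of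
  spans is named by the values of an injection \<open>e\<close>: at \<open>0, 1, 2\<close> the apex, the two feet and their identities,
  at \<open>3, 4\<close> the legs from the apex.\<close>

definition span_shape :: "(nat \<Rightarrow> 'i) \<Rightarrow> ('i, 'i) precategory" where
  "span_shape e = \<lparr>
     Ob = {e 0, e 1, e 2}, Ar = {e 0, e 1, e 2, e 3, e 4},
     Dom = (\<lambda>x. if x = e 1 \<or> x = e 2 then x else e 0),
     Cod = (\<lambda>x. if x = e 3 then e 1 else if x = e 4 then e 2 else x),
     Id = (\<lambda>x. x),
     Comp = (\<lambda>y x. if y = e 3 \<or> y = e 4 then y else x)\<rparr>"

text \<open>The opposite shape, with the same names.\<close>

definition cospan_shape :: "(nat \<Rightarrow> 'i) \<Rightarrow> ('i, 'i) precategory" where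
  "cospan_shape e = \<lparr>
     Ob = {e 0, e 1, e 2}, Ar = {e 0, e 1, e 2, e 3, e 4},
     Dom = (\<lambda>x. if x = e 3 then e 1 else if x = e 4 then e 2 else x),
     Cod = (\<lambda>x. if x = e 1 \<or> x = e 2 then x else e 0),
     Id = (\<lambda>x. x),
     Comp = (\<lambda>y x. if x = e 3 \<or> x = e 4 then x else y)\<rparr>"

lemma distinct_names:
  assumes "inj (e :: nat \<Rightarrow> 'i)"
  shows "e 0 \<noteq> e 1" "e 0 \<noteq> e 2" "e 0 \<noteq> e 3" "e 0 \<noteq> e 4" "e 1 \<noteq> e 2" "e 1 \<noteq> e 3" "e 1 \<noteq> e 4"
    "e 2 \<noteq> e 3" "e 2 \<noteq> e 4" "e 3 \<noteq> e 4"
  using assms by (auto simp: inj_eq)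

lemma category_span_shape: "inj e \<Longrightarrow> category (span_shape e)"
  by (unfold_locales; use distinct_names[of e] in \<open>auto simp: span_shape_def hom_iff\<close>)

lemma category_cospan_shape: "inj e \<Longrightarrow> category (cospan_shape e)"
  by (unfold_locales; use distinct_names[of e] in \<open>auto simp: cospan_shape_def hom_iff\<close>)

lemma bicomplete_category: "bicomplete small C \<Longrightarrow> category C"
  by (simp add: bicomplete_def)

lemma bicomplete_limit:
  fixes small :: "'i::infinite itself" and J :: "('i, 'i) precategory"
  assumes "bicomplete small C" "functor_between J C Do Da" "Ar J \<prec> (UNIV :: 'i set)"
  obtains x l where "is_limit J C Do Da x l"
  using assms unfolding bicomplete_def by blast

lemma bicomplete_colimit:
  fixes small :: "'i::infinite itself" and J :: "('i, 'i) precategory"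
  assumes "bicomplete small C" "functor_between J C Do Da" "Ar J \<prec> (UNIV :: 'i set)"
  obtains x l where "is_colimit J C Do Da x l"
  using assms unfolding bicomplete_def by blast

lemma infinite_names:
  obtains e :: "nat \<Rightarrow> 'i::infinite" where "inj e"
  using infinite_countable_subset[OF infinite_UNIV] by blast

text \<open>A cocone over a span is determined by its two outer legs, the third being a composite; and the span
  shape is small because it is finite while \<open>'i\<close> is infinite.\<close>

lemma bicomplete_has_pushouts:
  fixes small :: "'i::infinite itself" and C :: "('o, 'a, 'm) precategory_scheme" (structure)
  assumes bc: "bicomplete small C" and fg: "f \<in> Ar C" "g \<in> Ar C" "Dom C f = Dom C g"
  shows "\<exists>i j. is_pushout C f g i j"
proof -
  interpret category C using bc by (rule bicomplete_category)
  obtain e :: "nat \<Rightarrow> 'i" where e: "inj e" by (rule infinite_names)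
  note d = distinct_names[OF e]
  let ?J = "span_shape e"
  interpret J: category ?J by (rule category_span_shape[OF e])
  define Do where "Do x = (if x = e 1 then Cod C f else if x = e 2 then Cod C g else Dom C f)" for x
  define Da where "Da x = (if x = e 3 then f else if x = e 4 then g else Id C (Do x))" for x
  have F: "functor_between ?J C Do Da"
    by (unfold_locales; use d fg in \<open>auto simp: span_shape_def hom_iff Do_def Da_def\<close>)
  have "Ar ?J \<prec> (UNIV :: 'i set)" by (rule finite_lesspoll_infinite[OF infinite_UNIV]) (simp add: span_shape_def)
  with bc F obtain x l where xl: "is_colimit ?J C Do Da x l" by (rule bicomplete_colimit)
  have cc: "is_cocone ?J C Do Da y m \<longleftrightarrow> y \<in> Ob C \<and> m (e 1) \<in> hom C (Cod C f) y \<and>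
      m (e 2) \<in> hom C (Cod C g) y \<and> m (e 0) = m (e 1) \<bullet> f \<and> m (e 1) \<bullet> f = m (e 2) \<bullet> g" for y m
    using d d[symmetric] fg by (auto simp: is_cocone_def span_shape_def Do_def Da_def hom_iff)
  have l: "x \<in> Ob C" "l (e 1) \<in> hom C (Cod C f) x" "l (e 2) \<in> hom C (Cod C g) x"
    "l (e 0) = l (e 1) \<bullet> f" "l (e 1) \<bullet> f = l (e 2) \<bullet> g"
    using xl cc by (auto simp: is_colimit_def)
  have uni: "\<exists>!h. h \<in> hom C x y \<and> h \<bullet> l (e 1) = u \<and> h \<bullet> l (e 2) = v"
    if uv: "u \<in> hom C (Cod C f) y" "v \<in> hom C (Cod C g) y" "u \<bullet> f = v \<bullet> g" for y u v
  proof -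
    define m where "m k = (if k = e 1 then u else if k = e 2 then v else u \<bullet> f)" for k
    have m: "m (e 0) = u \<bullet> f" "m (e 1) = u" "m (e 2) = v" using d by (auto simp: m_def)
    have "is_cocone ?J C Do Da y m" unfolding cc m using uv by (auto simp: hom_iff)
    hence "\<exists>!h. h \<in> hom C x y \<and> (\<forall>j\<in>Ob ?J. h \<bullet> l j = m j)" using xl by (auto simp: is_colimit_def)
    moreover have "(h \<in> hom C x y \<and> (\<forall>j\<in>Ob ?J. h \<bullet> l j = m j)) \<longleftrightarrow>
      (h \<in> hom C x y \<and> h \<bullet> l (e 1) = u \<and> h \<bullet> l (e 2) = v)" for h
    proof -
      have "h \<bullet> l (e 0) = u \<bullet> f" if "h \<in> hom C x y" "h \<bullet> l (e 1) = u"
      proof -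
        have "(h \<bullet> l (e 1)) \<bullet> f = h \<bullet> (l (e 1) \<bullet> f)" using that(1) l(1-3) fg by (simp add: hom_iff)
        thus ?thesis using that l by simp
      qed
      thus ?thesis using m by (auto simp: span_shape_def)
    qed
    ultimately show ?thesis by simp
  qed
  have "is_pushout C f g (l (e 1)) (l (e 2))"
    unfolding is_pushout_def using l fg uni by (auto simp: hom_iff)
  thus ?thesis by blast
qed

lemma bicomplete_has_pullbacks:
  fixes small :: "'i::infinite itself" and C :: "('o, 'a, 'm) precategory_scheme" (structure)
  assumes bc: "bicomplete small C" and fg: "f \<in> Ar C" "g \<in> Ar C" "Cod C f = Cod C g"
  shows "\<exists>p q. is_pullback C f g p q"
proof -
  interpret category C using bc by (rule bicomplete_category)
  obtain e :: "nat \<Rightarrow> 'i" where e: "inj e" by (rule infinite_names)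
  note d = distinct_names[OF e]
  let ?J = "cospan_shape e"
  interpret J: category ?J by (rule category_cospan_shape[OF e])
  define Do where "Do x = (if x = e 1 then Dom C f else if x = e 2 then Dom C g else Cod C f)" for x
  define Da where "Da x = (if x = e 3 then f else if x = e 4 then g else Id C (Do x))" for x
  have F: "functor_between ?J C Do Da"
    by (unfold_locales; use d fg in \<open>auto simp: cospan_shape_def hom_iff Do_def Da_def\<close>)
  have "Ar ?J \<prec> (UNIV :: 'i set)" by (rule finite_lesspoll_infinite[OF infinite_UNIV]) (simp add: cospan_shape_def)
  with bc F obtain x l where xl: "is_limit ?J C Do Da x l" by (rule bicomplete_limit)
  have cc: "is_cone ?J C Do Da y m \<longleftrightarrow> y \<in> Ob C \<and> m (e 1) \<in> hom C y (Dom C f) \<and>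
      m (e 2) \<in> hom C y (Dom C g) \<and> m (e 0) = f \<bullet> m (e 1) \<and> f \<bullet> m (e 1) = g \<bullet> m (e 2)" for y m
    using d d[symmetric] fg by (auto simp: is_cone_def cospan_shape_def Do_def Da_def hom_iff)
  have l: "x \<in> Ob C" "l (e 1) \<in> hom C x (Dom C f)" "l (e 2) \<in> hom C x (Dom C g)"
    "l (e 0) = f \<bullet> l (e 1)" "f \<bullet> l (e 1) = g \<bullet> l (e 2)"
    using xl cc by (auto simp: is_limit_def)
  have uni: "\<exists>!h. h \<in> hom C y x \<and> l (e 1) \<bullet> h = u \<and> l (e 2) \<bullet> h = v"
    if uv: "u \<in> hom C y (Dom C f)" "v \<in> hom C y (Dom C g)" "f \<bullet> u = g \<bullet> v" for y u v
  proof -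
    define m where "m k = (if k = e 1 then u else if k = e 2 then v else f \<bullet> u)" for k
    have m: "m (e 0) = f \<bullet> u" "m (e 1) = u" "m (e 2) = v" using d by (auto simp: m_def)
    have "is_cone ?J C Do Da y m" unfolding cc m using uv by (auto simp: hom_iff)
    hence "\<exists>!h. h \<in> hom C y x \<and> (\<forall>j\<in>Ob ?J. l j \<bullet> h = m j)" using xl by (auto simp: is_limit_def)
    moreover have "(h \<in> hom C y x \<and> (\<forall>j\<in>Ob ?J. l j \<bullet> h = m j)) \<longleftrightarrow>
      (h \<in> hom C y x \<and> l (e 1) \<bullet> h = u \<and> l (e 2) \<bullet> h = v)" for h
    proof -
      have "l (e 0) \<bullet> h = f \<bullet> u" if "h \<in> hom C y x" "l (e 1) \<bullet> h = u"
      proof -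
        have "f \<bullet> (l (e 1) \<bullet> h) = (f \<bullet> l (e 1)) \<bullet> h" using that(1) l(1-3) fg by (simp add: hom_iff)
        thus ?thesis using that l by simp
      qed
      thus ?thesis using m by (auto simp: cospan_shape_def)
    qed
    ultimately show ?thesis by simp
  qed
  have "is_pullback C f g (l (e 1)) (l (e 2))"
    unfolding is_pullback_def using l fg uni by (auto simp: hom_iff)
  thus ?thesis by blast
qed

lemma bicomplete_has_initial:
  fixes small :: "'i::infinite itself" and C :: "('o, 'a, 'm) precategory_scheme" (structure)
  assumes bc: "bicomplete small C"
  shows "\<exists>x. is_initial C x"
proof -
  interpret category C using bc by (rule bicomplete_category)
  define J :: "('i, 'i) precategory" where
    "J = \<lparr>Ob = {}, Ar = {}, Dom = (\<lambda>x. x), Cod = (\<lambda>x. x), Id = (\<lambda>x. x), Comp = (\<lambda>y x. x)\<rparr>"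
  interpret J: category J by unfold_locales (auto simp: J_def hom_iff)
  have F: "functor_between J C (\<lambda>x. undefined) (\<lambda>x. undefined)"
    by unfold_locales (auto simp: J_def hom_iff)
  have "Ar J \<prec> (UNIV :: 'i set)" by (rule finite_lesspoll_infinite[OF infinite_UNIV]) (simp add: J_def)
  with bc F obtain x l where "is_colimit J C (\<lambda>x. undefined) (\<lambda>x. undefined) x l"
    by (rule bicomplete_colimit)
  hence "is_initial C x" by (auto simp: is_colimit_def is_cocone_def is_initial_def J_def)
  thus ?thesis by blast
qed

section \<open>The arrow category\<close>

text \<open>Components of arrows and squares, indexed by booleans: \<open>False\<close> stands for the domain, \<open>True\<close> for the
  codomain. With this indexing the pushout product acts on indices by conjunction.\<close>

definition ev :: "('o, 'a, 'm) precategory_scheme \<Rightarrow> 'a \<Rightarrow> bool \<Rightarrow> 'o" where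
  "ev C f a = (if a then Cod C f else Dom C f)"

definition sqc :: "'a square \<Rightarrow> bool \<Rightarrow> 'a" where
  "sqc \<alpha> a = (if a then sq1 \<alpha> else sq0 \<alpha>)"

lemma ev_simps [simp]: "ev C f True = Cod C f" "ev C f False = Dom C f"
  by (simp_all add: ev_def)

lemma square_sel [simp]:
  "sq_src (f, g, x, y) = f" "sq_trg (f, g, x, y) = g" "sq0 (f, g, x, y) = x" "sq1 (f, g, x, y) = y"
  by (simp_all add: sq_src_def sq_trg_def sq0_def sq1_def)

lemma square_eqI:
  assumes "sq_src \<alpha> = sq_src \<beta>" "sq_trg \<alpha> = sq_trg \<beta>" "\<And>a. sqc \<alpha> a = sqc \<beta> a"
  shows "\<alpha> = \<beta>"
  using assms(1,2) assms(3)[of True] assms(3)[of False]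
  by (cases \<alpha>; cases \<beta>) (auto simp: sqc_def)

lemma square_collapse: "\<alpha> = (sq_src \<alpha>, sq_trg \<alpha>, sqc \<alpha> False, sqc \<alpha> True)"
  by (cases \<alpha>) (auto simp: sqc_def)

lemma Arr_sel [simp]:
  "Ob (Arr S) = Ar S" "Ar (Arr S) = squares S" "Dom (Arr S) = sq_src" "Cod (Arr S) = sq_trg"
  "TensOb (Arr S) = pushout_product S" "TensAr (Arr S) = arr_tensor S" "Unit (Arr S) = arr_unit S"
  "Assoc (Arr S) = arr_assoc S" "LUnit (Arr S) = arr_lunit S" "RUnit (Arr S) = arr_runit S"
  "Braid (Arr S) = arr_braid S"
  by (simp_all add: Arr_def)

lemma Arr_Id: "Id (Arr S) f = (f, f, Id S (Dom S f), Id S (Cod S f))"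
  by (simp add: Arr_def)

lemma Arr_Comp: "\<beta> \<bullet>\<^bsub>Arr S\<^esub> \<alpha> = (sq_src \<alpha>, sq_trg \<beta>, sq0 \<beta> \<bullet>\<^bsub>S\<^esub> sq0 \<alpha>, sq1 \<beta> \<bullet>\<^bsub>S\<^esub> sq1 \<alpha>)"
  by (simp add: Arr_def)

lemma Arr_Id_Comp_sel [simp]:
  "sq_src (Id (Arr S) f) = f" "sq_trg (Id (Arr S) f) = f"
  "sq_src (\<beta> \<bullet>\<^bsub>Arr S\<^esub> \<alpha>) = sq_src \<alpha>" "sq_trg (\<beta> \<bullet>\<^bsub>Arr S\<^esub> \<alpha>) = sq_trg \<beta>"
  by (simp_all add: Arr_Id Arr_Comp)

lemma squares_iff:
  "\<alpha> \<in> squares C \<longleftrightarrow> sq_src \<alpha> \<in> Ar C \<and> sq_trg \<alpha> \<in> Ar C \<and>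
     (\<forall>a. sqc \<alpha> a \<in> Ar C \<and> Dom C (sqc \<alpha> a) = ev C (sq_src \<alpha>) a \<and> Cod C (sqc \<alpha> a) = ev C (sq_trg \<alpha>) a) \<and>
     sq_trg \<alpha> \<bullet>\<^bsub>C\<^esub> sqc \<alpha> False = sqc \<alpha> True \<bullet>\<^bsub>C\<^esub> sq_src \<alpha>"
  by (cases \<alpha>) (auto simp: squares_def hom_iff ev_def sqc_def)

lemma squareD:
  assumes "\<alpha> \<in> squares C"
  shows "sq_src \<alpha> \<in> Ar C" "sq_trg \<alpha> \<in> Ar C" "sqc \<alpha> a \<in> Ar C"
    "Dom C (sqc \<alpha> a) = ev C (sq_src \<alpha>) a" "Cod C (sqc \<alpha> a) = ev C (sq_trg \<alpha>) a"
  using assms by (auto simp: squares_iff)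

lemma square_commutes:
  assumes "\<alpha> \<in> squares C"
  shows "sq_trg \<alpha> \<bullet>\<^bsub>C\<^esub> sqc \<alpha> False = sqc \<alpha> True \<bullet>\<^bsub>C\<^esub> sq_src \<alpha>"
  using assms by (auto simp: squares_iff)

lemma sqc_pair [simp]: "sqc (f, g, x, y) a = (if a then y else x)"
  by (simp add: sqc_def)

lemma sqc_comp [simp]: "sqc (\<beta> \<bullet>\<^bsub>Arr S\<^esub> \<alpha>) a = sqc \<beta> a \<bullet>\<^bsub>S\<^esub> sqc \<alpha> a"
  by (simp add: sqc_def Arr_Comp)

lemma sqc_Id [simp]: "sqc (Id (Arr S) f) a = Id S (ev S f a)"
  by (simp add: sqc_def ev_def Arr_Id)

locale premonoidal_category = category S
  for S :: "('o, 'a, 'm) premonoidal_scheme" (structure)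
begin

abbreviation arr_comp :: "'a square \<Rightarrow> 'a square \<Rightarrow> 'a square" (infixr "\<cdot>" 70) where
  "\<beta> \<cdot> \<alpha> \<equiv> \<beta> \<bullet>\<^bsub>Arr S\<^esub> \<alpha>"

lemma ev_Ob [simp]: "f \<in> Ar S \<Longrightarrow> ev S f a \<in> Ob S"
  by (simp add: ev_def)

lemma squareI:
  assumes "f \<in> Ar S" "g \<in> Ar S" "x \<in> Ar S" "y \<in> Ar S" "Dom S x = Dom S f" "Cod S x = Dom S g"
    "Dom S y = Cod S f" "Cod S y = Cod S g" "g \<bullet> x = y \<bullet> f"
  shows "(f, g, x, y) \<in> squares S"
  using assms by (auto simp: squares_iff ev_def)

lemma Arr_comp_square:
  assumes "\<alpha> \<in> squares S" "\<beta> \<in> squares S" "sq_src \<beta> = sq_trg \<alpha>"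
  shows "\<beta> \<cdot> \<alpha> \<in> squares S"
proof -
  note a = squareD[OF assms(1)] and b = squareD[OF assms(2)]
  have "sq_trg \<beta> \<bullet> (sqc \<beta> False \<bullet> sqc \<alpha> False) = (sq_trg \<beta> \<bullet> sqc \<beta> False) \<bullet> sqc \<alpha> False"
    using a b assms(3) by (simp add: ev_def)
  also have "\<dots> = sqc \<beta> True \<bullet> (sq_trg \<alpha> \<bullet> sqc \<alpha> False)"
    unfolding square_commutes[OF assms(2)] using a b assms(3) by (simp add: ev_def)
  also have "\<dots> = (sqc \<beta> True \<bullet> sqc \<alpha> True) \<bullet> sq_src \<alpha>"
    unfolding square_commutes[OF assms(1)] using a b assms(3) by (simp add: ev_def)
  finally have "sq_trg \<beta> \<bullet> (sq0 \<beta> \<bullet> sq0 \<alpha>) = (sq1 \<beta> \<bullet> sq1 \<alpha>) \<bullet> sq_src \<alpha>"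
    by (simp add: sqc_def)
  moreover have sq_comps: "sq0 \<gamma> = sqc \<gamma> False" "sq1 \<gamma> = sqc \<gamma> True" for \<gamma> :: "'a square"
    by (simp_all add: sqc_def)
  ultimately show ?thesis unfolding Arr_Comp
    using a b assms(3)
    by (intro squareI) (simp_all add: sq_comps ev_def)
qed

lemma Arr_category: "category (Arr S)"
proof
  fix f g h w x y z
  show "f \<in> Ar (Arr S) \<Longrightarrow> Dom (Arr S) f \<in> Ob (Arr S)" by (simp add: squareD)
  show "f \<in> Ar (Arr S) \<Longrightarrow> Cod (Arr S) f \<in> Ob (Arr S)" by (simp add: squareD)
  show "x \<in> Ob (Arr S) \<Longrightarrow> Id (Arr S) x \<in> hom (Arr S) x x" for x
    by (simp add: hom_iff squares_iff ev_def)
  show "f \<in> hom (Arr S) x y \<Longrightarrow> g \<in> hom (Arr S) y z \<Longrightarrow> g \<cdot> f \<in> hom (Arr S) x z"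
    using Arr_comp_square[of f g] by (auto simp: hom_iff)
  show "f \<cdot> Id (Arr S) x = f" if "f \<in> hom (Arr S) x y"
  proof (rule square_eqI)
    fix a
    show "sqc (f \<cdot> Id (Arr S) x) a = sqc f a"
      unfolding sqc_comp sqc_Id using that by (simp add: hom_iff squareD)
  qed (use that in \<open>auto simp: hom_iff\<close>)
  show "Id (Arr S) y \<cdot> f = f" if "f \<in> hom (Arr S) x y"
  proof (rule square_eqI)
    fix a
    show "sqc (Id (Arr S) y \<cdot> f) a = sqc f a"
      unfolding sqc_comp sqc_Id using that by (simp add: hom_iff squareD)
  qed (use that in \<open>auto simp: hom_iff\<close>)
  show "(h \<cdot> g) \<cdot> f = h \<cdot> (g \<cdot> f)"
    if "f \<in> hom (Arr S) w x" "g \<in> hom (Arr S) x y" "h \<in> hom (Arr S) y z"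
  proof (rule square_eqI)
    fix a
    show "sqc ((h \<cdot> g) \<cdot> f) a = sqc (h \<cdot> (g \<cdot> f)) a"
      unfolding sqc_comp using that by (simp add: hom_iff squareD)
  qed auto
qed

lemma Arr_is_iso:
  assumes sq: "\<alpha> \<in> squares S" and iso: "\<And>a. is_iso S (sqc \<alpha> a)"
  shows "is_iso (Arr S) \<alpha>"
proof -
  interpret A: category "Arr S" by (rule Arr_category)
  note d = squareD[OF sq]
  obtain x where x: "x \<in> Ar S" "Dom S x = Dom S (sq_trg \<alpha>)" "Cod S x = Dom S (sq_src \<alpha>)"
    "x \<bullet> sqc \<alpha> False = Id S (Dom S (sq_src \<alpha>))" "sqc \<alpha> False \<bullet> x = Id S (Dom S (sq_trg \<alpha>))"
    using iso[of False] d(4,5)[of False] by (auto elim!: is_isoE simp: ev_def)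
  obtain y where y: "y \<in> Ar S" "Dom S y = Cod S (sq_trg \<alpha>)" "Cod S y = Cod S (sq_src \<alpha>)"
    "y \<bullet> sqc \<alpha> True = Id S (Cod S (sq_src \<alpha>))" "sqc \<alpha> True \<bullet> y = Id S (Cod S (sq_trg \<alpha>))"
    using iso[of True] d(4,5)[of True] by (auto elim!: is_isoE simp: ev_def)
  have "sq_src \<alpha> \<bullet> x = y \<bullet> ((sqc \<alpha> True \<bullet> sq_src \<alpha>) \<bullet> x)"
    using x y d comp_chain[of y "sqc \<alpha> True" _ "sq_src \<alpha> \<bullet> x"] by (simp add: ev_def)
  also have "\<dots> = y \<bullet> (sq_trg \<alpha> \<bullet> (sqc \<alpha> False \<bullet> x))"
    unfolding square_commutes[OF sq, symmetric] using x(1-3) y d by (simp add: ev_def)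
  also have "\<dots> = y \<bullet> sq_trg \<alpha>" using x(5) y d by (simp add: ev_def)
  finally have b: "(sq_trg \<alpha>, sq_src \<alpha>, x, y) \<in> squares S"
    using x y d by (intro squareI) auto
  show ?thesis
  proof (rule A.is_isoI[of _ "(sq_trg \<alpha>, sq_src \<alpha>, x, y)"])
    show "(sq_trg \<alpha>, sq_src \<alpha>, x, y) \<cdot> \<alpha> = Id (Arr S) (Dom (Arr S) \<alpha>)"
      by (rule square_eqI) (use x y in \<open>auto simp: ev_def\<close>)
    show "\<alpha> \<cdot> (sq_trg \<alpha>, sq_src \<alpha>, x, y) = Id (Arr S) (Cod (Arr S) \<alpha>)"
      by (rule square_eqI) (use x y in \<open>auto simp: ev_def\<close>)
  qed (use sq b in auto)
qed

lemma ev_functor: "functor_between (Arr S) S (\<lambda>f. ev S f a) (\<lambda>\<alpha>. sqc \<alpha> a)"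
proof -
  interpret A: category "Arr S" by (rule Arr_category)
  show ?thesis
    by unfold_locales (auto simp: hom_iff squareD)
qed

end

lemma functor_comp:
  assumes "functor_between J C Fo Fa" "functor_between C D Go Ga"
  shows "functor_between J D (\<lambda>x. Go (Fo x)) (\<lambda>u. Ga (Fa u))"
proof -
  interpret F: functor_between J C Fo Fa by fact
  interpret G: functor_between C D Go Ga by fact
  show ?thesis by unfold_locales (auto simp: hom_iff F.map_compose G.map_compose)
qed

context premonoidal_category
begin

text \<open>Colimits are computed in each component; the colimit arrow is induced by the cocone
  \<open>l True j \<bullet> Do j\<close> on the diagram of domains.\<close>

lemma Arr_colimit:
  assumes F: "functor_between J (Arr S) Do Da"
    and ex: "\<And>a. \<exists>x l. is_colimit J S (\<lambda>j. ev S (Do j) a) (\<lambda>u. sqc (Da u) a) x l"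
  shows "\<exists>x l. is_colimit J (Arr S) Do Da x l"
proof -
  interpret A: category "Arr S" by (rule Arr_category)
  interpret F: functor_between J "Arr S" Do Da by fact
  obtain x l where xl: "\<And>a. is_colimit J S (\<lambda>j. ev S (Do j) a) (\<lambda>u. sqc (Da u) a) (x a) (l a)"
    using ex by metis
  have Do: "Do j \<in> Ar S" if "j \<in> Ob J" for j using F.map_ob that by simp
  have Da: "Da u \<in> squares S" "sq_src (Da u) = Do (Dom J u)" "sq_trg (Da u) = Do (Cod J u)"
    if "u \<in> Ar J" for u using F.map_arrow[OF that] by auto
  have cc: "is_cocone J S (\<lambda>j. ev S (Do j) a) (\<lambda>u. sqc (Da u) a) (x a) (l a)" for a
    using xl by (auto simp: is_colimit_def)
  have l: "l a j \<in> Ar S" "Dom S (l a j) = ev S (Do j) a" "Cod S (l a j) = x a" if "j \<in> Ob J" for a j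
    using cc[of a] that by (auto simp: is_cocone_def hom_iff)
  have x: "x a \<in> Ob S" for a using cc[of a] by (auto simp: is_cocone_def)
  have lu: "l a (Cod J u) \<bullet> sqc (Da u) a = l a (Dom J u)" if "u \<in> Ar J" for a u
    using cc[of a] that by (auto simp: is_cocone_def)
  have ext: "h = h'" if "h \<in> Ar S" "h' \<in> Ar S" "Dom S h = x a" "Dom S h' = x a" "Cod S h = Cod S h'"
    "\<And>j. j \<in> Ob J \<Longrightarrow> h \<bullet> l a j = h' \<bullet> l a j" for a h h'
  proof -
    have "is_cocone J S (\<lambda>j. ev S (Do j) a) (\<lambda>u. sqc (Da u) a) (Cod S h) (\<lambda>j. h \<bullet> l a j)"
      unfolding is_cocone_def
    proof (intro conjI ballI)
      fix u assume u: "u \<in> Ar J"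
      show "(h \<bullet> l a (Cod J u)) \<bullet> sqc (Da u) a = h \<bullet> l a (Dom J u)"
        using u that l lu[OF u] Da[OF u] squareD[OF Da(1)[OF u]] by simp
    qed (use that l in \<open>auto simp: hom_iff\<close>)
    hence "\<exists>!k. k \<in> hom S (x a) (Cod S h) \<and> (\<forall>j\<in>Ob J. k \<bullet> l a j = h \<bullet> l a j)"
      using xl[of a] unfolding is_colimit_def by blast
    moreover have "h \<in> hom S (x a) (Cod S h) \<and> (\<forall>j\<in>Ob J. h \<bullet> l a j = h \<bullet> l a j)"
      "h' \<in> hom S (x a) (Cod S h) \<and> (\<forall>j\<in>Ob J. h' \<bullet> l a j = h \<bullet> l a j)"
      using that by (auto simp: hom_iff)
    ultimately show ?thesis by blast
  qed
  have "is_cocone J S (\<lambda>j. ev S (Do j) False) (\<lambda>u. sqc (Da u) False) (x True) (\<lambda>j. l True j \<bullet> Do j)"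
    unfolding is_cocone_def
  proof (intro conjI ballI)
    fix u assume u: "u \<in> Ar J"
    note d = squareD[OF Da(1)[OF u]] Da[OF u]
    have "(l True (Cod J u) \<bullet> Do (Cod J u)) \<bullet> sqc (Da u) False =
      l True (Cod J u) \<bullet> (sq_trg (Da u) \<bullet> sqc (Da u) False)"
      using u l d Do by (simp add: ev_def)
    also have "\<dots> = (l True (Cod J u) \<bullet> sqc (Da u) True) \<bullet> Do (Dom J u)"
      unfolding square_commutes[OF Da(1)[OF u]] using u l d Do by (simp add: ev_def)
    finally show "(l True (Cod J u) \<bullet> Do (Cod J u)) \<bullet> sqc (Da u) False = l True (Dom J u) \<bullet> Do (Dom J u)"
      using lu[OF u] by simp
  qed (use x l Do in \<open>auto simp: hom_iff ev_def\<close>)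
  then have "\<exists>h. h \<in> hom S (x False) (x True) \<and> (\<forall>j\<in>Ob J. h \<bullet> l False j = l True j \<bullet> Do j)"
    using xl[of False] unfolding is_colimit_def by blast
  then obtain c where c: "c \<in> Ar S" "Dom S c = x False" "Cod S c = x True"
    "\<And>j. j \<in> Ob J \<Longrightarrow> c \<bullet> l False j = l True j \<bullet> Do j"
    unfolding hom_iff by blast
  define L where "L j = (Do j, c, l False j, l True j)" for j
  have L: "L j \<in> squares S" if "j \<in> Ob J" for j
    unfolding L_def using that Do l c by (intro squareI) (auto simp: ev_def)
  have cocL: "is_cocone J (Arr S) Do Da c L"
    unfolding is_cocone_def
  proof (intro conjI ballI)
    fix u assume u: "u \<in> Ar J"
    show "L (Cod J u) \<cdot> Da u = L (Dom J u)"
    proof (rule square_eqI)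
      fix a
      have "sqc (L j) a = l a j" for j by (simp add: L_def)
      thus "sqc (L (Cod J u) \<cdot> Da u) a = sqc (L (Dom J u)) a"
        unfolding sqc_comp using lu[OF u] by simp
    qed (use u Da in \<open>auto simp: L_def\<close>)
  qed (use c L in \<open>auto simp: hom_iff\<close>, auto simp: L_def)
  have "\<exists>!h. h \<in> hom (Arr S) c y \<and> (\<forall>j\<in>Ob J. h \<cdot> L j = m j)"
    if y: "is_cocone J (Arr S) Do Da y m" for y m
  proof (rule ex_ex1I)
    have m: "m j \<in> squares S" "sq_src (m j) = Do j" "sq_trg (m j) = y" if "j \<in> Ob J" for j
      using y that by (auto simp: is_cocone_def hom_iff)
    have mu: "m (Cod J u) \<cdot> Da u = m (Dom J u)" if "u \<in> Ar J" for u
      using y that unfolding is_cocone_def by blast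
    have yA: "y \<in> Ar S" using y by (simp add: is_cocone_def)
    have "is_cocone J S (\<lambda>j. ev S (Do j) a) (\<lambda>u. sqc (Da u) a) (ev S y a) (\<lambda>j. sqc (m j) a)" for a
      unfolding is_cocone_def using m yA by (auto simp: hom_iff squareD mu[symmetric])
    hence "\<exists>h. h \<in> hom S (x a) (ev S y a) \<and> (\<forall>j\<in>Ob J. h \<bullet> l a j = sqc (m j) a)" for a
      using xl[of a] unfolding is_colimit_def by blast
    then obtain h where h: "\<And>a. h a \<in> Ar S" "\<And>a. Dom S (h a) = x a" "\<And>a. Cod S (h a) = ev S y a"
      "\<And>a j. j \<in> Ob J \<Longrightarrow> h a \<bullet> l a j = sqc (m j) a"
      unfolding hom_iff by metis
    have "y \<bullet> h False = h True \<bullet> c"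
    proof (rule ext[of _ _ False])
      fix j assume j: "j \<in> Ob J"
      note d = squareD[OF m(1)[OF j]] m[OF j]
      have "(h True \<bullet> c) \<bullet> l False j = h True \<bullet> (l True j \<bullet> Do j)"
        using h(1-3) c j l by (simp add: ev_def)
      also have "\<dots> = (h True \<bullet> l True j) \<bullet> Do j" using h(1-3) c j l Do by (simp add: ev_def)
      also have "\<dots> = y \<bullet> sqc (m j) False" using square_commutes[OF m(1)[OF j]] h(4)[OF j] d by simp
      also have "\<dots> = (y \<bullet> h False) \<bullet> l False j" using h(1-3) h(4)[OF j,symmetric] l j yA by (simp add: ev_def)
      finally show "(y \<bullet> h False) \<bullet> l False j = (h True \<bullet> c) \<bullet> l False j" by simp
    qed (use h c yA in \<open>auto simp: ev_def\<close>)
    hence H: "(c, y, h False, h True) \<in> squares S"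
      using h c yA by (intro squareI) (auto simp: ev_def)
    have "(c, y, h False, h True) \<cdot> L j = m j" if j: "j \<in> Ob J" for j
    proof (rule square_eqI)
      fix a
      have "sqc (c, y, h False, h True) a = h a" "sqc (L j) a = l a j" by (auto simp: L_def)
      thus "sqc ((c, y, h False, h True) \<cdot> L j) a = sqc (m j) a"
        unfolding sqc_comp using h(4) j by simp
    qed (use m j in \<open>auto simp: L_def\<close>)
    thus "\<exists>h. h \<in> hom (Arr S) c y \<and> (\<forall>j\<in>Ob J. h \<cdot> L j = m j)"
      using H by (intro exI[of _ "(c, y, h False, h True)"]) (auto simp: hom_iff)
    fix k k' assume k: "k \<in> hom (Arr S) c y \<and> (\<forall>j\<in>Ob J. k \<cdot> L j = m j)"
      and k': "k' \<in> hom (Arr S) c y \<and> (\<forall>j\<in>Ob J. k' \<cdot> L j = m j)"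
    hence d: "k \<in> squares S" "k' \<in> squares S" "sq_src k = c" "sq_src k' = c" "sq_trg k = y" "sq_trg k' = y"
      by (auto simp: hom_iff)
    show "k = k'"
    proof (rule square_eqI)
      fix a
      show "sqc k a = sqc k' a"
      proof (rule ext[of _ _ a])
        fix j assume j: "j \<in> Ob J"
        have "sqc (L j) a = l a j" by (simp add: L_def)
        thus "sqc k a \<bullet> l a j = sqc k' a \<bullet> l a j"
          using sqc_comp[where S=S and \<alpha>="L j" and a=a] k k' j by metis
      qed (use d c in \<open>auto simp: squareD ev_def\<close>)
    qed (use d in auto)
  qed
  with cocL have "is_colimit J (Arr S) Do Da c L" unfolding is_colimit_def by blast
  thus ?thesis by blast
qed

text \<open>Dually, the limit arrow is induced by the cone \<open>Do j \<bullet> l False j\<close> on the diagram of codomains.\<close>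

lemma Arr_limit:
  assumes F: "functor_between J (Arr S) Do Da"
    and ex: "\<And>a. \<exists>x l. is_limit J S (\<lambda>j. ev S (Do j) a) (\<lambda>u. sqc (Da u) a) x l"
  shows "\<exists>x l. is_limit J (Arr S) Do Da x l"
proof -
  interpret A: category "Arr S" by (rule Arr_category)
  interpret F: functor_between J "Arr S" Do Da by fact
  obtain x l where xl: "\<And>a. is_limit J S (\<lambda>j. ev S (Do j) a) (\<lambda>u. sqc (Da u) a) (x a) (l a)"
    using ex by metis
  have Do: "Do j \<in> Ar S" if "j \<in> Ob J" for j using F.map_ob that by simp
  have Da: "Da u \<in> squares S" "sq_src (Da u) = Do (Dom J u)" "sq_trg (Da u) = Do (Cod J u)"
    if "u \<in> Ar J" for u using F.map_arrow[OF that] by auto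
  have cc: "is_cone J S (\<lambda>j. ev S (Do j) a) (\<lambda>u. sqc (Da u) a) (x a) (l a)" for a
    using xl by (auto simp: is_limit_def)
  have l: "l a j \<in> Ar S" "Cod S (l a j) = ev S (Do j) a" "Dom S (l a j) = x a" if "j \<in> Ob J" for a j
    using cc[of a] that by (auto simp: is_cone_def hom_iff)
  have x: "x a \<in> Ob S" for a using cc[of a] by (auto simp: is_cone_def)
  have lu: "sqc (Da u) a \<bullet> l a (Dom J u) = l a (Cod J u)" if "u \<in> Ar J" for a u
    using cc[of a] that by (auto simp: is_cone_def)
  have ext: "h = h'" if "h \<in> Ar S" "h' \<in> Ar S" "Cod S h = x a" "Cod S h' = x a" "Dom S h = Dom S h'"
    "\<And>j. j \<in> Ob J \<Longrightarrow> l a j \<bullet> h = l a j \<bullet> h'" for a h h'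
  proof -
    have "is_cone J S (\<lambda>j. ev S (Do j) a) (\<lambda>u. sqc (Da u) a) (Dom S h) (\<lambda>j. l a j \<bullet> h)"
      unfolding is_cone_def
    proof (intro conjI ballI)
      fix u assume u: "u \<in> Ar J"
      show "sqc (Da u) a \<bullet> (l a (Dom J u) \<bullet> h) = l a (Cod J u) \<bullet> h"
        by (rule comp_chain[OF lu[OF u]]) (use u that l Da[OF u] squareD[OF Da(1)[OF u]] in auto)
    qed (use that l in \<open>auto simp: hom_iff\<close>)
    hence "\<exists>!k. k \<in> hom S (Dom S h) (x a) \<and> (\<forall>j\<in>Ob J. l a j \<bullet> k = l a j \<bullet> h)"
      using xl[of a] unfolding is_limit_def by blast
    moreover have "h \<in> hom S (Dom S h) (x a) \<and> (\<forall>j\<in>Ob J. l a j \<bullet> h = l a j \<bullet> h)"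
      "h' \<in> hom S (Dom S h) (x a) \<and> (\<forall>j\<in>Ob J. l a j \<bullet> h' = l a j \<bullet> h)"
      using that by (auto simp: hom_iff)
    ultimately show ?thesis by blast
  qed
  have "is_cone J S (\<lambda>j. ev S (Do j) True) (\<lambda>u. sqc (Da u) True) (x False) (\<lambda>j. Do j \<bullet> l False j)"
    unfolding is_cone_def
  proof (intro conjI ballI)
    fix u assume u: "u \<in> Ar J"
    note d = squareD[OF Da(1)[OF u]] Da[OF u]
    have "sqc (Da u) True \<bullet> (Do (Dom J u) \<bullet> l False (Dom J u)) =
      (sqc (Da u) True \<bullet> sq_src (Da u)) \<bullet> l False (Dom J u)"
      using u l d Do by (simp add: ev_def)
    also have "\<dots> = Do (Cod J u) \<bullet> (sqc (Da u) False \<bullet> l False (Dom J u))"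
      unfolding square_commutes[OF Da(1)[OF u], symmetric] using u l d Do by (simp add: ev_def)
    finally show "sqc (Da u) True \<bullet> (Do (Dom J u) \<bullet> l False (Dom J u)) = Do (Cod J u) \<bullet> l False (Cod J u)"
      using lu[OF u] by simp
  qed (use x l Do in \<open>auto simp: hom_iff ev_def\<close>)
  then have "\<exists>h. h \<in> hom S (x False) (x True) \<and> (\<forall>j\<in>Ob J. l True j \<bullet> h = Do j \<bullet> l False j)"
    using xl[of True] unfolding is_limit_def by blast
  then obtain c where c: "c \<in> Ar S" "Dom S c = x False" "Cod S c = x True"
    "\<And>j. j \<in> Ob J \<Longrightarrow> l True j \<bullet> c = Do j \<bullet> l False j"
    unfolding hom_iff by blast
  define L where "L j = (c, Do j, l False j, l True j)" for j
  have L: "L j \<in> squares S" if "j \<in> Ob J" for j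
    unfolding L_def using that Do l c by (intro squareI) (auto simp: ev_def)
  have cocL: "is_cone J (Arr S) Do Da c L"
    unfolding is_cone_def
  proof (intro conjI ballI)
    fix u assume u: "u \<in> Ar J"
    show "Da u \<cdot> L (Dom J u) = L (Cod J u)"
    proof (rule square_eqI)
      fix a
      have "sqc (L j) a = l a j" for j by (simp add: L_def)
      thus "sqc (Da u \<cdot> L (Dom J u)) a = sqc (L (Cod J u)) a"
        unfolding sqc_comp using lu[OF u] by simp
    qed (use u Da in \<open>auto simp: L_def\<close>)
  qed (use c L in \<open>auto simp: hom_iff\<close>, auto simp: L_def)
  have "\<exists>!h. h \<in> hom (Arr S) y c \<and> (\<forall>j\<in>Ob J. L j \<cdot> h = m j)"
    if y: "is_cone J (Arr S) Do Da y m" for y m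
  proof (rule ex_ex1I)
    have m: "m j \<in> squares S" "sq_src (m j) = y" "sq_trg (m j) = Do j" if "j \<in> Ob J" for j
      using y that by (auto simp: is_cone_def hom_iff)
    have mu: "Da u \<cdot> m (Dom J u) = m (Cod J u)" if "u \<in> Ar J" for u
      using y that unfolding is_cone_def by blast
    have yA: "y \<in> Ar S" using y by (simp add: is_cone_def)
    have "is_cone J S (\<lambda>j. ev S (Do j) a) (\<lambda>u. sqc (Da u) a) (ev S y a) (\<lambda>j. sqc (m j) a)" for a
      unfolding is_cone_def using m yA by (auto simp: hom_iff squareD mu[symmetric])
    hence "\<exists>h. h \<in> hom S (ev S y a) (x a) \<and> (\<forall>j\<in>Ob J. l a j \<bullet> h = sqc (m j) a)" for a
      using xl[of a] unfolding is_limit_def by blast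
    then obtain h where h: "\<And>a. h a \<in> Ar S" "\<And>a. Cod S (h a) = x a" "\<And>a. Dom S (h a) = ev S y a"
      "\<And>a j. j \<in> Ob J \<Longrightarrow> l a j \<bullet> h a = sqc (m j) a"
      unfolding hom_iff by metis
    have "c \<bullet> h False = h True \<bullet> y"
    proof (rule ext[of _ _ True])
      fix j assume j: "j \<in> Ob J"
      note d = squareD[OF m(1)[OF j]] m[OF j]
      have "l True j \<bullet> (c \<bullet> h False) = (Do j \<bullet> l False j) \<bullet> h False"
        by (rule comp_chain[OF c(4)[OF j]]) (use h(1-3) c(1-3) j l in \<open>auto simp: ev_def\<close>)
      also have "\<dots> = Do j \<bullet> sqc (m j) False"
        using h(1-3) h(4)[OF j, of False] j l Do by (simp add: ev_def)
      also have "\<dots> = (l True j \<bullet> h True) \<bullet> y"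
        using square_commutes[OF m(1)[OF j]] h(4)[OF j] d by simp
      also have "\<dots> = l True j \<bullet> (h True \<bullet> y)" using h(1-3) l j yA by (simp add: ev_def)
      finally show "l True j \<bullet> (c \<bullet> h False) = l True j \<bullet> (h True \<bullet> y)" .
    qed (use h c yA in \<open>auto simp: ev_def\<close>)
    hence H: "(y, c, h False, h True) \<in> squares S"
      using h c yA by (intro squareI) (auto simp: ev_def)
    have "L j \<cdot> (y, c, h False, h True) = m j" if j: "j \<in> Ob J" for j
    proof (rule square_eqI)
      fix a
      have "sqc (y, c, h False, h True) a = h a" "sqc (L j) a = l a j" by (auto simp: L_def)
      thus "sqc (L j \<cdot> (y, c, h False, h True)) a = sqc (m j) a"
        unfolding sqc_comp using h(4) j by simp
    qed (use m j in \<open>auto simp: L_def\<close>)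
    thus "\<exists>h. h \<in> hom (Arr S) y c \<and> (\<forall>j\<in>Ob J. L j \<cdot> h = m j)"
      using H by (intro exI[of _ "(y, c, h False, h True)"]) (auto simp: hom_iff)
    fix k k' assume k: "k \<in> hom (Arr S) y c \<and> (\<forall>j\<in>Ob J. L j \<cdot> k = m j)"
      and k': "k' \<in> hom (Arr S) y c \<and> (\<forall>j\<in>Ob J. L j \<cdot> k' = m j)"
    hence d: "k \<in> squares S" "k' \<in> squares S" "sq_src k = y" "sq_src k' = y" "sq_trg k = c" "sq_trg k' = c"
      by (auto simp: hom_iff)
    show "k = k'"
    proof (rule square_eqI)
      fix a
      show "sqc k a = sqc k' a"
      proof (rule ext[of _ _ a])
        fix j assume j: "j \<in> Ob J"
        have "sqc (L j) a = l a j" by (simp add: L_def)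
        thus "l a j \<bullet> sqc k a = l a j \<bullet> sqc k' a"
          using sqc_comp[where S=S and \<beta>="L j" and a=a] k k' j by metis
      qed (use d c in \<open>auto simp: squareD ev_def\<close>)
    qed (use d in auto)
  qed
  with cocL have "is_limit J (Arr S) Do Da c L" unfolding is_limit_def by blast
  thus ?thesis by blast
qed

lemma Arr_bicomplete:
  fixes small :: "'i::infinite itself"
  assumes bc: "bicomplete small S"
  shows "bicomplete small (Arr S)"
  unfolding bicomplete_def
proof (intro conjI allI impI)
  show "category (Arr S)" by (rule Arr_category)
  fix J :: "('i, 'i) precategory" and Do Da
  assume *: "functor_between J (Arr S) Do Da \<and> Ar J \<prec> (UNIV :: 'i set)"
  have F: "functor_between J S (\<lambda>j. ev S (Do j) a) (\<lambda>u. sqc (Da u) a)" for a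
    by (rule functor_comp[OF conjunct1[OF *] ev_functor])
  show "\<exists>x l. is_limit J (Arr S) Do Da x l"
    by (rule Arr_limit) (use * bicomplete_limit[OF bc F] in blast)+
  show "\<exists>x l. is_colimit J (Arr S) Do Da x l"
    by (rule Arr_colimit) (use * bicomplete_colimit[OF bc F] in blast)+
qed

end

section \<open>Symmetric monoidal closed categories with pushouts\<close>

context symmetric_monoidal_category
begin

sublocale premonoidal_category S by unfold_locales

abbreviation left_whisker :: "'o \<Rightarrow> 'a \<Rightarrow> 'a" (infixr "\<lhd>" 75) where
  "x \<lhd> f \<equiv> Id S x \<otimes> f"

abbreviation right_whisker :: "'a \<Rightarrow> 'o \<Rightarrow> 'a" (infixr "\<rhd>" 75) where
  "f \<rhd> x \<equiv> f \<otimes> Id S x"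

lemma tensor_arrow [simp]:
  assumes "f \<in> Ar S" "g \<in> Ar S"
  shows "f \<otimes> g \<in> Ar S" "Dom S (f \<otimes> g) = Dom S f \<odot> Dom S g" "Cod S (f \<otimes> g) = Cod S f \<odot> Cod S g"
  using tensor_hom[of f "Dom S f" "Cod S f" g "Dom S g" "Cod S g"] assms by (auto simp: hom_iff)

declare tensor_ob [simp] tensor_id [simp] unit_ob [simp]

lemma interchange:
  assumes "f \<in> Ar S" "f' \<in> Ar S" "g \<in> Ar S" "g' \<in> Ar S" "Dom S f' = Cod S f" "Dom S g' = Cod S g"
  shows "(f' \<otimes> g') \<bullet> (f \<otimes> g) = (f' \<bullet> f) \<otimes> (g' \<bullet> g)"
  using tensor_comp[of f "Dom S f" "Cod S f" f' "Cod S f'" g "Dom S g" "Cod S g" g' "Cod S g'"] assms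
  by (auto simp: hom_iff)

lemma interchange_chain:
  assumes "f \<in> Ar S" "f' \<in> Ar S" "g \<in> Ar S" "g' \<in> Ar S" "Dom S f' = Cod S f" "Dom S g' = Cod S g"
    "k \<in> Ar S" "Cod S k = Dom S f \<odot> Dom S g"
  shows "(f' \<otimes> g') \<bullet> ((f \<otimes> g) \<bullet> k) = ((f' \<bullet> f) \<otimes> (g' \<bullet> g)) \<bullet> k"
  by (rule comp_chain[OF interchange]) (use assms in auto)

lemma Assoc_arrow [simp]:
  assumes "x \<in> Ob S" "y \<in> Ob S" "z \<in> Ob S"
  shows "Assoc S x y z \<in> Ar S" "Dom S (Assoc S x y z) = (x \<odot> y) \<odot> z"
    "Cod S (Assoc S x y z) = x \<odot> (y \<odot> z)"
  using assoc_hom[OF assms] by (auto simp: hom_iff)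

lemma Braid_arrow [simp]:
  assumes "x \<in> Ob S" "y \<in> Ob S"
  shows "Braid S x y \<in> Ar S" "Dom S (Braid S x y) = x \<odot> y" "Cod S (Braid S x y) = y \<odot> x"
  using braid_hom[OF assms] by (auto simp: hom_iff)

lemma LUnit_arrow [simp]:
  assumes "x \<in> Ob S"
  shows "LUnit S x \<in> Ar S" "Dom S (LUnit S x) = Unit S \<odot> x" "Cod S (LUnit S x) = x"
  using lunit_hom[OF assms] by (auto simp: hom_iff)

lemma RUnit_arrow [simp]:
  assumes "x \<in> Ob S"
  shows "RUnit S x \<in> Ar S" "Dom S (RUnit S x) = x \<odot> Unit S" "Cod S (RUnit S x) = x"
  using runit_hom[OF assms] by (auto simp: hom_iff)

lemma Assoc_nat:
  assumes "f \<in> Ar S" "g \<in> Ar S" "h \<in> Ar S" "x = Cod S f" "y = Cod S g" "z = Cod S h"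
  shows "Assoc S x y z \<bullet> ((f \<otimes> g) \<otimes> h) = (f \<otimes> (g \<otimes> h)) \<bullet> Assoc S (Dom S f) (Dom S g) (Dom S h)"
  using assms assoc_natural[of f "Dom S f" x g "Dom S g" y h "Dom S h" z] by (auto simp: hom_iff)

lemma Braid_nat:
  assumes "f \<in> Ar S" "g \<in> Ar S" "x = Cod S f" "y = Cod S g"
  shows "Braid S x y \<bullet> (f \<otimes> g) = (g \<otimes> f) \<bullet> Braid S (Dom S f) (Dom S g)"
  using assms braid_natural[of f "Dom S f" x g "Dom S g" y] by (auto simp: hom_iff)

lemma Braid_Braid:
  assumes "x \<in> Ob S" "y \<in> Ob S"
  shows "Braid S y x \<bullet> Braid S x y = Id S (x \<odot> y)"
  by (rule braid_symmetric[OF assms])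

end

text \<open>The colimits and limits of \<open>S\<close> that enter the construction: pushouts for the pushout product, an initial
  object for its unit, and pullbacks for its internal hom.\<close>

locale smcc = symmetric_monoidal_closed_category S + category_with_pushouts S
  for S :: "('o, 'a, 'm) premonoidal_scheme" (structure) +
  assumes initial_exists: "\<exists>x. is_initial S x"
    and pullback_exists:
      "\<lbrakk>f \<in> Ar S; g \<in> Ar S; Cod S f = Cod S g\<rbrakk> \<Longrightarrow> \<exists>p q. is_pullback S f g p q"
begin

subsection \<open>Tensoring preserves colimits in each variable\<close>

lemma tensor_right_adjoint:
  assumes "w \<in> Ob S"
  shows "left_adjoint S S (\<lambda>x. x \<odot> w) (\<lambda>f. f \<rhd> w)"
  using closed[OF assms] adjunction.is_left_adjoint by blast

text \<open>By symmetry \<open>w \<odot> -\<close> is isomorphic to \<open>- \<odot> w\<close>; its universal arrow is that of \<open>- \<odot> w\<close> preceded by the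
  braiding.\<close>

lemma tensor_left_adjoint:
  assumes w: "w \<in> Ob S"
  shows "left_adjoint S S (\<lambda>x. w \<odot> x) (\<lambda>f. w \<lhd> f)"
proof -
  interpret R: left_adjoint S S "\<lambda>x. x \<odot> w" "\<lambda>f. f \<rhd> w" by (rule tensor_right_adjoint[OF w])
  show ?thesis
  proof unfold_locales
    show "w \<lhd> (g \<bullet> f) = (w \<lhd> g) \<bullet> (w \<lhd> f)"
      if "f \<in> hom S x y" "g \<in> hom S y z" for f g x y z
      using that w by (auto simp: hom_iff interchange)
    fix y assume y: "y \<in> Ob S"
    obtain g e where g: "g \<in> Ob S" and e: "e \<in> Ar S" "Dom S e = g \<odot> w" "Cod S e = y"
      and u: "\<And>x k. x \<in> Ob S \<Longrightarrow> k \<in> hom S (x \<odot> w) y \<Longrightarrow> \<exists>!k'. k' \<in> hom S x g \<and> e \<bullet> (k' \<rhd> w) = k"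
      using R.couniversal[OF y] by (auto simp: hom_iff)
    have "\<exists>!k'. k' \<in> hom S x g \<and> (e \<bullet> Braid S w g) \<bullet> (w \<lhd> k') = k"
      if x: "x \<in> Ob S" and k: "k \<in> hom S (w \<odot> x) y" for x k
    proof -
      have "(e \<bullet> Braid S w g) \<bullet> (w \<lhd> k') = k \<longleftrightarrow> e \<bullet> (k' \<rhd> w) = k \<bullet> Braid S x w"
        if k': "k' \<in> hom S x g" for k'
      proof -
        have 1: "(e \<bullet> Braid S w g) \<bullet> (w \<lhd> k') = (e \<bullet> (k' \<rhd> w)) \<bullet> Braid S w x"
          using k' e g w x by (simp add: hom_iff Braid_nat)
        have 2: "((e \<bullet> (k' \<rhd> w)) \<bullet> Braid S w x) \<bullet> Braid S x w = e \<bullet> (k' \<rhd> w)"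
          using k' e g w x by (simp add: hom_iff Braid_Braid)
        have 3: "(k \<bullet> Braid S x w) \<bullet> Braid S w x = k"
          using k w x by (simp add: hom_iff Braid_Braid)
        show ?thesis using 1 2 3 by auto
      qed
      moreover have "\<exists>!k'. k' \<in> hom S x g \<and> e \<bullet> (k' \<rhd> w) = k \<bullet> Braid S x w"
        by (rule u) (use k x w in \<open>auto simp: hom_iff\<close>)
      ultimately show ?thesis by (metis (no_types, lifting))
    qed
    thus "\<exists>g e. g \<in> Ob S \<and> e \<in> hom S (w \<odot> g) y \<and>
      (\<forall>x\<in>Ob S. \<forall>k\<in>hom S (w \<odot> x) y. \<exists>!k'. k' \<in> hom S x g \<and> e \<bullet> (w \<lhd> k') = k)"
      using g e w by (intro exI[of _ g] exI[of _ "e \<bullet> Braid S w g"]) (auto simp: hom_iff)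
  qed (use w in \<open>auto simp: hom_iff\<close>)
qed

lemma tensor_right_jointly_epic:
  assumes "jointly_epic S I x" "w \<in> Ob S"
  shows "jointly_epic S ((\<lambda>f. f \<rhd> w) ` I) (x \<odot> w)"
  using left_adjoint.preserves_jointly_epic[OF tensor_right_adjoint[OF assms(2)] assms(1)] .

lemma tensor_left_jointly_epic:
  assumes "jointly_epic S I x" "w \<in> Ob S"
  shows "jointly_epic S ((\<lambda>f. w \<lhd> f) ` I) (w \<odot> x)"
  using left_adjoint.preserves_jointly_epic[OF tensor_left_adjoint[OF assms(2)] assms(1)] .

lemma tensor_right_pushout:
  assumes "is_pushout S f g i j" "w \<in> Ob S"
  shows "is_pushout S (f \<rhd> w) (g \<rhd> w) (i \<rhd> w) (j \<rhd> w)"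
  using left_adjoint.preserves_pushout[OF tensor_right_adjoint[OF assms(2)] assms(1)] .

lemma tensor_left_pushout:
  assumes "is_pushout S f g i j" "w \<in> Ob S"
  shows "is_pushout S (w \<lhd> f) (w \<lhd> g) (w \<lhd> i) (w \<lhd> j)"
  using left_adjoint.preserves_pushout[OF tensor_left_adjoint[OF assms(2)] assms(1)] .

subsection \<open>The coprojections of a pushout product\<close>

abbreviation box :: "'a \<Rightarrow> 'a \<Rightarrow> 'a" (infixr "\<box>" 73) where "f \<box> g \<equiv> pushout_product S f g"

lemma legs [simp]:
  assumes "f \<in> Ar S" "g \<in> Ar S"
  shows "pp_leg1 S f g \<in> Ar S" "Dom S (pp_leg1 S f g) = Dom S f \<odot> Dom S g"
    "Cod S (pp_leg1 S f g) = Dom S f \<odot> Cod S g"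
    "pp_leg2 S f g \<in> Ar S" "Dom S (pp_leg2 S f g) = Dom S f \<odot> Dom S g"
    "Cod S (pp_leg2 S f g) = Cod S f \<odot> Dom S g"
  using assms by (simp_all add: pp_leg1_def pp_leg2_def)

lemma pp_in_arrow [simp]:
  assumes "f \<in> Ar S" "g \<in> Ar S"
  shows "pp_in1 S f g \<in> Ar S" "Dom S (pp_in1 S f g) = Dom S f \<odot> Cod S g" "Cod S (pp_in1 S f g) = pp_dom S f g"
    "pp_in2 S f g \<in> Ar S" "Dom S (pp_in2 S f g) = Cod S f \<odot> Dom S g" "Cod S (pp_in2 S f g) = pp_dom S f g"
    "pp_dom S f g \<in> Ob S"
  using assms by (simp_all add: pp_in1_def pp_in2_def pp_dom_def)

lemma pp_commutes:
  assumes "f \<in> Ar S" "g \<in> Ar S" "x = Dom S f" "y = Dom S g"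
  shows "pp_in1 S f g \<bullet> (x \<lhd> g) = pp_in2 S f g \<bullet> (f \<rhd> y)"
  using po_commutes[of "pp_leg1 S f g" "pp_leg2 S f g"] assms
  by (simp add: pp_in1_def pp_in2_def pp_leg1_def pp_leg2_def)

lemma pp_desc:
  assumes "f \<in> Ar S" "g \<in> Ar S" "u \<in> Ar S" "v \<in> Ar S"
    "Dom S u = Dom S f \<odot> Cod S g" "Dom S v = Cod S f \<odot> Dom S g" "Cod S u = Cod S v"
    "u \<bullet> (Dom S f \<lhd> g) = v \<bullet> (f \<rhd> Dom S g)"
  shows "pp_desc S f g u v \<in> Ar S" "Dom S (pp_desc S f g u v) = pp_dom S f g"
    "Cod S (pp_desc S f g u v) = Cod S v" "pp_desc S f g u v \<bullet> pp_in1 S f g = u"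
    "pp_desc S f g u v \<bullet> pp_in2 S f g = v"
  using po_desc[of "pp_leg1 S f g" "pp_leg2 S f g" u v] assms
  by (simp_all add: pp_in1_def pp_in2_def pp_leg1_def pp_leg2_def pp_dom_def pp_desc_def)

lemma pp_is_pushout:
  assumes "f \<in> Ar S" "g \<in> Ar S"
  shows "is_pushout S (Dom S f \<lhd> g) (f \<rhd> Dom S g) (pp_in1 S f g) (pp_in2 S f g)"
  using is_pushout_po[of "pp_leg1 S f g" "pp_leg2 S f g"] assms
  by (simp add: pp_in1_def pp_in2_def pp_leg1_def pp_leg2_def)

lemma pp_ext:
  assumes "f \<in> Ar S" "g \<in> Ar S" "k \<in> Ar S" "k' \<in> Ar S" "Dom S k = pp_dom S f g"
    "Dom S k' = pp_dom S f g" "Cod S k = Cod S k'"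
    "k \<bullet> pp_in1 S f g = k' \<bullet> pp_in1 S f g" "k \<bullet> pp_in2 S f g = k' \<bullet> pp_in2 S f g"
  shows "k = k'"
  by (rule po_ext[of "pp_leg1 S f g" "pp_leg2 S f g"])
    (use assms in \<open>auto simp: pp_in1_def pp_in2_def pp_dom_def\<close>)

lemma box_arrow [simp]:
  assumes "f \<in> Ar S" "g \<in> Ar S"
  shows "f \<box> g \<in> Ar S" "Dom S (f \<box> g) = pp_dom S f g" "Cod S (f \<box> g) = Cod S f \<odot> Cod S g"
  using pp_desc[of f g "f \<rhd> Cod S g" "Cod S f \<lhd> g"] assms
  by (auto simp: pushout_product_def interchange)

lemma box_in:
  assumes "f \<in> Ar S" "g \<in> Ar S"
  shows "(f \<box> g) \<bullet> pp_in1 S f g = f \<rhd> Cod S g" "(f \<box> g) \<bullet> pp_in2 S f g = Cod S f \<lhd> g"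
  using pp_desc[of f g "f \<rhd> Cod S g" "Cod S f \<lhd> g"] assms
  by (auto simp: pushout_product_def interchange)

text \<open>The coprojection of the component \<open>(a, b)\<close> into the pushout product, which lands in the component \<open>a \<and> b\<close>.
  At \<open>(True, True)\<close> it is an identity; at \<open>(False, False)\<close> it is the diagonal of the pushout square.\<close>

definition pin :: "'a \<Rightarrow> 'a \<Rightarrow> bool \<Rightarrow> bool \<Rightarrow> 'a" where
  "pin f g a b =
     (if a then if b then Id S (Cod S f \<odot> Cod S g) else pp_in2 S f g
      else if b then pp_in1 S f g else pp_in1 S f g \<bullet> (Dom S f \<lhd> g))"

lemma pin_simps [simp]:
  "pin f g True True = Id S (Cod S f \<odot> Cod S g)" "pin f g True False = pp_in2 S f g"
  "pin f g False True = pp_in1 S f g"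
  by (simp_all add: pin_def)

lemma pin_arrow [simp]:
  assumes "f \<in> Ar S" "g \<in> Ar S"
  shows "pin f g a b \<in> Ar S" "Dom S (pin f g a b) = ev S f a \<odot> ev S g b"
    "Cod S (pin f g a b) = ev S (f \<box> g) (a \<and> b)"
  using assms by (auto simp: pin_def)

text \<open>The pair \<open>(False, False)\<close> is left out, since its coprojection factors through the others. The
  condition \<open>a \<or> b\<close>, that at most one index be \<open>False\<close>, recurs for more factors: it selects the generators of
  an iterated pushout product.\<close>

lemma pin_jointly_epic:
  assumes "f \<in> Ar S" "g \<in> Ar S"
  shows "jointly_epic S {pin f g a b |a b. (a \<or> b) \<and> (a \<and> b) = c} (ev S (f \<box> g) c)"
  unfolding jointly_epic_def
proof (intro conjI ballI impI)
  fix k k' assume k: "k \<in> Ar S" "k' \<in> Ar S" and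
    *: "Dom S k = ev S (f \<box> g) c \<and> Dom S k' = ev S (f \<box> g) c \<and> Cod S k = Cod S k' \<and>
      (\<forall>i\<in>{pin f g a b |a b. (a \<or> b) \<and> (a \<and> b) = c}. k \<bullet> i = k' \<bullet> i)"
  hence e: "k \<bullet> pin f g a b = k' \<bullet> pin f g a b" if "a \<or> b" "(a \<and> b) = c" for a b using that by blast
  have d: "Dom S k = ev S (f \<box> g) c" "Dom S k' = ev S (f \<box> g) c" "Cod S k = Cod S k'" using * by auto
  show "k = k'"
  proof (cases c)
    case True
    thus ?thesis using e[of True True] k d assms by simp
  next
    case False
    show ?thesis
      by (rule pp_ext[OF assms k]) (use e[of True False] e[of False True] d False assms in simp_all)
  qed
qed (use assms in auto)

lemma pin_ext:
  assumes "f \<in> Ar S" "g \<in> Ar S" "k \<in> Ar S" "k' \<in> Ar S" "Dom S k = ev S (f \<box> g) c"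
    "Dom S k' = ev S (f \<box> g) c" "Cod S k = Cod S k'"
    "\<And>a b. a \<or> b \<Longrightarrow> (a \<and> b) = c \<Longrightarrow> k \<bullet> pin f g a b = k' \<bullet> pin f g a b"
  shows "k = k'"
proof (rule jointly_epicD[OF pin_jointly_epic[OF assms(1,2)] assms(3-7)])
  fix i assume "i \<in> {pin f g a b |a b. (a \<or> b) \<and> (a \<and> b) = c}"
  thus "k \<bullet> i = k' \<bullet> i" using assms(8) by blast
qed

lemma pin_ext_right:
  assumes "f \<in> Ar S" "g \<in> Ar S" "w \<in> Ob S" "k \<in> Ar S" "k' \<in> Ar S" "Dom S k = ev S (f \<box> g) c \<odot> w"
    "Dom S k' = ev S (f \<box> g) c \<odot> w" "Cod S k = Cod S k'"
    "\<And>a b. a \<or> b \<Longrightarrow> (a \<and> b) = c \<Longrightarrow> k \<bullet> (pin f g a b \<rhd> w) = k' \<bullet> (pin f g a b \<rhd> w)"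
  shows "k = k'"
proof (rule jointly_epicD[OF tensor_right_jointly_epic[OF pin_jointly_epic[OF assms(1,2)] assms(3)] assms(4-8)])
  fix i assume "i \<in> (\<lambda>i. i \<rhd> w) ` {pin f g a b |a b. (a \<or> b) \<and> (a \<and> b) = c}"
  thus "k \<bullet> i = k' \<bullet> i" using assms(9) by blast
qed

lemma pin_ext_right2:
  assumes "f \<in> Ar S" "g \<in> Ar S" "w \<in> Ob S" "w' \<in> Ob S" "k \<in> Ar S" "k' \<in> Ar S"
    "Dom S k = (ev S (f \<box> g) c \<odot> w) \<odot> w'" "Dom S k' = (ev S (f \<box> g) c \<odot> w) \<odot> w'" "Cod S k = Cod S k'"
    "\<And>a b. a \<or> b \<Longrightarrow> (a \<and> b) = c \<Longrightarrow>
      k \<bullet> ((pin f g a b \<rhd> w) \<rhd> w') = k' \<bullet> ((pin f g a b \<rhd> w) \<rhd> w')"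
  shows "k = k'"
proof (rule jointly_epicD[OF tensor_right_jointly_epic[OF
      tensor_right_jointly_epic[OF pin_jointly_epic[OF assms(1,2)] assms(3)] assms(4)] assms(5-9)])
  fix i assume "i \<in> (\<lambda>i. i \<rhd> w') ` (\<lambda>i. i \<rhd> w) ` {pin f g a b |a b. (a \<or> b) \<and> (a \<and> b) = c}"
  thus "k \<bullet> i = k' \<bullet> i" using assms(10) by blast
qed

lemma pin_ext_left:
  assumes "f \<in> Ar S" "g \<in> Ar S" "w \<in> Ob S" "k \<in> Ar S" "k' \<in> Ar S" "Dom S k = w \<odot> ev S (f \<box> g) c"
    "Dom S k' = w \<odot> ev S (f \<box> g) c" "Cod S k = Cod S k'"
    "\<And>a b. a \<or> b \<Longrightarrow> (a \<and> b) = c \<Longrightarrow> k \<bullet> (w \<lhd> pin f g a b) = k' \<bullet> (w \<lhd> pin f g a b)"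
  shows "k = k'"
proof (rule jointly_epicD[OF tensor_left_jointly_epic[OF pin_jointly_epic[OF assms(1,2)] assms(3)] assms(4-8)])
  fix i assume "i \<in> (\<lambda>i. w \<lhd> i) ` {pin f g a b |a b. (a \<or> b) \<and> (a \<and> b) = c}"
  thus "k \<bullet> i = k' \<bullet> i" using assms(9) by blast
qed

text \<open>For three factors the generators are the triples of indices with at most one \<open>False\<close>, on which all
  pairwise disjunctions hold: maps out of the outer pushout product are tested on its coprojections, whose
  domains contain a tensored inner pushout product, and \<open>pin_ext_right\<close> resolves that.\<close>

lemma pin_ext3:
  assumes fgh: "f \<in> Ar S" "g \<in> Ar S" "h \<in> Ar S" "k \<in> Ar S" "k' \<in> Ar S" "Dom S k = ev S ((f \<box> g) \<box> h) d"
    "Dom S k' = ev S ((f \<box> g) \<box> h) d" "Cod S k = Cod S k'"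
    and e: "\<And>a b c. a \<or> b \<Longrightarrow> a \<or> c \<Longrightarrow> b \<or> c \<Longrightarrow> (a \<and> b \<and> c) = d \<Longrightarrow>
      k \<bullet> (pin (f \<box> g) h (a \<and> b) c \<bullet> (pin f g a b \<rhd> ev S h c)) =
      k' \<bullet> (pin (f \<box> g) h (a \<and> b) c \<bullet> (pin f g a b \<rhd> ev S h c))"
  shows "k = k'"
proof (rule pin_ext[of "f \<box> g" h _ _ d])
  fix q c assume q: "q \<or> c" "(q \<and> c) = d"
  show "k \<bullet> pin (f \<box> g) h q c = k' \<bullet> pin (f \<box> g) h q c"
  proof (rule pin_ext_right[of f g "ev S h c" _ _ q])
    fix a b assume "a \<or> b" "(a \<and> b) = q"
    hence c: "a \<or> b" "a \<or> c" "b \<or> c" "(a \<and> b \<and> c) = d" "q = (a \<and> b)" using q by auto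
    show "(k \<bullet> pin (f \<box> g) h q c) \<bullet> (pin f g a b \<rhd> ev S h c) =
      (k' \<bullet> pin (f \<box> g) h q c) \<bullet> (pin f g a b \<rhd> ev S h c)"
      using e[OF c(1-4)] fgh q(2) unfolding c(5) by simp
  qed (use fgh q in auto)
qed (use fgh in auto)

text \<open>The same for the other bracketing, with \<open>pin_ext_left\<close> in place of \<open>pin_ext_right\<close>.\<close>

lemma pin_ext3_left:
  assumes fgh: "f \<in> Ar S" "g \<in> Ar S" "h \<in> Ar S" "k \<in> Ar S" "k' \<in> Ar S" "Dom S k = ev S (f \<box> (g \<box> h)) d"
    "Dom S k' = ev S (f \<box> (g \<box> h)) d" "Cod S k = Cod S k'"
    and e: "\<And>a b c. a \<or> b \<Longrightarrow> a \<or> c \<Longrightarrow> b \<or> c \<Longrightarrow> (a \<and> b \<and> c) = d \<Longrightarrow>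
      k \<bullet> (pin f (g \<box> h) a (b \<and> c) \<bullet> (ev S f a \<lhd> pin g h b c)) =
      k' \<bullet> (pin f (g \<box> h) a (b \<and> c) \<bullet> (ev S f a \<lhd> pin g h b c))"
  shows "k = k'"
proof (rule pin_ext[of f "g \<box> h" _ _ d])
  fix a q assume q: "a \<or> q" "(a \<and> q) = d"
  show "k \<bullet> pin f (g \<box> h) a q = k' \<bullet> pin f (g \<box> h) a q"
  proof (rule pin_ext_left[of g h "ev S f a" _ _ q])
    fix b c assume "b \<or> c" "(b \<and> c) = q"
    hence c: "a \<or> b" "a \<or> c" "b \<or> c" "(a \<and> b \<and> c) = d" "q = (b \<and> c)" using q by auto
    show "(k \<bullet> pin f (g \<box> h) a q) \<bullet> (ev S f a \<lhd> pin g h b c) =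
      (k' \<bullet> pin f (g \<box> h) a q) \<bullet> (ev S f a \<lhd> pin g h b c)"
      using e[OF c(1-4)] fgh q(2) unfolding c(5) by simp
  qed (use fgh q in auto)
qed (use fgh in auto)

lemma pin_ext4:
  assumes fgh: "f \<in> Ar S" "g \<in> Ar S" "h \<in> Ar S" "l \<in> Ar S" "k \<in> Ar S" "k' \<in> Ar S"
    "Dom S k = ev S (((f \<box> g) \<box> h) \<box> l) z" "Dom S k' = ev S (((f \<box> g) \<box> h) \<box> l) z" "Cod S k = Cod S k'"
    and e: "\<And>a b c d. a \<or> b \<Longrightarrow> a \<or> c \<Longrightarrow> b \<or> c \<Longrightarrow> a \<or> d \<Longrightarrow> b \<or> d \<Longrightarrow> c \<or> d \<Longrightarrow> (a \<and> b \<and> c \<and> d) = z \<Longrightarrow>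
      k \<bullet> (pin ((f \<box> g) \<box> h) l (a \<and> b \<and> c) d \<bullet> ((pin (f \<box> g) h (a \<and> b) c \<bullet>
        (pin f g a b \<rhd> ev S h c)) \<rhd> ev S l d)) =
      k' \<bullet> (pin ((f \<box> g) \<box> h) l (a \<and> b \<and> c) d \<bullet> ((pin (f \<box> g) h (a \<and> b) c \<bullet>
        (pin f g a b \<rhd> ev S h c)) \<rhd> ev S l d))"
  shows "k = k'"
proof (rule pin_ext3[of "f \<box> g" h l _ _ z])
  fix q c d assume q: "q \<or> c" "q \<or> d" "c \<or> d" "(q \<and> c \<and> d) = z"
  show "k \<bullet> (pin ((f \<box> g) \<box> h) l (q \<and> c) d \<bullet> (pin (f \<box> g) h q c \<rhd> ev S l d)) =
    k' \<bullet> (pin ((f \<box> g) \<box> h) l (q \<and> c) d \<bullet> (pin (f \<box> g) h q c \<rhd> ev S l d))"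
  proof (rule pin_ext_right2[of f g "ev S h c" "ev S l d" _ _ q])
    fix a b assume "a \<or> b" "(a \<and> b) = q"
    hence c: "a \<or> b" "a \<or> c" "b \<or> c" "a \<or> d" "b \<or> d" "c \<or> d" "(a \<and> b \<and> c \<and> d) = z" "q = (a \<and> b)"
      using q by auto
    show "(k \<bullet> (pin ((f \<box> g) \<box> h) l (q \<and> c) d \<bullet> (pin (f \<box> g) h q c \<rhd> ev S l d))) \<bullet>
        ((pin f g a b \<rhd> ev S h c) \<rhd> ev S l d) =
      (k' \<bullet> (pin ((f \<box> g) \<box> h) l (q \<and> c) d \<bullet> (pin (f \<box> g) h q c \<rhd> ev S l d))) \<bullet>
        ((pin f g a b \<rhd> ev S h c) \<rhd> ev S l d)"
      using e[OF c(1-7)] fgh q(4) unfolding c(8) by (simp add: interchange)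
  qed (use fgh q in auto)
qed (use fgh in auto)

end

section \<open>The pushout product monoidal structure\<close>

context smcc
begin

subsection \<open>Functoriality\<close>

lemma arr_tensor_eq: "arr_tensor S \<alpha> \<beta> =
  (sq_src \<alpha> \<box> sq_src \<beta>, sq_trg \<alpha> \<box> sq_trg \<beta>,
   pp_desc S (sq_src \<alpha>) (sq_src \<beta>)
     (pp_in1 S (sq_trg \<alpha>) (sq_trg \<beta>) \<bullet> (sqc \<alpha> False \<otimes> sqc \<beta> True))
     (pp_in2 S (sq_trg \<alpha>) (sq_trg \<beta>) \<bullet> (sqc \<alpha> True \<otimes> sqc \<beta> False)),
   sqc \<alpha> True \<otimes> sqc \<beta> True)"
  by (cases \<alpha>; cases \<beta>) (simp add: arr_tensor_def)

lemma arr_tensor_sel [simp]: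
  "sq_src (arr_tensor S \<alpha> \<beta>) = sq_src \<alpha> \<box> sq_src \<beta>" "sq_trg (arr_tensor S \<alpha> \<beta>) = sq_trg \<alpha> \<box> sq_trg \<beta>"
  by (simp_all add: arr_tensor_eq)

text \<open>On the component \<open>(a, b)\<close> the tensor product of squares is the tensor product of their components. As these
  coprojections are jointly epic, this determines it.\<close>

lemma
  assumes \<alpha>: "\<alpha> \<in> squares S" and \<beta>: "\<beta> \<in> squares S"
  shows arr_tensor_square [simp]: "arr_tensor S \<alpha> \<beta> \<in> squares S"
    and arr_tensor_pin: "a \<or> b \<Longrightarrow> sqc (arr_tensor S \<alpha> \<beta>) (a \<and> b) \<bullet> pin (sq_src \<alpha>) (sq_src \<beta>) a b =
      pin (sq_trg \<alpha>) (sq_trg \<beta>) a b \<bullet> (sqc \<alpha> a \<otimes> sqc \<beta> b)"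
proof -
  note d [simp] = squareD[OF \<alpha>] squareD[OF \<beta>]
  note c = square_commutes[OF \<alpha>] square_commutes[OF \<beta>]
  let ?f = "sq_src \<alpha>" and ?g = "sq_src \<beta>" and ?f' = "sq_trg \<alpha>" and ?g' = "sq_trg \<beta>"
  let ?u = "pp_in1 S ?f' ?g' \<bullet> (sqc \<alpha> False \<otimes> sqc \<beta> True)"
  let ?v = "pp_in2 S ?f' ?g' \<bullet> (sqc \<alpha> True \<otimes> sqc \<beta> False)"
  let ?D = "pp_desc S ?f ?g ?u ?v"
  have "?u \<bullet> (Dom S ?f \<lhd> ?g) = pp_in1 S ?f' ?g' \<bullet> (sqc \<alpha> False \<otimes> (sqc \<beta> True \<bullet> ?g))"
    by (simp add: interchange)
  also have "\<dots> = (pp_in1 S ?f' ?g' \<bullet> (Dom S ?f' \<lhd> ?g')) \<bullet> (sqc \<alpha> False \<otimes> sqc \<beta> False)"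
    unfolding c[symmetric] by (simp add: interchange)
  also have "\<dots> = pp_in2 S ?f' ?g' \<bullet> ((?f' \<bullet> sqc \<alpha> False) \<otimes> sqc \<beta> False)"
    by (simp add: pp_commutes interchange)
  also have "\<dots> = ?v \<bullet> (?f \<rhd> Dom S ?g)"
    unfolding c by (simp add: interchange)
  finally have e: "?u \<bullet> (Dom S ?f \<lhd> ?g) = ?v \<bullet> (?f \<rhd> Dom S ?g)" .
  have D: "?D \<in> Ar S" "Dom S ?D = pp_dom S ?f ?g" "Cod S ?D = pp_dom S ?f' ?g'"
    "?D \<bullet> pp_in1 S ?f ?g = ?u" "?D \<bullet> pp_in2 S ?f ?g = ?v"
    using pp_desc[of ?f ?g ?u ?v, OF _ _ _ _ _ _ _ e] by simp_all
  show "arr_tensor S \<alpha> \<beta> \<in> squares S"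
    unfolding arr_tensor_eq
  proof (rule squareI)
    show "(?f' \<box> ?g') \<bullet> ?D = (sqc \<alpha> True \<otimes> sqc \<beta> True) \<bullet> (?f \<box> ?g)"
    proof (rule pp_ext[of ?f ?g])
      show "((?f' \<box> ?g') \<bullet> ?D) \<bullet> pp_in1 S ?f ?g = ((sqc \<alpha> True \<otimes> sqc \<beta> True) \<bullet> (?f \<box> ?g)) \<bullet> pp_in1 S ?f ?g"
        using D comp_chain[OF box_in(1)] by (simp add: box_in(1) interchange c)
      show "((?f' \<box> ?g') \<bullet> ?D) \<bullet> pp_in2 S ?f ?g = ((sqc \<alpha> True \<otimes> sqc \<beta> True) \<bullet> (?f \<box> ?g)) \<bullet> pp_in2 S ?f ?g"
        using D comp_chain[OF box_in(2)] by (simp add: box_in(2) interchange c)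
    qed (use D in auto)
  qed (use D in auto)
  show "sqc (arr_tensor S \<alpha> \<beta>) (a \<and> b) \<bullet> pin ?f ?g a b = pin ?f' ?g' a b \<bullet> (sqc \<alpha> a \<otimes> sqc \<beta> b)"
    if "a \<or> b"
    using that D by (cases a; cases b) (simp_all add: arr_tensor_eq)
qed

subsection \<open>Three-fold pushout products\<close>

text \<open>The universal property of \<open>(f \<box> g) \<box> h\<close> on domains: three maps, one for each position of the single
  domain among the factors, that agree on the components with two domains. The first two are glued along the
  pushout of \<open>f \<box> g\<close> tensored with the codomain of \<open>h\<close>; compatibility of the result with the third is tested
  on the same pushout tensored with the domain of \<open>h\<close>.\<close>

lemma pp_desc3:
  assumes fgh [simp]: "f \<in> Ar S" "g \<in> Ar S" "h \<in> Ar S"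
    and u [simp]: "u \<in> Ar S" "Dom S u = (Dom S f \<odot> Cod S g) \<odot> Cod S h" "Cod S u = z"
    and v [simp]: "v \<in> Ar S" "Dom S v = (Cod S f \<odot> Dom S g) \<odot> Cod S h" "Cod S v = z"
    and w [simp]: "w \<in> Ar S" "Dom S w = (Cod S f \<odot> Cod S g) \<odot> Dom S h" "Cod S w = z"
    and uv: "u \<bullet> ((Dom S f \<lhd> g) \<rhd> Cod S h) = v \<bullet> ((f \<rhd> Dom S g) \<rhd> Cod S h)"
    and uw: "u \<bullet> ((Dom S f \<odot> Cod S g) \<lhd> h) = w \<bullet> ((f \<rhd> Cod S g) \<rhd> Dom S h)"
    and vw: "v \<bullet> ((Cod S f \<odot> Dom S g) \<lhd> h) = w \<bullet> ((Cod S f \<lhd> g) \<rhd> Dom S h)"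
  obtains k where "k \<in> Ar S" "Dom S k = pp_dom S (f \<box> g) h" "Cod S k = z"
    "k \<bullet> (pp_in1 S (f \<box> g) h \<bullet> (pp_in1 S f g \<rhd> Cod S h)) = u"
    "k \<bullet> (pp_in1 S (f \<box> g) h \<bullet> (pp_in2 S f g \<rhd> Cod S h)) = v"
    "k \<bullet> pp_in2 S (f \<box> g) h = w"
proof -
  have po: "is_pushout S ((Dom S f \<lhd> g) \<rhd> x) ((f \<rhd> Dom S g) \<rhd> x)
      (pp_in1 S f g \<rhd> x) (pp_in2 S f g \<rhd> x)" if "x \<in> Ob S" for x
    by (rule tensor_right_pushout[OF pp_is_pushout]) (use that in auto)
  obtain k1 where k1: "k1 \<in> Ar S" "Dom S k1 = pp_dom S f g \<odot> Cod S h" "Cod S k1 = z"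
    "k1 \<bullet> (pp_in1 S f g \<rhd> Cod S h) = u" "k1 \<bullet> (pp_in2 S f g \<rhd> Cod S h) = v"
    by (rule is_pushout_desc[OF po[of "Cod S h"], of u v]) (use uv in auto)
  have "k1 \<bullet> (pp_dom S f g \<lhd> h) = w \<bullet> ((f \<box> g) \<rhd> Dom S h)"
  proof (rule jointly_epicD[OF pushout_jointly_epic[OF po[of "Dom S h"]]])
    fix i assume "i \<in> {pp_in1 S f g \<rhd> Dom S h, pp_in2 S f g \<rhd> Dom S h}"
    moreover have "(k1 \<bullet> (pp_dom S f g \<lhd> h)) \<bullet> (pp_in1 S f g \<rhd> Dom S h) =
        (k1 \<bullet> (pp_in1 S f g \<rhd> Cod S h)) \<bullet> ((Dom S f \<odot> Cod S g) \<lhd> h)"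
      using k1(1-3) by (simp add: interchange del: tensor_id)
    moreover have "(k1 \<bullet> (pp_dom S f g \<lhd> h)) \<bullet> (pp_in2 S f g \<rhd> Dom S h) =
        (k1 \<bullet> (pp_in2 S f g \<rhd> Cod S h)) \<bullet> ((Cod S f \<odot> Dom S g) \<lhd> h)"
      using k1(1-3) by (simp add: interchange del: tensor_id)
    ultimately show "(k1 \<bullet> (pp_dom S f g \<lhd> h)) \<bullet> i = (w \<bullet> ((f \<box> g) \<rhd> Dom S h)) \<bullet> i"
      using k1 uw vw by (auto simp: interchange box_in)
  qed (use k1 in auto)
  hence "k1 \<bullet> ((Dom S (f \<box> g)) \<lhd> h) = w \<bullet> ((f \<box> g) \<rhd> Dom S h)" by simp
  note * = pp_desc[of "f \<box> g" h k1 w, OF _ _ _ _ _ _ _ this]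
  show thesis
  proof
    let ?k = "pp_desc S (f \<box> g) h k1 w"
    show k: "?k \<in> Ar S" "Dom S ?k = pp_dom S (f \<box> g) h" "Cod S ?k = z" "?k \<bullet> pp_in2 S (f \<box> g) h = w"
      using * k1(1-3) by simp_all
    have "?k \<bullet> (pp_in1 S (f \<box> g) h \<bullet> (i \<rhd> Cod S h)) = k1 \<bullet> (i \<rhd> Cod S h)"
      if "i \<in> Ar S" "Cod S i = pp_dom S f g" for i
      by (rule comp_chain[OF *(4)]) (use that k k1(1-3) in simp_all)
    thus "?k \<bullet> (pp_in1 S (f \<box> g) h \<bullet> (pp_in1 S f g \<rhd> Cod S h)) = u"
      "?k \<bullet> (pp_in1 S (f \<box> g) h \<bullet> (pp_in2 S f g \<rhd> Cod S h)) = v"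
      using k1 by simp_all
  qed
qed

text \<open>The universal property of \<open>f \<box> (g \<box> h)\<close>, by tensoring the pushout of \<open>g \<box> h\<close> on the left.\<close>

lemma pp_desc3_left:
  assumes fgh [simp]: "f \<in> Ar S" "g \<in> Ar S" "h \<in> Ar S"
    and u [simp]: "u \<in> Ar S" "Dom S u = Dom S f \<odot> (Cod S g \<odot> Cod S h)" "Cod S u = z"
    and v [simp]: "v \<in> Ar S" "Dom S v = Cod S f \<odot> (Dom S g \<odot> Cod S h)" "Cod S v = z"
    and w [simp]: "w \<in> Ar S" "Dom S w = Cod S f \<odot> (Cod S g \<odot> Dom S h)" "Cod S w = z"
    and uv: "u \<bullet> (Dom S f \<lhd> (g \<rhd> Cod S h)) = v \<bullet> (f \<rhd> (Dom S g \<odot> Cod S h))"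
    and uw: "u \<bullet> (Dom S f \<lhd> (Cod S g \<lhd> h)) = w \<bullet> (f \<rhd> (Cod S g \<odot> Dom S h))"
    and vw: "v \<bullet> (Cod S f \<lhd> (Dom S g \<lhd> h)) = w \<bullet> (Cod S f \<lhd> (g \<rhd> Dom S h))"
  obtains k where "k \<in> Ar S" "Dom S k = pp_dom S f (g \<box> h)" "Cod S k = z"
    "k \<bullet> pp_in1 S f (g \<box> h) = u"
    "k \<bullet> (pp_in2 S f (g \<box> h) \<bullet> (Cod S f \<lhd> pp_in1 S g h)) = v"
    "k \<bullet> (pp_in2 S f (g \<box> h) \<bullet> (Cod S f \<lhd> pp_in2 S g h)) = w"
proof -
  have po: "is_pushout S (x \<lhd> (Dom S g \<lhd> h)) (x \<lhd> (g \<rhd> Dom S h))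
      (x \<lhd> pp_in1 S g h) (x \<lhd> pp_in2 S g h)" if "x \<in> Ob S" for x
    by (rule tensor_left_pushout[OF pp_is_pushout]) (use that in auto)
  obtain k1 where k1: "k1 \<in> Ar S" "Dom S k1 = Cod S f \<odot> pp_dom S g h" "Cod S k1 = z"
    "k1 \<bullet> (Cod S f \<lhd> pp_in1 S g h) = v" "k1 \<bullet> (Cod S f \<lhd> pp_in2 S g h) = w"
    by (rule is_pushout_desc[OF po[of "Cod S f"], of v w]) (use vw in auto)
  have "u \<bullet> (Dom S f \<lhd> (g \<box> h)) = k1 \<bullet> (f \<rhd> pp_dom S g h)"
  proof (rule jointly_epicD[OF pushout_jointly_epic[OF po[of "Dom S f"]]])
    fix i assume "i \<in> {Id S (Dom S f) \<otimes> pp_in1 S g h, Dom S f \<lhd> pp_in2 S g h}"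
    moreover have "(k1 \<bullet> (f \<rhd> pp_dom S g h)) \<bullet> (Dom S f \<lhd> pp_in1 S g h) =
        (k1 \<bullet> (Cod S f \<lhd> pp_in1 S g h)) \<bullet> (f \<rhd> (Dom S g \<odot> Cod S h))"
      using k1(1-3) by (simp add: interchange del: tensor_id)
    moreover have "(k1 \<bullet> (f \<rhd> pp_dom S g h)) \<bullet> (Dom S f \<lhd> pp_in2 S g h) =
        (k1 \<bullet> (Cod S f \<lhd> pp_in2 S g h)) \<bullet> (f \<rhd> (Cod S g \<odot> Dom S h))"
      using k1(1-3) by (simp add: interchange del: tensor_id)
    ultimately show "(u \<bullet> (Dom S f \<lhd> (g \<box> h))) \<bullet> i = (k1 \<bullet> (f \<rhd> pp_dom S g h)) \<bullet> i"
      using k1 uv uw by (auto simp: interchange box_in)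
  qed (use k1 in auto)
  hence "u \<bullet> (Dom S f \<lhd> (g \<box> h)) = k1 \<bullet> (f \<rhd> (Dom S (g \<box> h)))" by simp
  note * = pp_desc[of f "g \<box> h" u k1, OF _ _ _ _ _ _ _ this]
  show thesis
  proof
    let ?k = "pp_desc S f (g \<box> h) u k1"
    show k: "?k \<in> Ar S" "Dom S ?k = pp_dom S f (g \<box> h)" "Cod S ?k = z" "?k \<bullet> pp_in1 S f (g \<box> h) = u"
      using * k1(1-3) by simp_all
    have "?k \<bullet> (pp_in2 S f (g \<box> h) \<bullet> (Cod S f \<lhd> i)) = k1 \<bullet> (Cod S f \<lhd> i)"
      if "i \<in> Ar S" "Cod S i = pp_dom S g h" for i
      by (rule comp_chain[OF *(5)]) (use that k k1(1-3) in simp_all)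
    thus "?k \<bullet> (pp_in2 S f (g \<box> h) \<bullet> (Cod S f \<lhd> pp_in1 S g h)) = v"
      "?k \<bullet> (pp_in2 S f (g \<box> h) \<bullet> (Cod S f \<lhd> pp_in2 S g h)) = w"
      using k1 by simp_all
  qed
qed

lemma pin_ext3_dom:
  assumes fgh: "f \<in> Ar S" "g \<in> Ar S" "h \<in> Ar S" "k \<in> Ar S" "k' \<in> Ar S" "Dom S k = pp_dom S (f \<box> g) h"
    "Dom S k' = pp_dom S (f \<box> g) h" "Cod S k = Cod S k'"
    and e: "k \<bullet> (pp_in1 S (f \<box> g) h \<bullet> (pp_in1 S f g \<rhd> Cod S h)) =
      k' \<bullet> (pp_in1 S (f \<box> g) h \<bullet> (pp_in1 S f g \<rhd> Cod S h))"
      "k \<bullet> (pp_in1 S (f \<box> g) h \<bullet> (pp_in2 S f g \<rhd> Cod S h)) =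
      k' \<bullet> (pp_in1 S (f \<box> g) h \<bullet> (pp_in2 S f g \<rhd> Cod S h))"
      "k \<bullet> pp_in2 S (f \<box> g) h = k' \<bullet> pp_in2 S (f \<box> g) h"
  shows "k = k'"
proof (rule pin_ext3[of f g h _ _ False])
  fix a b c assume c: "a \<or> b" "a \<or> c" "b \<or> c" "(a \<and> b \<and> c) = False"
  show "k \<bullet> (pin (f \<box> g) h (a \<and> b) c \<bullet> (pin f g a b \<rhd> ev S h c)) =
      k' \<bullet> (pin (f \<box> g) h (a \<and> b) c \<bullet> (pin f g a b \<rhd> ev S h c))"
    using c e fgh by (cases a; cases b; cases c) simp_all
qed (use fgh in auto)

lemma pin_ext3_left_dom:
  assumes fgh: "f \<in> Ar S" "g \<in> Ar S" "h \<in> Ar S" "k \<in> Ar S" "k' \<in> Ar S" "Dom S k = pp_dom S f (g \<box> h)"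
    "Dom S k' = pp_dom S f (g \<box> h)" "Cod S k = Cod S k'"
    and e: "k \<bullet> pp_in1 S f (g \<box> h) = k' \<bullet> pp_in1 S f (g \<box> h)"
      "k \<bullet> (pp_in2 S f (g \<box> h) \<bullet> (Cod S f \<lhd> pp_in1 S g h)) =
      k' \<bullet> (pp_in2 S f (g \<box> h) \<bullet> (Cod S f \<lhd> pp_in1 S g h))"
      "k \<bullet> (pp_in2 S f (g \<box> h) \<bullet> (Cod S f \<lhd> pp_in2 S g h)) =
      k' \<bullet> (pp_in2 S f (g \<box> h) \<bullet> (Cod S f \<lhd> pp_in2 S g h))"
  shows "k = k'"
proof (rule pin_ext3_left[of f g h _ _ False])
  fix a b c assume c: "a \<or> b" "a \<or> c" "b \<or> c" "(a \<and> b \<and> c) = False"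
  show "k \<bullet> (pin f (g \<box> h) a (b \<and> c) \<bullet> (ev S f a \<lhd> pin g h b c)) =
      k' \<bullet> (pin f (g \<box> h) a (b \<and> c) \<bullet> (ev S f a \<lhd> pin g h b c))"
    using c e fgh by (cases a; cases b; cases c) simp_all
qed (use fgh in auto)

subsection \<open>Associativity\<close>

lemma Assoc_nat_Id_left:
  assumes "x \<in> Ob S" "y \<in> Ob S" "h \<in> Ar S" "z = Cod S h"
  shows "Assoc S x y z \<bullet> ((x \<odot> y) \<lhd> h) = (x \<lhd> (y \<lhd> h)) \<bullet> Assoc S x y (Dom S h)"
  using Assoc_nat[of "Id S x" "Id S y" h x y z] assms by simp

definition assoc_inv :: "'o \<Rightarrow> 'o \<Rightarrow> 'o \<Rightarrow> 'a" where
  "assoc_inv x y z = (SOME k. k \<in> Ar S \<and> Dom S k = x \<odot> (y \<odot> z) \<and> Cod S k = (x \<odot> y) \<odot> z \<and>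
     k \<bullet> Assoc S x y z = Id S ((x \<odot> y) \<odot> z) \<and> Assoc S x y z \<bullet> k = Id S (x \<odot> (y \<odot> z)))"

lemma assoc_inv [simp]:
  assumes "x \<in> Ob S" "y \<in> Ob S" "z \<in> Ob S"
  shows "assoc_inv x y z \<in> Ar S" "Dom S (assoc_inv x y z) = x \<odot> (y \<odot> z)"
    "Cod S (assoc_inv x y z) = (x \<odot> y) \<odot> z"
    "assoc_inv x y z \<bullet> Assoc S x y z = Id S ((x \<odot> y) \<odot> z)"
    "Assoc S x y z \<bullet> assoc_inv x y z = Id S (x \<odot> (y \<odot> z))"
proof -
  let ?P = "\<lambda>k. k \<in> Ar S \<and> Dom S k = x \<odot> (y \<odot> z) \<and> Cod S k = (x \<odot> y) \<odot> z \<and>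
     k \<bullet> Assoc S x y z = Id S ((x \<odot> y) \<odot> z) \<and> Assoc S x y z \<bullet> k = Id S (x \<odot> (y \<odot> z))"
  obtain k where "?P k" by (rule is_isoE[OF assoc_iso[OF assms]], rule that) (use assms in simp)
  hence "?P (assoc_inv x y z)" unfolding assoc_inv_def by (rule someI)
  thus "assoc_inv x y z \<in> Ar S" "Dom S (assoc_inv x y z) = x \<odot> (y \<odot> z)"
    "Cod S (assoc_inv x y z) = (x \<odot> y) \<odot> z"
    "assoc_inv x y z \<bullet> Assoc S x y z = Id S ((x \<odot> y) \<odot> z)"
    "Assoc S x y z \<bullet> assoc_inv x y z = Id S (x \<odot> (y \<odot> z))"
    by blast+
qed

lemma assoc_inv_nat:
  assumes fgh [simp]: "f \<in> Ar S" "g \<in> Ar S" "h \<in> Ar S" and "x = Cod S f" "y = Cod S g" "z = Cod S h"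
  shows "assoc_inv x y z \<bullet> (f \<otimes> (g \<otimes> h)) = ((f \<otimes> g) \<otimes> h) \<bullet> assoc_inv (Dom S f) (Dom S g) (Dom S h)"
proof -
  let ?A = "Assoc S (Dom S f) (Dom S g) (Dom S h)" and ?B = "assoc_inv (Dom S f) (Dom S g) (Dom S h)"
  have "assoc_inv x y z \<bullet> (f \<otimes> (g \<otimes> h)) = assoc_inv x y z \<bullet> (((f \<otimes> (g \<otimes> h)) \<bullet> ?A) \<bullet> ?B)"
    using assms by simp
  also have "(f \<otimes> (g \<otimes> h)) \<bullet> ?A = Assoc S x y z \<bullet> ((f \<otimes> g) \<otimes> h)"
    using assms by (simp add: Assoc_nat)
  also have "assoc_inv x y z \<bullet> ((Assoc S x y z \<bullet> ((f \<otimes> g) \<otimes> h)) \<bullet> ?B) = ((f \<otimes> g) \<otimes> h) \<bullet> ?B"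
    using comp_chain[OF assoc_inv(4)[of x y z]] assms by simp
  finally show ?thesis .
qed

lemma arr_assoc_sel [simp]:
  "sq_src (arr_assoc S f g h) = (f \<box> g) \<box> h" "sq_trg (arr_assoc S f g h) = f \<box> (g \<box> h)"
  by (simp_all add: arr_assoc_def)

text \<open>Both bracketings have the same universal property up to the associator of \<open>S\<close>, so the associator and
  its inverse induce mutually inverse maps on domains. The middle statement says that on every component the
  associator of arrows is the associator of \<open>S\<close>.\<close>

lemma
  assumes fgh [simp]: "f \<in> Ar S" "g \<in> Ar S" "h \<in> Ar S"
  shows arr_assoc_square [simp]: "arr_assoc S f g h \<in> squares S"
    and arr_assoc_pin: "a \<or> b \<Longrightarrow> a \<or> c \<Longrightarrow> b \<or> c \<Longrightarrow> sqc (arr_assoc S f g h) (a \<and> b \<and> c) \<bullet>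
      (pin (f \<box> g) h (a \<and> b) c \<bullet> (pin f g a b \<rhd> ev S h c)) =
      pin f (g \<box> h) a (b \<and> c) \<bullet> ((ev S f a \<lhd> pin g h b c) \<bullet> Assoc S (ev S f a) (ev S g b) (ev S h c))"
    and arr_assoc_iso: "is_iso (Arr S) (arr_assoc S f g h)"
proof -
  let ?A = "Assoc S"
  let ?u = "pp_in1 S f (g \<box> h) \<bullet> ?A (Dom S f) (Cod S g) (Cod S h)"
  let ?v = "pp_in2 S f (g \<box> h) \<bullet> ((Cod S f \<lhd> pp_in1 S g h) \<bullet> ?A (Cod S f) (Dom S g) (Cod S h))"
  let ?w = "pp_in2 S f (g \<box> h) \<bullet> ((Cod S f \<lhd> pp_in2 S g h) \<bullet> ?A (Cod S f) (Cod S g) (Dom S h))"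
  let ?P = "\<lambda>k. k \<in> hom S (pp_dom S (f \<box> g) h) (pp_dom S f (g \<box> h)) \<and>
        k \<bullet> (pp_in1 S (f \<box> g) h \<bullet> (pp_in1 S f g \<rhd> Cod S h)) = ?u \<and>
        k \<bullet> (pp_in1 S (f \<box> g) h \<bullet> (pp_in2 S f g \<rhd> Cod S h)) = ?v \<and>
        k \<bullet> pp_in2 S (f \<box> g) h = ?w"
  have gh: "pp_in1 S f (g \<box> h) \<bullet> ((Dom S f \<lhd> (g \<box> h)) \<bullet> k) =
      pp_in2 S f (g \<box> h) \<bullet> ((f \<rhd> pp_dom S g h) \<bullet> k)"
    if "k \<in> Ar S" "Cod S k = Dom S f \<odot> pp_dom S g h" for k
    by (rule comp_chain_eq[OF pp_commutes]) (use that in auto)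
  have "\<exists>!k. ?P k"
  proof (rule ex_ex1I)
    have 1: "?u \<bullet> ((Dom S f \<lhd> g) \<rhd> Cod S h) =
      pp_in1 S f (g \<box> h) \<bullet> ((Dom S f \<lhd> (g \<rhd> Cod S h)) \<bullet> ?A (Dom S f) (Dom S g) (Cod S h))"
      by (simp add: Assoc_nat)
    also have "\<dots> = pp_in1 S f (g \<box> h) \<bullet> ((Dom S f \<lhd> (g \<box> h)) \<bullet>
      ((Dom S f \<lhd> pp_in1 S g h) \<bullet> ?A (Dom S f) (Dom S g) (Cod S h)))"
      by (simp add: interchange_chain box_in)
    also have "\<dots> = pp_in2 S f (g \<box> h) \<bullet> ((f \<rhd> pp_dom S g h) \<bullet>
      ((Dom S f \<lhd> pp_in1 S g h) \<bullet> ?A (Dom S f) (Dom S g) (Cod S h)))"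
      by (rule gh) simp_all
    also have "\<dots> = ?v \<bullet> ((f \<rhd> Dom S g) \<rhd> Cod S h)"
      by (simp add: interchange_chain Assoc_nat)
    finally have uv: "?u \<bullet> ((Dom S f \<lhd> g) \<rhd> Cod S h) =
      ?v \<bullet> ((f \<rhd> Dom S g) \<rhd> Cod S h)" .
    have "?u \<bullet> ((Dom S f \<odot> Cod S g) \<lhd> h) =
      pp_in1 S f (g \<box> h) \<bullet> ((Dom S f \<lhd> (Cod S g \<lhd> h)) \<bullet> ?A (Dom S f) (Cod S g) (Dom S h))"
      by (simp add: Assoc_nat_Id_left)
    also have "\<dots> = pp_in1 S f (g \<box> h) \<bullet> ((Dom S f \<lhd> (g \<box> h)) \<bullet>
      ((Dom S f \<lhd> pp_in2 S g h) \<bullet> ?A (Dom S f) (Cod S g) (Dom S h)))"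
      by (simp add: interchange_chain box_in)
    also have "\<dots> = pp_in2 S f (g \<box> h) \<bullet> ((f \<rhd> pp_dom S g h) \<bullet>
      ((Dom S f \<lhd> pp_in2 S g h) \<bullet> ?A (Dom S f) (Cod S g) (Dom S h)))"
      by (rule gh) simp_all
    also have "\<dots> = ?w \<bullet> ((f \<rhd> Cod S g) \<rhd> Dom S h)"
      by (simp add: interchange_chain Assoc_nat)
    finally have uw: "?u \<bullet> ((Dom S f \<odot> Cod S g) \<lhd> h) =
      ?w \<bullet> ((f \<rhd> Cod S g) \<rhd> Dom S h)" .
    have vw: "?v \<bullet> ((Cod S f \<odot> Dom S g) \<lhd> h) = ?w \<bullet> ((Cod S f \<lhd> g) \<rhd> Dom S h)"
      by (simp add: Assoc_nat_Id_left Assoc_nat interchange_chain pp_commutes)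
    show "\<exists>k. ?P k"
      by (rule pp_desc3[OF fgh, of ?u _ ?v ?w, OF _ _ _ _ _ _ _ _ _ uv uw vw]) (auto simp: hom_iff)
    show "k = k'" if "?P k" "?P k'" for k k'
      by (rule pin_ext3_dom[OF fgh]) (use that in \<open>simp_all add: hom_iff\<close>)
  qed
  from theI'[OF this] have "?P (arr_assoc0 S f g h)"
    unfolding arr_assoc0_def Let_def .
  hence k: "arr_assoc0 S f g h \<in> Ar S" "Dom S (arr_assoc0 S f g h) = pp_dom S (f \<box> g) h"
    "Cod S (arr_assoc0 S f g h) = pp_dom S f (g \<box> h)"
    "arr_assoc0 S f g h \<bullet> (pp_in1 S (f \<box> g) h \<bullet> (pp_in1 S f g \<rhd> Cod S h)) = ?u"
    "arr_assoc0 S f g h \<bullet> (pp_in1 S (f \<box> g) h \<bullet> (pp_in2 S f g \<rhd> Cod S h)) = ?v"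
    "arr_assoc0 S f g h \<bullet> pp_in2 S (f \<box> g) h = ?w"
    by (auto simp: hom_iff)
  show sq: "arr_assoc S f g h \<in> squares S"
    unfolding arr_assoc_def
  proof (rule squareI)
    have b: "(f \<box> (g \<box> h)) \<bullet> (pp_in1 S f (g \<box> h) \<bullet> x) = (f \<rhd> (Cod S g \<odot> Cod S h)) \<bullet> x"
      if "x \<in> Ar S" "Cod S x = Dom S f \<odot> Cod S g \<odot> Cod S h" for x
      using comp_chain[OF box_in(1)[of f "g \<box> h"], of x] that by simp
    have b': "(f \<box> (g \<box> h)) \<bullet> (pp_in2 S f (g \<box> h) \<bullet> x) = (Cod S f \<lhd> (g \<box> h)) \<bullet> x"
      if "x \<in> Ar S" "Cod S x = Cod S f \<odot> pp_dom S g h" for x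
      using comp_chain[OF box_in(2)[of f "g \<box> h"], of x] that by simp
    have b'': "((f \<box> g) \<box> h) \<bullet> (pp_in1 S (f \<box> g) h \<bullet> x) = ((f \<box> g) \<rhd> Cod S h) \<bullet> x"
      if "x \<in> Ar S" "Cod S x = pp_dom S f g \<odot> Cod S h" for x
      using comp_chain[OF box_in(1)[of "f \<box> g" h], of x] that by simp
    show "(f \<box> (g \<box> h)) \<bullet> arr_assoc0 S f g h = ?A (Cod S f) (Cod S g) (Cod S h) \<bullet> ((f \<box> g) \<box> h)"
      by (rule pin_ext3_dom[OF fgh])
        (simp_all add: k b b' b'' box_in interchange interchange_chain Assoc_nat Assoc_nat_Id_left)
  qed (use k in auto)
  show "sqc (arr_assoc S f g h) (a \<and> b \<and> c) \<bullet>
      (pin (f \<box> g) h (a \<and> b) c \<bullet> (pin f g a b \<rhd> ev S h c)) =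
      pin f (g \<box> h) a (b \<and> c) \<bullet> ((ev S f a \<lhd> pin g h b c) \<bullet> ?A (ev S f a) (ev S g b) (ev S h c))"
    if "a \<or> b" "a \<or> c" "b \<or> c"
    using that k by (cases a; cases b; cases c) (simp_all add: arr_assoc_def)
  \<comment> \<open>The inverse on domains comes in the same way from the inverses of the associators.\<close>
  let ?B = assoc_inv
  let ?u' = "pp_in1 S (f \<box> g) h \<bullet> ((pp_in1 S f g \<rhd> Cod S h) \<bullet> ?B (Dom S f) (Cod S g) (Cod S h))"
  let ?v' = "pp_in1 S (f \<box> g) h \<bullet> ((pp_in2 S f g \<rhd> Cod S h) \<bullet> ?B (Cod S f) (Dom S g) (Cod S h))"
  let ?w' = "pp_in2 S (f \<box> g) h \<bullet> ?B (Cod S f) (Cod S g) (Dom S h)"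
  have fg: "pp_in1 S (f \<box> g) h \<bullet> ((pp_dom S f g \<lhd> h) \<bullet> k) =
      pp_in2 S (f \<box> g) h \<bullet> (((f \<box> g) \<rhd> Dom S h) \<bullet> k)"
    if "k \<in> Ar S" "Cod S k = pp_dom S f g \<odot> Dom S h" for k
    by (rule comp_chain_eq[OF pp_commutes]) (use that in auto)
  have uv: "?u' \<bullet> (Dom S f \<lhd> (g \<rhd> Cod S h)) = ?v' \<bullet> (f \<rhd> (Dom S g \<odot> Cod S h))"
    using assoc_inv_nat[of f "Id S (Dom S g)" "Id S (Cod S h)"]
    by (simp add: assoc_inv_nat interchange_chain pp_commutes)
  have "?u' \<bullet> (Dom S f \<lhd> (Cod S g \<lhd> h)) = pp_in1 S (f \<box> g) h \<bullet>
      ((pp_dom S f g \<lhd> h) \<bullet> ((pp_in1 S f g \<rhd> Dom S h) \<bullet> ?B (Dom S f) (Cod S g) (Dom S h)))"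
    by (simp add: assoc_inv_nat interchange_chain)
  also have "\<dots> = pp_in2 S (f \<box> g) h \<bullet> (((f \<box> g) \<rhd> Dom S h) \<bullet>
      ((pp_in1 S f g \<rhd> Dom S h) \<bullet> ?B (Dom S f) (Cod S g) (Dom S h)))"
    by (rule fg) simp_all
  also have "\<dots> = ?w' \<bullet> (f \<rhd> (Cod S g \<odot> Dom S h))"
    using assoc_inv_nat[of f "Id S (Cod S g)" "Id S (Dom S h)"]
    by (simp add: interchange_chain box_in)
  finally have uw: "?u' \<bullet> (Dom S f \<lhd> (Cod S g \<lhd> h)) = ?w' \<bullet> (f \<rhd> (Cod S g \<odot> Dom S h))" .
  have "?v' \<bullet> (Cod S f \<lhd> (Dom S g \<lhd> h)) = pp_in1 S (f \<box> g) h \<bullet>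
      ((pp_dom S f g \<lhd> h) \<bullet> ((pp_in2 S f g \<rhd> Dom S h) \<bullet> ?B (Cod S f) (Dom S g) (Dom S h)))"
    by (simp add: assoc_inv_nat interchange_chain)
  also have "\<dots> = pp_in2 S (f \<box> g) h \<bullet> (((f \<box> g) \<rhd> Dom S h) \<bullet>
      ((pp_in2 S f g \<rhd> Dom S h) \<bullet> ?B (Cod S f) (Dom S g) (Dom S h)))"
    by (rule fg) simp_all
  also have "\<dots> = ?w' \<bullet> (Cod S f \<lhd> (g \<rhd> Dom S h))"
    by (simp add: interchange_chain box_in assoc_inv_nat)
  finally have vw: "?v' \<bullet> (Cod S f \<lhd> (Dom S g \<lhd> h)) =
      ?w' \<bullet> (Cod S f \<lhd> (g \<rhd> Dom S h))" .
  obtain k' where k': "k' \<in> Ar S" "Dom S k' = pp_dom S f (g \<box> h)" "Cod S k' = pp_dom S (f \<box> g) h"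
    "k' \<bullet> pp_in1 S f (g \<box> h) = ?u'"
    "k' \<bullet> (pp_in2 S f (g \<box> h) \<bullet> (Cod S f \<lhd> pp_in1 S g h)) = ?v'"
    "k' \<bullet> (pp_in2 S f (g \<box> h) \<bullet> (Cod S f \<lhd> pp_in2 S g h)) = ?w'"
    by (rule pp_desc3_left[OF fgh, of ?u' _ ?v' ?w', OF _ _ _ _ _ _ _ _ _ uv uw vw]) auto
  let ?k = "arr_assoc0 S f g h"
  note cs = comp_chain[OF k(4)] comp_chain[OF k(5)] comp_chain[OF k(6)]
    comp_chain[OF k'(4)] comp_chain[OF k'(5)] comp_chain[OF k'(6)]
  have kk: "k' \<bullet> ?k = Id S (pp_dom S (f \<box> g) h)"
    by (rule pin_ext3_dom[OF fgh]) (use k k' cs in simp_all)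
  have kk': "?k \<bullet> k' = Id S (pp_dom S f (g \<box> h))"
    by (rule pin_ext3_left_dom[OF fgh]) (use k k' cs in simp_all)
  have "is_iso S ?k"
    by (rule is_isoI[of _ k']) (use k k' kk kk' in auto)
  show "is_iso (Arr S) (arr_assoc S f g h)"
  proof (rule Arr_is_iso[OF sq])
    show "is_iso S (sqc (arr_assoc S f g h) a)" for a
      using \<open>is_iso S ?k\<close> by (simp add: arr_assoc_def assoc_iso)
  qed
qed


subsection \<open>Units\<close>

lemma initial_ob_is_initial: "is_initial S (initial_ob S)"
  unfolding initial_ob_def by (rule someI_ex[OF initial_exists])

lemma initial_ob_Ob [simp]: "initial_ob S \<in> Ob S"
  using initial_ob_is_initial by (simp add: is_initial_def)

lemma initial_tensor_left: "w \<in> Ob S \<Longrightarrow> is_initial S (initial_ob S \<odot> w)"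
  by (rule left_adjoint.preserves_initial[OF tensor_right_adjoint initial_ob_is_initial])

lemma initial_tensor_right: "w \<in> Ob S \<Longrightarrow> is_initial S (w \<odot> initial_ob S)"
  by (rule left_adjoint.preserves_initial[OF tensor_left_adjoint initial_ob_is_initial])

lemma initial_eq:
  assumes "is_initial S x" "k \<in> Ar S" "k' \<in> Ar S" "Dom S k = x" "Dom S k' = x" "Cod S k = Cod S k'"
  shows "k = k'"
proof -
  have "\<exists>!f. f \<in> hom S x (Cod S k)" using assms by (auto simp: is_initial_def)
  thus ?thesis using assms by (auto simp: hom_iff)
qed

lemma initial_arrow:
  assumes "is_initial S x" "y \<in> Ob S"
  obtains k where "k \<in> Ar S" "Dom S k = x" "Cod S k = y"
  using assms by (auto simp: is_initial_def hom_iff)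

lemma arr_unit_arrow [simp]:
  "arr_unit S \<in> Ar S" "Dom S (arr_unit S) = initial_ob S" "Cod S (arr_unit S) = Unit S"
proof -
  have "\<exists>!f. f \<in> hom S (initial_ob S) (Unit S)"
    using initial_ob_is_initial by (auto simp: is_initial_def)
  from theI'[OF this] show "arr_unit S \<in> Ar S" "Dom S (arr_unit S) = initial_ob S" "Cod S (arr_unit S) = Unit S"
    by (auto simp: arr_unit_def initial_ar_def hom_iff)
qed

text \<open>The domain of the unit is initial and stays so after tensoring, so the components at its domain carry no
  information.\<close>

lemma pin_unit_left_jointly_epic:
  assumes g [simp]: "g \<in> Ar S"
  shows "jointly_epic S {pin (arr_unit S) g True c} (ev S (arr_unit S \<box> g) c)"
  unfolding jointly_epic_def
proof (intro conjI ballI impI)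
  fix k k' assume k: "k \<in> Ar S" "k' \<in> Ar S" and *: "Dom S k = ev S (arr_unit S \<box> g) c \<and>
    Dom S k' = ev S (arr_unit S \<box> g) c \<and> Cod S k = Cod S k' \<and>
    (\<forall>i\<in>{pin (arr_unit S) g True c}. k \<bullet> i = k' \<bullet> i)"
  show "k = k'"
  proof (rule pin_ext[of "arr_unit S" g _ _ c])
    fix a b assume ab: "a \<or> b" "(a \<and> b) = c"
    show "k \<bullet> pin (arr_unit S) g a b = k' \<bullet> pin (arr_unit S) g a b"
    proof (cases a)
      case True
      thus ?thesis using ab * by auto
    next
      case False
      show ?thesis
        by (rule initial_eq[OF initial_tensor_left[of "ev S g b"]]) (use k * ab False in auto)
    qed
  qed (use k * in auto)
qed auto

lemma pin_unit_right_jointly_epic: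
  assumes g [simp]: "g \<in> Ar S"
  shows "jointly_epic S {pin g (arr_unit S) c True} (ev S (g \<box> arr_unit S) c)"
  unfolding jointly_epic_def
proof (intro conjI ballI impI)
  fix k k' assume k: "k \<in> Ar S" "k' \<in> Ar S" and *: "Dom S k = ev S (g \<box> arr_unit S) c \<and>
    Dom S k' = ev S (g \<box> arr_unit S) c \<and> Cod S k = Cod S k' \<and>
    (\<forall>i\<in>{pin g (arr_unit S) c True}. k \<bullet> i = k' \<bullet> i)"
  show "k = k'"
  proof (rule pin_ext[of g "arr_unit S" _ _ c])
    fix a b assume ab: "a \<or> b" "(a \<and> b) = c"
    show "k \<bullet> pin g (arr_unit S) a b = k' \<bullet> pin g (arr_unit S) a b"
    proof (cases b)
      case True
      thus ?thesis using ab * by auto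
    next
      case False
      show ?thesis
        by (rule initial_eq[OF initial_tensor_right[of "ev S g a"]]) (use k * ab False in auto)
    qed
  qed (use k * in auto)
qed auto

lemma pin_unit_left_ext:
  assumes "g \<in> Ar S" "k \<in> Ar S" "k' \<in> Ar S" "Dom S k = ev S (arr_unit S \<box> g) c"
    "Dom S k' = ev S (arr_unit S \<box> g) c" "Cod S k = Cod S k'"
    "k \<bullet> pin (arr_unit S) g True c = k' \<bullet> pin (arr_unit S) g True c"
  shows "k = k'"
  by (rule jointly_epicD[OF pin_unit_left_jointly_epic[OF assms(1)] assms(2-6)]) (use assms(7) in blast)

lemma pin_unit_right_ext:
  assumes "g \<in> Ar S" "k \<in> Ar S" "k' \<in> Ar S" "Dom S k = ev S (g \<box> arr_unit S) c"
    "Dom S k' = ev S (g \<box> arr_unit S) c" "Cod S k = Cod S k'"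
    "k \<bullet> pin g (arr_unit S) c True = k' \<bullet> pin g (arr_unit S) c True"
  shows "k = k'"
  by (rule jointly_epicD[OF pin_unit_right_jointly_epic[OF assms(1)] assms(2-6)]) (use assms(7) in blast)

lemma arr_unit_sel [simp]:
  "sq_src (arr_lunit S g) = arr_unit S \<box> g" "sq_trg (arr_lunit S g) = g"
  "sq_src (arr_runit S g) = g \<box> arr_unit S" "sq_trg (arr_runit S g) = g"
  by (simp_all add: arr_lunit_def arr_runit_def)

lemma LUnit_nat:
  "f \<in> Ar S \<Longrightarrow> y = Cod S f \<Longrightarrow> LUnit S y \<bullet> (Unit S \<lhd> f) = f \<bullet> LUnit S (Dom S f)"
  using lunit_natural[of f "Dom S f" "Cod S f"] by (auto simp: hom_iff)

lemma RUnit_nat: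
  "f \<in> Ar S \<Longrightarrow> y = Cod S f \<Longrightarrow> RUnit S y \<bullet> (f \<rhd> Unit S) = f \<bullet> RUnit S (Dom S f)"
  using runit_natural[of f "Dom S f" "Cod S f"] by (auto simp: hom_iff)

text \<open>The coprojection \<open>pp_in2\<close> from \<open>Unit S \<odot> Dom S g\<close> is invertible, since the opposite leg of the
  pushout is a map between initial objects; hence the map on domains exists, is unique, and is invertible along with \<open>LUnit\<close>.\<close>

lemma
  assumes g [simp]: "g \<in> Ar S"
  shows arr_lunit_square [simp]: "arr_lunit S g \<in> squares S"
    and arr_lunit_pin: "sqc (arr_lunit S g) c \<bullet> pin (arr_unit S) g True c = LUnit S (ev S g c)"
    and arr_lunit_iso: "is_iso (Arr S) (arr_lunit S g)"
proof -
  let ?I = "arr_unit S" and ?P = "\<lambda>k. k \<in> hom S (pp_dom S (arr_unit S) g) (Dom S g) \<and>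
    k \<bullet> pp_in2 S (arr_unit S) g = LUnit S (Dom S g)"
  obtain u where u: "u \<in> Ar S" "Dom S u = initial_ob S \<odot> Cod S g" "Cod S u = Dom S g"
    by (rule initial_arrow[OF initial_tensor_left[of "Cod S g"], of "Dom S g"]) auto
  have "u \<bullet> (Dom S ?I \<lhd> g) = LUnit S (Dom S g) \<bullet> (?I \<rhd> Dom S g)"
    by (rule initial_eq[OF initial_tensor_left[of "Dom S g"]]) (use u in auto)
  from pp_desc[OF _ _ _ _ _ _ _ this] u have "\<exists>k. ?P k" by (auto simp: hom_iff)
  moreover have ext: "k = k'" if "k \<in> Ar S" "k' \<in> Ar S" "Dom S k = pp_dom S ?I g"
    "Dom S k' = pp_dom S ?I g" "Cod S k = Cod S k'" "k \<bullet> pp_in2 S ?I g = k' \<bullet> pp_in2 S ?I g" for k k'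
    by (rule pin_unit_left_ext[of g _ _ False]) (use that in auto)
  ultimately have "\<exists>!k. ?P k" by (intro ex_ex1I) (auto simp: hom_iff)
  from theI'[OF this] have k: "sqc (arr_lunit S g) False \<in> Ar S"
    "Dom S (sqc (arr_lunit S g) False) = pp_dom S ?I g" "Cod S (sqc (arr_lunit S g) False) = Dom S g"
    "sqc (arr_lunit S g) False \<bullet> pp_in2 S ?I g = LUnit S (Dom S g)"
    by (auto simp: hom_iff arr_lunit_def)
  have t: "sqc (arr_lunit S g) True = LUnit S (Cod S g)" by (simp add: arr_lunit_def)
  let ?k = "sqc (arr_lunit S g) False"
  have "g \<bullet> ?k = LUnit S (Cod S g) \<bullet> (?I \<box> g)"
    by (rule ext) (use k in \<open>simp_all add: box_in LUnit_nat\<close>)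
  thus sq: "arr_lunit S g \<in> squares S"
    using k by (subst square_collapse, intro squareI) (simp_all add: t)
  show "sqc (arr_lunit S g) c \<bullet> pin (arr_unit S) g True c = LUnit S (ev S g c)"
    using k t by (cases c) simp_all
  obtain l where l: "l \<in> Ar S" "Dom S l = Dom S g" "Cod S l = Unit S \<odot> Dom S g"
    "l \<bullet> LUnit S (Dom S g) = Id S (Unit S \<odot> Dom S g)" "LUnit S (Dom S g) \<bullet> l = Id S (Dom S g)"
    by (rule is_isoE[OF lunit_iso[of "Dom S g"]]) auto
  have "is_iso S ?k"
  proof (rule is_isoI)
    show "(pp_in2 S ?I g \<bullet> l) \<bullet> ?k = Id S (Dom S ?k)"
      by (rule ext) (use k l in simp_all)
    show "?k \<bullet> (pp_in2 S ?I g \<bullet> l) = Id S (Cod S ?k)"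
      using k l comp_chain[OF k(4)] by simp
  qed (use k l in simp_all)
  hence "is_iso S (sqc (arr_lunit S g) a)" for a by (cases a) (simp_all add: t lunit_iso)
  thus "is_iso (Arr S) (arr_lunit S g)" by (rule Arr_is_iso[OF sq])
qed

lemma
  assumes g [simp]: "g \<in> Ar S"
  shows arr_runit_square [simp]: "arr_runit S g \<in> squares S"
    and arr_runit_pin: "sqc (arr_runit S g) c \<bullet> pin g (arr_unit S) c True = RUnit S (ev S g c)"
    and arr_runit_iso: "is_iso (Arr S) (arr_runit S g)"
proof -
  let ?I = "arr_unit S" and ?P = "\<lambda>k. k \<in> hom S (pp_dom S g (arr_unit S)) (Dom S g) \<and>
    k \<bullet> pp_in1 S g (arr_unit S) = RUnit S (Dom S g)"
  obtain u where u: "u \<in> Ar S" "Dom S u = Cod S g \<odot> initial_ob S" "Cod S u = Dom S g"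
    by (rule initial_arrow[OF initial_tensor_right[of "Cod S g"], of "Dom S g"]) auto
  have "RUnit S (Dom S g) \<bullet> (Dom S g \<lhd> ?I) = u \<bullet> (g \<rhd> Dom S ?I)"
    by (rule initial_eq[OF initial_tensor_right[of "Dom S g"]]) (use u in auto)
  from pp_desc[OF _ _ _ _ _ _ _ this] u have "\<exists>k. ?P k" by (auto simp: hom_iff)
  moreover have ext: "k = k'" if "k \<in> Ar S" "k' \<in> Ar S" "Dom S k = pp_dom S g ?I"
    "Dom S k' = pp_dom S g ?I" "Cod S k = Cod S k'" "k \<bullet> pp_in1 S g ?I = k' \<bullet> pp_in1 S g ?I" for k k'
    by (rule pin_unit_right_ext[of g _ _ False]) (use that in auto)
  ultimately have "\<exists>!k. ?P k" by (intro ex_ex1I) (auto simp: hom_iff)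
  from theI'[OF this] have k: "sqc (arr_runit S g) False \<in> Ar S"
    "Dom S (sqc (arr_runit S g) False) = pp_dom S g ?I" "Cod S (sqc (arr_runit S g) False) = Dom S g"
    "sqc (arr_runit S g) False \<bullet> pp_in1 S g ?I = RUnit S (Dom S g)"
    by (auto simp: hom_iff arr_runit_def)
  have t: "sqc (arr_runit S g) True = RUnit S (Cod S g)" by (simp add: arr_runit_def)
  let ?k = "sqc (arr_runit S g) False"
  have "g \<bullet> ?k = RUnit S (Cod S g) \<bullet> (g \<box> ?I)"
    by (rule ext) (use k in \<open>simp_all add: box_in RUnit_nat\<close>)
  thus sq: "arr_runit S g \<in> squares S"
    using k by (subst square_collapse, intro squareI) (simp_all add: t)
  show "sqc (arr_runit S g) c \<bullet> pin g (arr_unit S) c True = RUnit S (ev S g c)"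
    using k t by (cases c) simp_all
  obtain l where l: "l \<in> Ar S" "Dom S l = Dom S g" "Cod S l = Dom S g \<odot> Unit S"
    "l \<bullet> RUnit S (Dom S g) = Id S (Dom S g \<odot> Unit S)" "RUnit S (Dom S g) \<bullet> l = Id S (Dom S g)"
    by (rule is_isoE[OF runit_iso[of "Dom S g"]]) auto
  have "is_iso S ?k"
  proof (rule is_isoI)
    show "(pp_in1 S g ?I \<bullet> l) \<bullet> ?k = Id S (Dom S ?k)"
      by (rule ext) (use k l in simp_all)
    show "?k \<bullet> (pp_in1 S g ?I \<bullet> l) = Id S (Cod S ?k)"
      using k l comp_chain[OF k(4)] by simp
  qed (use k l in simp_all)
  hence "is_iso S (sqc (arr_runit S g) a)" for a by (cases a) (simp_all add: t runit_iso)
  thus "is_iso (Arr S) (arr_runit S g)" by (rule Arr_is_iso[OF sq])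
qed

subsection \<open>Symmetry\<close>

lemma arr_braid_sel [simp]:
  "sq_src (arr_braid S f g) = f \<box> g" "sq_trg (arr_braid S f g) = g \<box> f"
  by (simp_all add: arr_braid_def)

text \<open>The braiding interchanges the two legs of the pushout, hence the roles of the two coprojections.\<close>

lemma
  assumes f [simp]: "f \<in> Ar S" and g [simp]: "g \<in> Ar S"
  shows arr_braid_square [simp]: "arr_braid S f g \<in> squares S"
    and arr_braid_pin: "a \<or> b \<Longrightarrow> sqc (arr_braid S f g) (a \<and> b) \<bullet> pin f g a b =
      pin g f b a \<bullet> Braid S (ev S f a) (ev S g b)"
proof -
  let ?u = "pp_in2 S g f \<bullet> Braid S (Dom S f) (Cod S g)"
  let ?v = "pp_in1 S g f \<bullet> Braid S (Cod S f) (Dom S g)"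
  have e: "?u \<bullet> (Dom S f \<lhd> g) = ?v \<bullet> (f \<rhd> Dom S g)"
    using comp_chain_eq[OF pp_commutes[of g f "Dom S g" "Dom S f"], of "Braid S (Dom S f) (Dom S g)"]
    by (simp add: Braid_nat)
  let ?k = "pp_desc S f g ?u ?v"
  have k: "?k \<in> Ar S" "Dom S ?k = pp_dom S f g" "Cod S ?k = pp_dom S g f"
    "?k \<bullet> pp_in1 S f g = ?u" "?k \<bullet> pp_in2 S f g = ?v"
    using pp_desc[of f g ?u ?v, OF _ _ _ _ _ _ _ e] by simp_all
  have "(g \<box> f) \<bullet> ?k = Braid S (Cod S f) (Cod S g) \<bullet> (f \<box> g)"
    by (rule pp_ext[of f g])
      (use k comp_chain[OF box_in(1)[of g f]] comp_chain[OF box_in(2)[of g f]] in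
        \<open>simp_all add: box_in Braid_nat\<close>)
  thus "arr_braid S f g \<in> squares S"
    unfolding arr_braid_def using k by (intro squareI) simp_all
  show "sqc (arr_braid S f g) (a \<and> b) \<bullet> pin f g a b = pin g f b a \<bullet> Braid S (ev S f a) (ev S g b)"
    if "a \<or> b"
    using that k by (cases a; cases b) (simp_all add: arr_braid_def)
qed

subsection \<open>Coherence\<close>

text \<open>This and the next two lemmas reduce every coherence law to an equation in the base category, with the
  component indices as parameters.\<close>

lemma square_ext_pin:
  assumes "\<alpha> \<in> squares S" "\<beta> \<in> squares S" "f \<in> Ar S" "g \<in> Ar S"
    "sq_src \<alpha> = f \<box> g" "sq_src \<beta> = f \<box> g" "sq_trg \<alpha> = sq_trg \<beta>"
    "\<And>a b. a \<or> b \<Longrightarrow> sqc \<alpha> (a \<and> b) \<bullet> pin f g a b = sqc \<beta> (a \<and> b) \<bullet> pin f g a b"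
  shows "\<alpha> = \<beta>"
proof (rule square_eqI)
  show "sqc \<alpha> c = sqc \<beta> c" for c
    by (rule pin_ext[OF assms(3,4), of _ _ c]) (use assms squareD[OF assms(1)] squareD[OF assms(2)] in auto)
qed (use assms in simp_all)

lemma square_ext_pin3:
  assumes "\<alpha> \<in> squares S" "\<beta> \<in> squares S" "f \<in> Ar S" "g \<in> Ar S" "h \<in> Ar S"
    "sq_src \<alpha> = (f \<box> g) \<box> h" "sq_src \<beta> = (f \<box> g) \<box> h" "sq_trg \<alpha> = sq_trg \<beta>"
    "\<And>a b c. a \<or> b \<Longrightarrow> a \<or> c \<Longrightarrow> b \<or> c \<Longrightarrow>
      sqc \<alpha> (a \<and> b \<and> c) \<bullet> (pin (f \<box> g) h (a \<and> b) c \<bullet> (pin f g a b \<rhd> ev S h c)) =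
      sqc \<beta> (a \<and> b \<and> c) \<bullet> (pin (f \<box> g) h (a \<and> b) c \<bullet> (pin f g a b \<rhd> ev S h c))"
  shows "\<alpha> = \<beta>"
proof (rule square_eqI)
  show "sqc \<alpha> d = sqc \<beta> d" for d
  proof (rule pin_ext3[OF assms(3-5), of _ _ d])
    fix a b c assume "a \<or> b" "a \<or> c" "b \<or> c" "(a \<and> b \<and> c) = d"
    thus "sqc \<alpha> d \<bullet> (pin (f \<box> g) h (a \<and> b) c \<bullet> (pin f g a b \<rhd> ev S h c)) =
      sqc \<beta> d \<bullet> (pin (f \<box> g) h (a \<and> b) c \<bullet> (pin f g a b \<rhd> ev S h c))"
      using assms(9)[of a b c] by blast
  qed (use assms(6-8) squareD[OF assms(1)] squareD[OF assms(2)] in auto)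
qed (use assms in simp_all)

lemma square_ext_pin4:
  assumes "\<alpha> \<in> squares S" "\<beta> \<in> squares S" "f \<in> Ar S" "g \<in> Ar S" "h \<in> Ar S" "l \<in> Ar S"
    "sq_src \<alpha> = ((f \<box> g) \<box> h) \<box> l" "sq_src \<beta> = ((f \<box> g) \<box> h) \<box> l" "sq_trg \<alpha> = sq_trg \<beta>"
    "\<And>a b c d. a \<or> b \<Longrightarrow> a \<or> c \<Longrightarrow> b \<or> c \<Longrightarrow> a \<or> d \<Longrightarrow> b \<or> d \<Longrightarrow> c \<or> d \<Longrightarrow>
      sqc \<alpha> (a \<and> b \<and> c \<and> d) \<bullet> (pin ((f \<box> g) \<box> h) l (a \<and> b \<and> c) d \<bullet> ((pin (f \<box> g) h (a \<and> b) c \<bullet>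
        (pin f g a b \<rhd> ev S h c)) \<rhd> ev S l d)) =
      sqc \<beta> (a \<and> b \<and> c \<and> d) \<bullet> (pin ((f \<box> g) \<box> h) l (a \<and> b \<and> c) d \<bullet> ((pin (f \<box> g) h (a \<and> b) c \<bullet>
        (pin f g a b \<rhd> ev S h c)) \<rhd> ev S l d))"
  shows "\<alpha> = \<beta>"
proof (rule square_eqI)
  show "sqc \<alpha> z = sqc \<beta> z" for z
  proof (rule pin_ext4[OF assms(3-6), of _ _ z])
    fix a b c d assume "a \<or> b" "a \<or> c" "b \<or> c" "a \<or> d" "b \<or> d" "c \<or> d" "(a \<and> b \<and> c \<and> d) = z"
    thus "sqc \<alpha> z \<bullet> (pin ((f \<box> g) \<box> h) l (a \<and> b \<and> c) d \<bullet> ((pin (f \<box> g) h (a \<and> b) c \<bullet>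
        (pin f g a b \<rhd> ev S h c)) \<rhd> ev S l d)) =
      sqc \<beta> z \<bullet> (pin ((f \<box> g) \<box> h) l (a \<and> b \<and> c) d \<bullet> ((pin (f \<box> g) h (a \<and> b) c \<bullet>
        (pin f g a b \<rhd> ev S h c)) \<rhd> ev S l d))"
      using assms(10)[of a b c d] by blast
  qed (use assms(7-9) squareD[OF assms(1)] squareD[OF assms(2)] in auto)
qed (use assms in simp_all)


lemma Assoc_nat_chain:
  assumes [simp]: "f \<in> Ar S" "g \<in> Ar S" "h \<in> Ar S" and [simp]: "x = Cod S f" "y = Cod S g" "z = Cod S h"
  shows "k \<in> Ar S \<Longrightarrow> Cod S k = (Dom S f \<odot> Dom S g) \<odot> Dom S h \<Longrightarrow> Assoc S x y z \<bullet> (((f \<otimes> g) \<otimes> h) \<bullet> k) =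
      (f \<otimes> (g \<otimes> h)) \<bullet> (Assoc S (Dom S f) (Dom S g) (Dom S h) \<bullet> k)"
    and "r \<in> Ar S \<Longrightarrow> Cod S r = Dom S f \<odot> Dom S g \<Longrightarrow> Assoc S x y z \<bullet> (((f \<otimes> g) \<bullet> r) \<otimes> h) =
      (f \<otimes> (g \<otimes> h)) \<bullet> (Assoc S (Dom S f) (Dom S g) (Dom S h) \<bullet> (r \<rhd> Dom S h))"
proof -
  have A: "Assoc S x y z \<bullet> ((f \<otimes> g) \<otimes> h) =
      (f \<otimes> (g \<otimes> h)) \<bullet> Assoc S (Dom S f) (Dom S g) (Dom S h)"
    by (rule Assoc_nat) simp_all
  show k: "Assoc S x y z \<bullet> (((f \<otimes> g) \<otimes> h) \<bullet> k) =
      (f \<otimes> (g \<otimes> h)) \<bullet> (Assoc S (Dom S f) (Dom S g) (Dom S h) \<bullet> k)"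
    if "k \<in> Ar S" "Cod S k = (Dom S f \<odot> Dom S g) \<odot> Dom S h" for k
    by (rule comp_chain_eq[OF A]) (use that in simp_all)
  show "Assoc S x y z \<bullet> (((f \<otimes> g) \<bullet> r) \<otimes> h) =
      (f \<otimes> (g \<otimes> h)) \<bullet> (Assoc S (Dom S f) (Dom S g) (Dom S h) \<bullet> (r \<rhd> Dom S h))"
    if "r \<in> Ar S" "Cod S r = Dom S f \<odot> Dom S g"
    using k[of "r \<rhd> Dom S h"] that by (simp add: interchange)
qed

lemma Braid_nat_chain:
  assumes "f \<in> Ar S" "g \<in> Ar S" "x = Cod S f" "y = Cod S g" "k \<in> Ar S" "Cod S k = Dom S f \<odot> Dom S g"
  shows "Braid S x y \<bullet> ((f \<otimes> g) \<bullet> k) = (g \<otimes> f) \<bullet> (Braid S (Dom S f) (Dom S g) \<bullet> k)"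
  by (rule comp_chain_eq[OF Braid_nat]) (use assms in simp_all)

text \<open>Forms of the component rules that rewrite inside longer composites. The component index is a separate
  variable \<open>q\<close>, because an iterated conjunction may be bracketed or ordered differently when the rule is used.\<close>

lemma arr_tensor_pin_at:
  assumes "\<alpha> \<in> squares S" "\<beta> \<in> squares S" "a \<or> b" "q = (a \<and> b)" "f = sq_src \<alpha>" "g = sq_src \<beta>"
  shows "sqc (arr_tensor S \<alpha> \<beta>) q \<bullet> pin f g a b = pin (sq_trg \<alpha>) (sq_trg \<beta>) a b \<bullet> (sqc \<alpha> a \<otimes> sqc \<beta> b)"
    and "k \<in> Ar S \<Longrightarrow> Cod S k = ev S f a \<odot> ev S g b \<Longrightarrow>
      sqc (arr_tensor S \<alpha> \<beta>) q \<bullet> (pin f g a b \<bullet> k) =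
      pin (sq_trg \<alpha>) (sq_trg \<beta>) a b \<bullet> ((sqc \<alpha> a \<otimes> sqc \<beta> b) \<bullet> k)"
proof -
  note d [simp] = squareD[OF assms(1)] squareD[OF assms(2)]
  show e: "sqc (arr_tensor S \<alpha> \<beta>) q \<bullet> pin f g a b = pin (sq_trg \<alpha>) (sq_trg \<beta>) a b \<bullet> (sqc \<alpha> a \<otimes> sqc \<beta> b)"
    unfolding assms(4-6) by (rule arr_tensor_pin[OF assms(1-3)])
  show "sqc (arr_tensor S \<alpha> \<beta>) q \<bullet> (pin f g a b \<bullet> k) =
      pin (sq_trg \<alpha>) (sq_trg \<beta>) a b \<bullet> ((sqc \<alpha> a \<otimes> sqc \<beta> b) \<bullet> k)"
    if "k \<in> Ar S" "Cod S k = ev S f a \<odot> ev S g b"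
    by (rule comp_chain_eq[OF e])
      (use that assms squareD[OF arr_tensor_square[OF assms(1,2)]] in simp_all)
qed

lemma arr_braid_pin_at:
  assumes [simp]: "f \<in> Ar S" "g \<in> Ar S" and "a \<or> b" "q = (a \<and> b)"
  shows "sqc (arr_braid S f g) q \<bullet> pin f g a b = pin g f b a \<bullet> Braid S (ev S f a) (ev S g b)"
    and "k \<in> Ar S \<Longrightarrow> Cod S k = ev S f a \<odot> ev S g b \<Longrightarrow>
      sqc (arr_braid S f g) q \<bullet> (pin f g a b \<bullet> k) = pin g f b a \<bullet> (Braid S (ev S f a) (ev S g b) \<bullet> k)"
proof -
  show e: "sqc (arr_braid S f g) q \<bullet> pin f g a b = pin g f b a \<bullet> Braid S (ev S f a) (ev S g b)"
    unfolding assms(4) by (rule arr_braid_pin[OF assms(1-3)])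
  show "sqc (arr_braid S f g) q \<bullet> (pin f g a b \<bullet> k) = pin g f b a \<bullet> (Braid S (ev S f a) (ev S g b) \<bullet> k)"
    if "k \<in> Ar S" "Cod S k = ev S f a \<odot> ev S g b"
    by (rule comp_chain_eq[OF e])
      (use that assms squareD[OF arr_braid_square[OF assms(1,2)]] in \<open>auto simp: conj_commute\<close>)
qed

text \<open>Tensors are kept merged by interchange, so the coprojection to be rewritten appears fused with further
  maps \<open>x\<close> and \<open>y\<close>.\<close>

lemma arr_assoc_pin_at:
  assumes [simp]: "f \<in> Ar S" "g \<in> Ar S" "h \<in> Ar S"
    and abc: "a \<or> b" "a \<or> c" "b \<or> c" "q = (a \<and> b \<and> c)" "r = (a \<and> b)"
    and x [simp]: "x \<in> Ar S" "Cod S x = ev S f a \<odot> ev S g b" "y \<in> Ar S" "Cod S y = ev S h c"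
  shows "sqc (arr_assoc S f g h) q \<bullet> (pin (f \<box> g) h r c \<bullet> ((pin f g a b \<bullet> x) \<otimes> y)) =
      pin f (g \<box> h) a (b \<and> c) \<bullet> ((ev S f a \<lhd> pin g h b c) \<bullet>
        (Assoc S (ev S f a) (ev S g b) (ev S h c) \<bullet> (x \<otimes> y)))"
    and "k \<in> Ar S \<Longrightarrow> Cod S k = Dom S x \<odot> Dom S y \<Longrightarrow>
      sqc (arr_assoc S f g h) q \<bullet> (pin (f \<box> g) h r c \<bullet> (((pin f g a b \<bullet> x) \<otimes> y) \<bullet> k)) =
      pin f (g \<box> h) a (b \<and> c) \<bullet> ((ev S f a \<lhd> pin g h b c) \<bullet>
        (Assoc S (ev S f a) (ev S g b) (ev S h c) \<bullet> ((x \<otimes> y) \<bullet> k)))"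
proof -
  note d = squareD[OF arr_assoc_square[OF assms(1-3)]]
  have k: "sqc (arr_assoc S f g h) q \<bullet> (pin (f \<box> g) h r c \<bullet> (((pin f g a b \<bullet> x) \<otimes> y) \<bullet> k)) =
      pin f (g \<box> h) a (b \<and> c) \<bullet> ((ev S f a \<lhd> pin g h b c) \<bullet>
        (Assoc S (ev S f a) (ev S g b) (ev S h c) \<bullet> ((x \<otimes> y) \<bullet> k)))"
    if [simp]: "k \<in> Ar S" "Cod S k = Dom S x \<odot> Dom S y" for k
  proof -
    have "sqc (arr_assoc S f g h) q \<bullet> (pin (f \<box> g) h r c \<bullet> (((pin f g a b \<bullet> x) \<otimes> y) \<bullet> k)) =
      (sqc (arr_assoc S f g h) (a \<and> b \<and> c) \<bullet>
      (pin (f \<box> g) h (a \<and> b) c \<bullet> (pin f g a b \<rhd> ev S h c))) \<bullet> ((x \<otimes> y) \<bullet> k)"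
      using abc d by (simp add: interchange_chain)
    also note arr_assoc_pin[OF assms(1-6)]
    finally show ?thesis by simp
  qed
  show "sqc (arr_assoc S f g h) q \<bullet> (pin (f \<box> g) h r c \<bullet> (((pin f g a b \<bullet> x) \<otimes> y) \<bullet> k)) =
      pin f (g \<box> h) a (b \<and> c) \<bullet> ((ev S f a \<lhd> pin g h b c) \<bullet>
        (Assoc S (ev S f a) (ev S g b) (ev S h c) \<bullet> ((x \<otimes> y) \<bullet> k)))"
    if "k \<in> Ar S" "Cod S k = Dom S x \<odot> Dom S y" using k that by blast
  show "sqc (arr_assoc S f g h) q \<bullet> (pin (f \<box> g) h r c \<bullet> ((pin f g a b \<bullet> x) \<otimes> y)) =
      pin f (g \<box> h) a (b \<and> c) \<bullet> ((ev S f a \<lhd> pin g h b c) \<bullet>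
        (Assoc S (ev S f a) (ev S g b) (ev S h c) \<bullet> (x \<otimes> y)))"
    using k[of "Id S (Dom S x \<odot> Dom S y)"] abc by simp
qed

text \<open>The case of an identity \<open>x\<close>, where the associator can be moved past \<open>y\<close>.\<close>

lemma arr_assoc_pin_whisker:
  assumes [simp]: "f \<in> Ar S" "g \<in> Ar S" "h \<in> Ar S"
    and abc: "a \<or> b" "a \<or> c" "b \<or> c" "q = (a \<and> b \<and> c)" "r = (a \<and> b)"
    and y [simp]: "y \<in> Ar S" "Cod S y = ev S h c"
  shows "sqc (arr_assoc S f g h) q \<bullet> (pin (f \<box> g) h r c \<bullet> (pin f g a b \<otimes> y)) =
      pin f (g \<box> h) a (b \<and> c) \<bullet> ((ev S f a \<lhd> (pin g h b c \<bullet> (ev S g b \<lhd> y))) \<bullet>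
        Assoc S (ev S f a) (ev S g b) (Dom S y))"
    and "k \<in> Ar S \<Longrightarrow> Cod S k = (ev S f a \<odot> ev S g b) \<odot> Dom S y \<Longrightarrow>
      sqc (arr_assoc S f g h) q \<bullet> (pin (f \<box> g) h r c \<bullet> ((pin f g a b \<otimes> y) \<bullet> k)) =
      pin f (g \<box> h) a (b \<and> c) \<bullet> ((ev S f a \<lhd> (pin g h b c \<bullet> (ev S g b \<lhd> y))) \<bullet>
        (Assoc S (ev S f a) (ev S g b) (Dom S y) \<bullet> k))"
proof -
  have A: "Assoc S (ev S f a) (ev S g b) (ev S h c) \<bullet> ((ev S f a \<odot> ev S g b) \<lhd> y) =
    (ev S f a \<lhd> (ev S g b \<lhd> y)) \<bullet> Assoc S (ev S f a) (ev S g b) (Dom S y)"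
    by (rule Assoc_nat_Id_left) simp_all
  note * = arr_assoc_pin_at[OF assms(1-8), of "Id S (ev S f a \<odot> ev S g b)" y]
  show "sqc (arr_assoc S f g h) q \<bullet> (pin (f \<box> g) h r c \<bullet> (pin f g a b \<otimes> y)) =
      pin f (g \<box> h) a (b \<and> c) \<bullet> ((ev S f a \<lhd> (pin g h b c \<bullet> (ev S g b \<lhd> y))) \<bullet>
        Assoc S (ev S f a) (ev S g b) (Dom S y))"
    using *(1) by (simp add: A interchange_chain)
  show "sqc (arr_assoc S f g h) q \<bullet> (pin (f \<box> g) h r c \<bullet> ((pin f g a b \<otimes> y) \<bullet> k)) =
      pin f (g \<box> h) a (b \<and> c) \<bullet> ((ev S f a \<lhd> (pin g h b c \<bullet> (ev S g b \<lhd> y))) \<bullet>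
        (Assoc S (ev S f a) (ev S g b) (Dom S y) \<bullet> k))"
    if "k \<in> Ar S" "Cod S k = (ev S f a \<odot> ev S g b) \<odot> Dom S y"
    using *(2)[of k] that by (simp add: comp_chain_eq[OF A] interchange_chain)
qed

text \<open>On the component \<open>(a, b, c, d)\<close> both sides reduce to iterated coprojections followed by the two sides of
  the pentagon for the objects \<open>ev S f a\<close>, \<open>ev S g b\<close>, \<open>ev S h c\<close> and \<open>ev S l d\<close>.\<close>

lemma Arr_pentagon:
  assumes [simp]: "f \<in> Ar S" "g \<in> Ar S" "h \<in> Ar S" "l \<in> Ar S"
  shows "arr_assoc S f g (h \<box> l) \<cdot> arr_assoc S (f \<box> g) h l =
    arr_tensor S (Id (Arr S) f) (arr_assoc S g h l) \<cdot> (arr_assoc S f (g \<box> h) l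
      \<cdot> arr_tensor S (arr_assoc S f g h) (Id (Arr S) l))"
proof -
  interpret A: category "Arr S" by (rule Arr_category)
  have Id_sq [simp]: "Id (Arr S) x \<in> squares S" if "x \<in> Ar S" for x using A.id_arrow(1)[of x] that by simp
  show ?thesis
  proof (rule square_ext_pin4[of _ _ f g h l])
    fix a b c d assume abcd: "a \<or> b" "a \<or> c" "b \<or> c" "a \<or> d" "b \<or> d" "c \<or> d"
    hence D: "a \<and> b \<or> c" "a \<and> b \<or> d" "a \<and> b \<or> c \<and> d" "a \<or> b \<and> c" "a \<or> c \<and> d" "b \<or> c \<and> d" "b \<and> c \<or> d"
      "a \<and> b \<and> c \<or> d" "a \<or> b \<and> c \<and> d" by auto
    show "sqc (arr_assoc S f g (h \<box> l) \<cdot> arr_assoc S (f \<box> g) h l) (a \<and> b \<and> c \<and> d) \<bullet>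
       (pin ((f \<box> g) \<box> h) l (a \<and> b \<and> c) d \<bullet> ((pin (f \<box> g) h (a \<and> b) c \<bullet>
        (pin f g a b \<rhd> ev S h c)) \<rhd> ev S l d)) =
      sqc (arr_tensor S (Id (Arr S) f) (arr_assoc S g h l) \<cdot> (arr_assoc S f (g \<box> h) l
      \<cdot> arr_tensor S (arr_assoc S f g h) (Id (Arr S) l))) (a \<and> b \<and> c \<and> d) \<bullet>
       (pin ((f \<box> g) \<box> h) l (a \<and> b \<and> c) d \<bullet> ((pin (f \<box> g) h (a \<and> b) c \<bullet>
        (pin f g a b \<rhd> ev S h c)) \<rhd> ev S l d))"
      using abcd D
      by (simp add: arr_assoc_pin_at arr_assoc_pin_whisker arr_tensor_pin_at interchange interchange_chain squareD
        Assoc_nat Assoc_nat_chain pentagon)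
  qed (simp_all add: Arr_comp_square)
qed


text \<open>By \<open>pin_unit_right_jointly_epic\<close> the component of the unit may be taken at its codomain, where it is \<open>Unit S\<close>.\<close>

lemma Arr_triangle:
  assumes [simp]: "f \<in> Ar S" "g \<in> Ar S"
  shows "arr_tensor S (Id (Arr S) f) (arr_lunit S g) \<cdot> arr_assoc S f (arr_unit S) g =
    arr_tensor S (arr_runit S f) (Id (Arr S) g)"
proof -
  interpret A: category "Arr S" by (rule Arr_category)
  have Id_sq [simp]: "Id (Arr S) x \<in> squares S" if "x \<in> Ar S" for x using A.id_arrow(1)[of x] that by simp
  let ?I = "arr_unit S"
  show ?thesis (is "?L = ?R")
  proof (rule square_ext_pin[of _ _ "f \<box> ?I" g])
    fix q c assume q: "q \<or> c"
    have L: "?L \<in> squares S" by (simp add: Arr_comp_square)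
    show "sqc ?L (q \<and> c) \<bullet> pin (f \<box> ?I) g q c = sqc ?R (q \<and> c) \<bullet> pin (f \<box> ?I) g q c"
    proof (rule jointly_epicD[OF tensor_right_jointly_epic[OF pin_unit_right_jointly_epic]])
      show "f \<in> Ar S" "ev S g c \<in> Ob S" by simp_all
      fix i assume "i \<in> (\<lambda>f. f \<rhd> ev S g c) ` {pin f ?I q True}"
      hence i: "i = pin f ?I q True \<rhd> ev S g c" by simp
      show "(sqc ?L (q \<and> c) \<bullet> pin (f \<box> ?I) g q c) \<bullet> i = (sqc ?R (q \<and> c) \<bullet> pin (f \<box> ?I) g q c) \<bullet> i"
        unfolding i using q
        by (simp add: squareD arr_assoc_pin_whisker arr_tensor_pin_at interchange interchange_chain
          arr_lunit_pin arr_runit_pin triangle)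
    qed (use squareD[OF L] in \<open>simp_all add: squareD\<close>)
  qed (simp_all add: Arr_comp_square)
qed

lemma Arr_hexagon:
  assumes [simp]: "f \<in> Ar S" "g \<in> Ar S" "h \<in> Ar S"
  shows "arr_assoc S g h f \<cdot> (arr_braid S f (g \<box> h) \<cdot> arr_assoc S f g h) =
    arr_tensor S (Id (Arr S) g) (arr_braid S f h) \<cdot> (arr_assoc S g f h
      \<cdot> arr_tensor S (arr_braid S f g) (Id (Arr S) h))"
proof -
  interpret A: category "Arr S" by (rule Arr_category)
  have Id_sq [simp]: "Id (Arr S) x \<in> squares S" if "x \<in> Ar S" for x using A.id_arrow(1)[of x] that by simp
  show ?thesis (is "?L = ?R")
  proof (rule square_ext_pin3[of _ _ f g h])
    fix a b c assume abc: "a \<or> b" "a \<or> c" "b \<or> c"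
    hence D: "b \<or> a" "c \<or> a" "c \<or> b" "a \<and> b \<or> c" "a \<or> b \<and> c" "b \<and> c \<or> a" "b \<or> c \<and> a" "b \<or> a \<and> c" by auto
    show "sqc ?L (a \<and> b \<and> c) \<bullet> (pin (f \<box> g) h (a \<and> b) c \<bullet> (pin f g a b \<rhd> ev S h c)) =
      sqc ?R (a \<and> b \<and> c) \<bullet> (pin (f \<box> g) h (a \<and> b) c \<bullet> (pin f g a b \<rhd> ev S h c))"
      using abc D
      by (simp add: arr_assoc_pin_at arr_assoc_pin_whisker arr_tensor_pin_at arr_braid_pin_at interchange
        interchange_chain squareD Assoc_nat Assoc_nat_chain Braid_nat Braid_nat_chain hexagon conj_ac)
  qed (simp_all add: Arr_comp_square)
qed


lemma Arr_symmetric_monoidal: "symmetric_monoidal_category (Arr S)"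
proof -
  interpret A: category "Arr S" by (rule Arr_category)
  have Id_sq [simp]: "Id (Arr S) x \<in> squares S" if "x \<in> Ar S" for x using A.id_arrow(1)[of x] that by simp
  show ?thesis
  proof
    fix f g h l x y z x' y' z' x'' y'' and \<alpha> \<beta> \<gamma> \<alpha>' \<beta>'
    show "x \<in> Ob (Arr S) \<Longrightarrow> y \<in> Ob (Arr S) \<Longrightarrow> TensOb (Arr S) x y \<in> Ob (Arr S)" for x y by simp
    show "\<alpha> \<in> hom (Arr S) x x' \<Longrightarrow> \<beta> \<in> hom (Arr S) y y' \<Longrightarrow>
      TensAr (Arr S) \<alpha> \<beta> \<in> hom (Arr S) (TensOb (Arr S) x y) (TensOb (Arr S) x' y')"
      by (auto simp: hom_iff)
    show "TensAr (Arr S) (Id (Arr S) x) (Id (Arr S) y) = Id (Arr S) (TensOb (Arr S) x y)"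
      if "x \<in> Ob (Arr S)" "y \<in> Ob (Arr S)" for x y
      by (rule square_ext_pin[of _ _ x y]) (use that in \<open>simp_all add: arr_tensor_pin_at\<close>)
    show "TensAr (Arr S) (\<alpha>' \<cdot> \<alpha>) (\<beta>' \<cdot> \<beta>) =
      TensAr (Arr S) \<alpha>' \<beta>' \<cdot> TensAr (Arr S) \<alpha> \<beta>"
      if "\<alpha> \<in> hom (Arr S) x x'" "\<alpha>' \<in> hom (Arr S) x' x''" "\<beta> \<in> hom (Arr S) y y'" "\<beta>' \<in> hom (Arr S) y' y''"
      for \<alpha> \<beta> \<alpha>' \<beta>' x x' x'' y y' y''
    proof -
      have "\<alpha> \<in> squares S" "\<beta> \<in> squares S" "\<alpha>' \<in> squares S" "\<beta>' \<in> squares S"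
        "sq_src \<alpha> = x" "sq_trg \<alpha> = x'" "sq_src \<alpha>' = x'" "sq_trg \<alpha>' = x''"
        "sq_src \<beta> = y" "sq_trg \<beta> = y'" "sq_src \<beta>' = y'" "sq_trg \<beta>' = y''"
        using that by (auto simp: hom_iff)
      moreover from this have "x \<in> Ar S" "y \<in> Ar S" using squareD by blast+
      ultimately show ?thesis unfolding Arr_sel
        by (intro square_ext_pin[of _ _ x y])
          (simp_all add: Arr_comp_square squareD arr_tensor_pin_at interchange)
    qed
    show "Unit (Arr S) \<in> Ob (Arr S)" by simp
    show "Assoc (Arr S) x y z \<in> hom (Arr S) (TensOb (Arr S) (TensOb (Arr S) x y) z)
        (TensOb (Arr S) x (TensOb (Arr S) y z))"
      if "x \<in> Ob (Arr S)" "y \<in> Ob (Arr S)" "z \<in> Ob (Arr S)" for x y z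
      using that by (simp add: hom_iff)
    show "is_iso (Arr S) (Assoc (Arr S) x y z)"
      if "x \<in> Ob (Arr S)" "y \<in> Ob (Arr S)" "z \<in> Ob (Arr S)" for x y z
      using that by (simp add: arr_assoc_iso)
    show "Assoc (Arr S) x' y' z' \<cdot> TensAr (Arr S) (TensAr (Arr S) \<alpha> \<beta>) \<gamma> =
        TensAr (Arr S) \<alpha> (TensAr (Arr S) \<beta> \<gamma>) \<cdot> Assoc (Arr S) x y z"
      if "\<alpha> \<in> hom (Arr S) x x'" "\<beta> \<in> hom (Arr S) y y'" "\<gamma> \<in> hom (Arr S) z z'"
      for \<alpha> \<beta> \<gamma> x y z x' y' z'
    proof -
      have s: "\<alpha> \<in> squares S" "\<beta> \<in> squares S" "\<gamma> \<in> squares S"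
        "sq_src \<alpha> = x" "sq_trg \<alpha> = x'" "sq_src \<beta> = y" "sq_trg \<beta> = y'" "sq_src \<gamma> = z" "sq_trg \<gamma> = z'"
        using that by (auto simp: hom_iff)
      have a [simp]: "x \<in> Ar S" "y \<in> Ar S" "z \<in> Ar S" "x' \<in> Ar S" "y' \<in> Ar S" "z' \<in> Ar S"
        using s squareD by blast+
      show ?thesis unfolding Arr_sel
      proof (rule square_ext_pin3[of _ _ x y z])
        fix a b c assume abc: "a \<or> b" "a \<or> c" "b \<or> c"
        hence D: "a \<and> b \<or> c" "a \<or> b \<and> c" by auto
        show "sqc (arr_assoc S x' y' z' \<cdot> arr_tensor S (arr_tensor S \<alpha> \<beta>) \<gamma>) (a \<and> b \<and> c) \<bullet>
          (pin (x \<box> y) z (a \<and> b) c \<bullet> (pin x y a b \<rhd> ev S z c)) =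
          sqc (arr_tensor S \<alpha> (arr_tensor S \<beta> \<gamma>) \<cdot> arr_assoc S x y z) (a \<and> b \<and> c) \<bullet>
          (pin (x \<box> y) z (a \<and> b) c \<bullet> (pin x y a b \<rhd> ev S z c))"
          using abc D s by (simp add: squareD arr_tensor_pin_at arr_assoc_pin_at arr_assoc_pin_whisker
              interchange interchange_chain Assoc_nat)
      qed (use s in \<open>simp_all add: Arr_comp_square\<close>)
    qed
    show "LUnit (Arr S) x \<in> hom (Arr S) (TensOb (Arr S) (Unit (Arr S)) x) x"
      "is_iso (Arr S) (LUnit (Arr S) x)"
      "RUnit (Arr S) x \<in> hom (Arr S) (TensOb (Arr S) x (Unit (Arr S))) x"
      "is_iso (Arr S) (RUnit (Arr S) x)" if "x \<in> Ob (Arr S)" for x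
      using that by (simp_all add: hom_iff arr_lunit_iso arr_runit_iso)
    show "LUnit (Arr S) y \<cdot> TensAr (Arr S) (Id (Arr S) (Unit (Arr S))) \<alpha> = \<alpha> \<cdot> LUnit (Arr S) x"
      if "\<alpha> \<in> hom (Arr S) x y" for \<alpha> x y
    proof -
      have s: "\<alpha> \<in> squares S" "sq_src \<alpha> = x" "sq_trg \<alpha> = y" using that by (auto simp: hom_iff)
      have a [simp]: "x \<in> Ar S" "y \<in> Ar S" using s squareD by blast+
      have L: "arr_lunit S y \<cdot> arr_tensor S (Id (Arr S) (arr_unit S)) \<alpha> \<in> squares S"
        "\<alpha> \<cdot> arr_lunit S x \<in> squares S" using s by (simp_all add: Arr_comp_square)
      show ?thesis unfolding Arr_sel
      proof (rule square_eqI)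
        fix c
        show "sqc (arr_lunit S y \<cdot> arr_tensor S (Id (Arr S) (arr_unit S)) \<alpha>) c =
          sqc (\<alpha> \<cdot> arr_lunit S x) c"
          by (rule pin_unit_left_ext[of x _ _ c])
            (use s squareD[OF L(1)] squareD[OF L(2)] in
              \<open>simp_all add: squareD arr_tensor_pin_at arr_lunit_pin LUnit_nat comp_chain[OF arr_lunit_pin]\<close>)
      qed (use s in simp_all)
    qed
    show "RUnit (Arr S) y \<cdot> TensAr (Arr S) \<alpha> (Id (Arr S) (Unit (Arr S))) = \<alpha> \<cdot> RUnit (Arr S) x"
      if "\<alpha> \<in> hom (Arr S) x y" for \<alpha> x y
    proof -
      have s: "\<alpha> \<in> squares S" "sq_src \<alpha> = x" "sq_trg \<alpha> = y" using that by (auto simp: hom_iff)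
      have a [simp]: "x \<in> Ar S" "y \<in> Ar S" using s squareD by blast+
      have L: "arr_runit S y \<cdot> arr_tensor S \<alpha> (Id (Arr S) (arr_unit S)) \<in> squares S"
        "\<alpha> \<cdot> arr_runit S x \<in> squares S" using s by (simp_all add: Arr_comp_square)
      show ?thesis unfolding Arr_sel
      proof (rule square_eqI)
        fix c
        show "sqc (arr_runit S y \<cdot> arr_tensor S \<alpha> (Id (Arr S) (arr_unit S))) c =
          sqc (\<alpha> \<cdot> arr_runit S x) c"
          by (rule pin_unit_right_ext[of x _ _ c])
            (use s squareD[OF L(1)] squareD[OF L(2)] in
              \<open>simp_all add: squareD arr_tensor_pin_at arr_runit_pin RUnit_nat comp_chain[OF arr_runit_pin]\<close>)
      qed (use s in simp_all)
    qed
    show "Braid (Arr S) x y \<in> hom (Arr S) (TensOb (Arr S) x y) (TensOb (Arr S) y x)"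
      if "x \<in> Ob (Arr S)" "y \<in> Ob (Arr S)" for x y using that by (simp add: hom_iff)
    show "Braid (Arr S) x' y' \<cdot> TensAr (Arr S) \<alpha> \<beta> = TensAr (Arr S) \<beta> \<alpha> \<cdot> Braid (Arr S) x y"
      if "\<alpha> \<in> hom (Arr S) x x'" "\<beta> \<in> hom (Arr S) y y'" for \<alpha> \<beta> x y x' y'
    proof -
      have s: "\<alpha> \<in> squares S" "\<beta> \<in> squares S" "sq_src \<alpha> = x" "sq_trg \<alpha> = x'" "sq_src \<beta> = y" "sq_trg \<beta> = y'"
        using that by (auto simp: hom_iff)
      have a [simp]: "x \<in> Ar S" "y \<in> Ar S" "x' \<in> Ar S" "y' \<in> Ar S" using s squareD by blast+
      show ?thesis unfolding Arr_sel
        by (rule square_ext_pin[of _ _ x y])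
          (use s in \<open>simp_all add: Arr_comp_square squareD arr_tensor_pin_at arr_braid_pin_at Braid_nat disj_commute conj_commute\<close>)
    qed
    show "Braid (Arr S) y x \<cdot> Braid (Arr S) x y = Id (Arr S) (TensOb (Arr S) x y)"
      if "x \<in> Ob (Arr S)" "y \<in> Ob (Arr S)" for x y
      by (rule square_ext_pin[of _ _ x y])
        (use that in \<open>simp_all add: Arr_comp_square squareD arr_braid_pin_at Braid_Braid disj_commute conj_commute\<close>)
    show "Assoc (Arr S) w x (TensOb (Arr S) y z) \<cdot> Assoc (Arr S) (TensOb (Arr S) w x) y z =
        TensAr (Arr S) (Id (Arr S) w) (Assoc (Arr S) x y z) \<cdot> (Assoc (Arr S) w (TensOb (Arr S) x y) z
          \<cdot> TensAr (Arr S) (Assoc (Arr S) w x y) (Id (Arr S) z))"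
      if "w \<in> Ob (Arr S)" "x \<in> Ob (Arr S)" "y \<in> Ob (Arr S)" "z \<in> Ob (Arr S)" for w x y z
      using that Arr_pentagon by simp
    show "TensAr (Arr S) (Id (Arr S) x) (LUnit (Arr S) y) \<cdot> Assoc (Arr S) x (Unit (Arr S)) y =
        TensAr (Arr S) (RUnit (Arr S) x) (Id (Arr S) y)"
      if "x \<in> Ob (Arr S)" "y \<in> Ob (Arr S)" for x y
      using that Arr_triangle by simp
    show "Assoc (Arr S) y z x \<cdot> (Braid (Arr S) x (TensOb (Arr S) y z) \<cdot> Assoc (Arr S) x y z) =
        TensAr (Arr S) (Id (Arr S) y) (Braid (Arr S) x z) \<cdot> (Assoc (Arr S) y x z
          \<cdot> TensAr (Arr S) (Braid (Arr S) x y) (Id (Arr S) z))"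
      if "x \<in> Ob (Arr S)" "y \<in> Ob (Arr S)" "z \<in> Ob (Arr S)" for x y z
      using that Arr_hexagon by simp
  qed
qed

subsection \<open>Closedness\<close>

text \<open>Internal homs by their universal property: \<open>H\<close> is \<open>Hom(w, z)\<close>, \<open>e\<close> the evaluation, \<open>tr\<close> currying.\<close>

lemma exponential:
  assumes "w \<in> Ob S" "z \<in> Ob S"
  obtains H e tr where "H \<in> Ob S" "e \<in> Ar S" "Dom S e = H \<odot> w" "Cod S e = z"
    "\<And>x k. x \<in> Ob S \<Longrightarrow> k \<in> Ar S \<Longrightarrow> Dom S k = x \<odot> w \<Longrightarrow> Cod S k = z \<Longrightarrow>
      tr x k \<in> Ar S \<and> Dom S (tr x k) = x \<and> Cod S (tr x k) = H \<and> e \<bullet> (tr x k \<rhd> w) = k"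
    "\<And>k k'. k \<in> Ar S \<Longrightarrow> k' \<in> Ar S \<Longrightarrow> Dom S k = Dom S k' \<Longrightarrow> Cod S k = H \<Longrightarrow> Cod S k' = H \<Longrightarrow>
      e \<bullet> (k \<rhd> w) = e \<bullet> (k' \<rhd> w) \<Longrightarrow> k = k'"
  by (rule left_adjoint.transposition[OF tensor_right_adjoint[OF assms(1)] assms(2)]) (rule that)

lemma pullback_desc:
  assumes "is_pullback S f g p q" "u \<in> Ar S" "v \<in> Ar S" "Cod S u = Dom S f" "Cod S v = Dom S g"
    "Dom S u = Dom S v" "f \<bullet> u = g \<bullet> v"
  obtains h where "h \<in> Ar S" "Dom S h = Dom S v" "Cod S h = Dom S p" "p \<bullet> h = u" "q \<bullet> h = v"
proof -
  have "u \<in> hom S (Dom S v) (Dom S f)" "v \<in> hom S (Dom S v) (Dom S g)" using assms by (auto simp: hom_iff)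
  hence "\<exists>!h. h \<in> hom S (Dom S v) (Dom S p) \<and> p \<bullet> h = u \<and> q \<bullet> h = v"
    using assms(1,7) unfolding is_pullback_def by blast
  thus thesis using that by (auto simp: hom_iff)
qed

lemma pullback_ext:
  assumes "is_pullback S f g p q" "k \<in> Ar S" "k' \<in> Ar S" "Cod S k = Dom S p" "Cod S k' = Dom S p"
    "Dom S k = Dom S k'" "p \<bullet> k = p \<bullet> k'" "q \<bullet> k = q \<bullet> k'"
  shows "k = k'"
proof -
  have a: "f \<in> Ar S" "g \<in> Ar S" "p \<in> Ar S" "q \<in> Ar S" "Cod S p = Dom S f" "Cod S q = Dom S g"
    "Dom S p = Dom S q" "f \<bullet> p = g \<bullet> q" using assms(1) by (auto simp: is_pullback_def)
  have "p \<bullet> k \<in> hom S (Dom S k) (Dom S f)" "q \<bullet> k \<in> hom S (Dom S k) (Dom S g)"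
    using assms(2-6) a by (auto simp: hom_iff)
  moreover have "f \<bullet> (p \<bullet> k) = g \<bullet> (q \<bullet> k)"
    by (rule comp_chain_eq[OF a(8), of k, THEN trans]) (use assms(2-6) a in auto)
  ultimately have "\<exists>!h. h \<in> hom S (Dom S k) (Dom S p) \<and> p \<bullet> h = p \<bullet> k \<and> q \<bullet> h = q \<bullet> k"
    using assms(1) unfolding is_pullback_def by blast
  thus ?thesis using assms(2-8) by (auto simp: hom_iff)
qed

text \<open>The internal hom from \<open>g\<close> to \<open>t\<close> is the arrow
  \<open>Hom(Y\<^sub>1, T\<^sub>0) \<rightarrow> Hom(Y\<^sub>1, T\<^sub>1) \<times>\<^bsub>Hom(Y\<^sub>0, T\<^sub>1)\<^esub> Hom(Y\<^sub>0, T\<^sub>0)\<close>, called \<open>r\<close> below, where \<open>g : Y\<^sub>0 \<rightarrow> Y\<^sub>1\<close> and \<open>t : T\<^sub>0 \<rightarrow> T\<^sub>1\<close>. A square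
  \<open>f \<box> g \<rightarrow> t\<close> consists of maps out of \<open>X\<^sub>0 \<odot> Y\<^sub>1\<close>, \<open>X\<^sub>1 \<odot> Y\<^sub>0\<close> and \<open>X\<^sub>1 \<odot> Y\<^sub>1\<close>. The first transposes to the
  domain of \<open>r\<close>, the other two to the factors of the pullback, and the compatibilities of the three maps say
  that this gives a square \<open>f \<rightarrow> r\<close>.\<close>

lemma Arr_closed:
  assumes g: "g \<in> Ar S"
  shows "left_adjoint (Arr S) (Arr S) (\<lambda>f. f \<box> g) (\<lambda>\<alpha>. arr_tensor S \<alpha> (Id (Arr S) g))"
proof -
  interpret A: symmetric_monoidal_category "Arr S" by (rule Arr_symmetric_monoidal)
  note g [simp]
  have Id_sq [simp]: "Id (Arr S) g \<in> squares S" using A.id_arrow(1)[of g] by simp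
  show ?thesis
  proof unfold_locales
    show "x \<in> Ob (Arr S) \<Longrightarrow> x \<box> g \<in> Ob (Arr S)" for x by simp
    show "\<alpha> \<in> hom (Arr S) x y \<Longrightarrow> arr_tensor S \<alpha> (Id (Arr S) g) \<in> hom (Arr S) (x \<box> g) (y \<box> g)" for \<alpha> x y
      by (auto simp: hom_iff)
    show "x \<in> Ob (Arr S) \<Longrightarrow> arr_tensor S (Id (Arr S) x) (Id (Arr S) g) = Id (Arr S) (x \<box> g)" for x
      using A.tensor_id[of x g] by simp
    show "arr_tensor S (\<beta> \<cdot> \<alpha>) (Id (Arr S) g) =
        arr_tensor S \<beta> (Id (Arr S) g) \<cdot> arr_tensor S \<alpha> (Id (Arr S) g)"
      if "\<alpha> \<in> hom (Arr S) x y" "\<beta> \<in> hom (Arr S) y z" for \<alpha> \<beta> x y z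
      using A.interchange[of \<alpha> \<beta> "Id (Arr S) g" "Id (Arr S) g"] that by (auto simp: hom_iff)
    fix t assume "t \<in> Ob (Arr S)"
    hence t [simp]: "t \<in> Ar S" by simp
    \<comment> \<open>The two digits of a name refer to the component of \<open>g\<close> and that of \<open>t\<close>: \<open>Hij\<close> is \<open>Hom(Y\<^sub>i, T\<^sub>j)\<close>, \<open>eij\<close> its evaluation.\<close>
    obtain H10 e10 t10 where e10 [simp]: "H10 \<in> Ob S" "e10 \<in> Ar S" "Dom S e10 = H10 \<odot> Cod S g" "Cod S e10 = Dom S t"
      and t10: "\<And>x k. x \<in> Ob S \<Longrightarrow> k \<in> Ar S \<Longrightarrow> Dom S k = x \<odot> Cod S g \<Longrightarrow> Cod S k = Dom S t \<Longrightarrow>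
        t10 x k \<in> Ar S \<and> Dom S (t10 x k) = x \<and> Cod S (t10 x k) = H10 \<and> e10 \<bullet> (t10 x k \<rhd> Cod S g) = k"
      and u10: "\<And>k k'. k \<in> Ar S \<Longrightarrow> k' \<in> Ar S \<Longrightarrow> Dom S k = Dom S k' \<Longrightarrow> Cod S k = H10 \<Longrightarrow> Cod S k' = H10 \<Longrightarrow>
        e10 \<bullet> (k \<rhd> Cod S g) = e10 \<bullet> (k' \<rhd> Cod S g) \<Longrightarrow> k = k'"
      by (rule exponential[of "Cod S g" "Dom S t"]) (simp_all, rule that)
    obtain H11 e11 t11 where e11 [simp]: "H11 \<in> Ob S" "e11 \<in> Ar S" "Dom S e11 = H11 \<odot> Cod S g" "Cod S e11 = Cod S t"
      and t11: "\<And>x k. x \<in> Ob S \<Longrightarrow> k \<in> Ar S \<Longrightarrow> Dom S k = x \<odot> Cod S g \<Longrightarrow> Cod S k = Cod S t \<Longrightarrow>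
        t11 x k \<in> Ar S \<and> Dom S (t11 x k) = x \<and> Cod S (t11 x k) = H11 \<and> e11 \<bullet> (t11 x k \<rhd> Cod S g) = k"
      and u11: "\<And>k k'. k \<in> Ar S \<Longrightarrow> k' \<in> Ar S \<Longrightarrow> Dom S k = Dom S k' \<Longrightarrow> Cod S k = H11 \<Longrightarrow> Cod S k' = H11 \<Longrightarrow>
        e11 \<bullet> (k \<rhd> Cod S g) = e11 \<bullet> (k' \<rhd> Cod S g) \<Longrightarrow> k = k'"
      by (rule exponential[of "Cod S g" "Cod S t"]) (simp_all, rule that)
    obtain H00 e00 t00 where e00 [simp]: "H00 \<in> Ob S" "e00 \<in> Ar S" "Dom S e00 = H00 \<odot> Dom S g" "Cod S e00 = Dom S t"
      and t00: "\<And>x k. x \<in> Ob S \<Longrightarrow> k \<in> Ar S \<Longrightarrow> Dom S k = x \<odot> Dom S g \<Longrightarrow> Cod S k = Dom S t \<Longrightarrow>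
        t00 x k \<in> Ar S \<and> Dom S (t00 x k) = x \<and> Cod S (t00 x k) = H00 \<and> e00 \<bullet> (t00 x k \<rhd> Dom S g) = k"
      and u00: "\<And>k k'. k \<in> Ar S \<Longrightarrow> k' \<in> Ar S \<Longrightarrow> Dom S k = Dom S k' \<Longrightarrow> Cod S k = H00 \<Longrightarrow> Cod S k' = H00 \<Longrightarrow>
        e00 \<bullet> (k \<rhd> Dom S g) = e00 \<bullet> (k' \<rhd> Dom S g) \<Longrightarrow> k = k'"
      by (rule exponential[of "Dom S g" "Dom S t"]) (simp_all, rule that)
    obtain H01 e01 t01 where e01 [simp]: "H01 \<in> Ob S" "e01 \<in> Ar S" "Dom S e01 = H01 \<odot> Dom S g" "Cod S e01 = Cod S t"
      and t01: "\<And>x k. x \<in> Ob S \<Longrightarrow> k \<in> Ar S \<Longrightarrow> Dom S k = x \<odot> Dom S g \<Longrightarrow> Cod S k = Cod S t \<Longrightarrow>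
        t01 x k \<in> Ar S \<and> Dom S (t01 x k) = x \<and> Cod S (t01 x k) = H01 \<and> e01 \<bullet> (t01 x k \<rhd> Dom S g) = k"
      and u01: "\<And>k k'. k \<in> Ar S \<Longrightarrow> k' \<in> Ar S \<Longrightarrow> Dom S k = Dom S k' \<Longrightarrow> Cod S k = H01 \<Longrightarrow> Cod S k' = H01 \<Longrightarrow>
        e01 \<bullet> (k \<rhd> Dom S g) = e01 \<bullet> (k' \<rhd> Dom S g) \<Longrightarrow> k = k'"
      by (rule exponential[of "Dom S g" "Cod S t"]) (simp_all, rule that)
    \<comment> \<open>The legs of the pullback: precomposition with \<open>g\<close> and postcomposition with \<open>t\<close>.\<close>
    define m1 where "m1 = t01 H11 (e11 \<bullet> (H11 \<lhd> g))"
    define m2 where "m2 = t01 H00 (t \<bullet> e00)"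
    have m1: "m1 \<in> Ar S" "Dom S m1 = H11" "Cod S m1 = H01" "e01 \<bullet> (m1 \<rhd> Dom S g) = e11 \<bullet> (H11 \<lhd> g)"
      unfolding m1_def using t01[of H11 "e11 \<bullet> (H11 \<lhd> g)"] by simp_all
    have m2: "m2 \<in> Ar S" "Dom S m2 = H00" "Cod S m2 = H01" "e01 \<bullet> (m2 \<rhd> Dom S g) = t \<bullet> e00"
      unfolding m2_def using t01[of H00 "t \<bullet> e00"] by simp_all
    have m: "m1 \<bullet> u = m2 \<bullet> v \<longleftrightarrow> e11 \<bullet> (u \<otimes> g) = t \<bullet> (e00 \<bullet> (v \<rhd> Dom S g))"
      if [simp]: "u \<in> Ar S" "v \<in> Ar S" "Cod S u = H11" "Cod S v = H00" "Dom S u = Dom S v" for u v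
    proof -
      have "e01 \<bullet> ((m1 \<bullet> u) \<rhd> Dom S g) = (e01 \<bullet> (m1 \<rhd> Dom S g)) \<bullet> (u \<rhd> Dom S g)"
        using m1(1-3) by (simp add: interchange)
      also have "\<dots> = e11 \<bullet> (u \<otimes> g)" unfolding m1(4) by (simp add: interchange)
      finally have 1: "e01 \<bullet> ((m1 \<bullet> u) \<rhd> Dom S g) = e11 \<bullet> (u \<otimes> g)" .
      have "e01 \<bullet> ((m2 \<bullet> v) \<rhd> Dom S g) = (e01 \<bullet> (m2 \<rhd> Dom S g)) \<bullet> (v \<rhd> Dom S g)"
        using m2(1-3) by (simp add: interchange)
      also have "\<dots> = t \<bullet> (e00 \<bullet> (v \<rhd> Dom S g))" unfolding m2(4) by simp
      finally have 2: "e01 \<bullet> ((m2 \<bullet> v) \<rhd> Dom S g) = t \<bullet> (e00 \<bullet> (v \<rhd> Dom S g))" .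
      have "m1 \<bullet> u = m2 \<bullet> v \<longleftrightarrow> e01 \<bullet> ((m1 \<bullet> u) \<rhd> Dom S g) = e01 \<bullet> ((m2 \<bullet> v) \<rhd> Dom S g)"
        using u01[of "m1 \<bullet> u" "m2 \<bullet> v"] m1(1-3) m2(1-3) by auto
      thus ?thesis unfolding 1 2 .
    qed
    obtain p q where pq: "is_pullback S m1 m2 p q"
      using pullback_exists[of m1 m2] m1 m2 by auto
    have p [simp]: "p \<in> Ar S" "q \<in> Ar S" "Cod S p = H11" "Cod S q = H00" "Dom S q = Dom S p"
      and "m1 \<bullet> p = m2 \<bullet> q"
      using pq m1(2) m2(2) by (auto simp: is_pullback_def)
    hence pq_eq: "e11 \<bullet> (p \<otimes> g) = t \<bullet> (e00 \<bullet> (q \<rhd> Dom S g))" using m[of p q] by simp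
    \<comment> \<open>The components of \<open>r\<close>: postcomposition with \<open>t\<close> and precomposition with \<open>g\<close> on \<open>Hom(Y\<^sub>1, T\<^sub>0)\<close>.\<close>
    let ?u = "t11 H10 (t \<bullet> e10)" and ?v = "t00 H10 (e10 \<bullet> (H10 \<lhd> g))"
    have u: "?u \<in> Ar S" "Dom S ?u = H10" "Cod S ?u = H11" "e11 \<bullet> (?u \<rhd> Cod S g) = t \<bullet> e10"
      using t11[of H10 "t \<bullet> e10"] by simp_all
    have v: "?v \<in> Ar S" "Dom S ?v = H10" "Cod S ?v = H00" "e00 \<bullet> (?v \<rhd> Dom S g) = e10 \<bullet> (H10 \<lhd> g)"
      using t00[of H10 "e10 \<bullet> (H10 \<lhd> g)"] by simp_all
    have "e11 \<bullet> (?u \<otimes> g) = (e11 \<bullet> (?u \<rhd> Cod S g)) \<bullet> (H10 \<lhd> g)"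
      using u(1-3) by (simp add: interchange)
    hence "e11 \<bullet> (?u \<otimes> g) = t \<bullet> (e00 \<bullet> (?v \<rhd> Dom S g))" unfolding u(4) v(4) by simp
    hence muv: "m1 \<bullet> ?u = m2 \<bullet> ?v" using m[of ?u ?v] u(1-3) v(1-3) by simp
    obtain r where r [simp]: "r \<in> Ar S" "Dom S r = H10" "Cod S r = Dom S p" and pr: "p \<bullet> r = ?u" and qr: "q \<bullet> r = ?v"
      by (rule pullback_desc[OF pq _ _ _ _ _ muv]) (use u v m1 m2 in simp_all)
    have r11: "e11 \<bullet> ((p \<bullet> (r \<bullet> s)) \<rhd> Cod S g) = t \<bullet> (e10 \<bullet> (s \<rhd> Cod S g))"
      if [simp]: "s \<in> Ar S" "Cod S s = H10" for s
    proof -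
      have "e11 \<bullet> ((p \<bullet> (r \<bullet> s)) \<rhd> Cod S g) = (e11 \<bullet> ((p \<bullet> r) \<rhd> Cod S g)) \<bullet> (s \<rhd> Cod S g)"
        by (simp add: interchange)
      thus ?thesis unfolding pr u(4) by simp
    qed
    have r00: "e00 \<bullet> ((q \<bullet> (r \<bullet> s)) \<rhd> Dom S g) = e10 \<bullet> (s \<otimes> g)"
      if [simp]: "s \<in> Ar S" "Cod S s = H10" for s
    proof -
      have "e00 \<bullet> ((q \<bullet> (r \<bullet> s)) \<rhd> Dom S g) = (e00 \<bullet> ((q \<bullet> r) \<rhd> Dom S g)) \<bullet> (s \<rhd> Dom S g)"
        by (simp add: interchange)
      thus ?thesis unfolding qr v(4) by (simp add: interchange)
    qed
    let ?e0 = "pp_desc S r g e10 (e00 \<bullet> (q \<rhd> Dom S g))"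
    have "e10 \<bullet> (Dom S r \<lhd> g) = (e00 \<bullet> (q \<rhd> Dom S g)) \<bullet> (r \<rhd> Dom S g)"
      using r00[of "Id S H10"] by (simp add: interchange)
    note * = pp_desc[of r g e10 "e00 \<bullet> (q \<rhd> Dom S g)", OF _ _ _ _ _ _ _ this]
    have e0: "?e0 \<in> Ar S" "Dom S ?e0 = pp_dom S r g" "Cod S ?e0 = Dom S t" "?e0 \<bullet> pp_in1 S r g = e10"
      "?e0 \<bullet> pp_in2 S r g = e00 \<bullet> (q \<rhd> Dom S g)"
      using * by simp_all
    \<comment> \<open>The counit \<open>r \<box> g \<rightarrow> t\<close>: evaluation at \<open>Y\<^sub>1\<close> and \<open>Y\<^sub>0\<close> on domains, evaluation at \<open>Y\<^sub>1\<close> on codomains.\<close>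
    define \<epsilon> where "\<epsilon> = (r \<box> g, t, ?e0, e11 \<bullet> (p \<rhd> Cod S g))"
    have \<epsilon>: "\<epsilon> \<in> squares S" "sq_src \<epsilon> = r \<box> g" "sq_trg \<epsilon> = t"
    proof -
      have "t \<bullet> ?e0 = (e11 \<bullet> (p \<rhd> Cod S g)) \<bullet> (r \<box> g)"
        by (rule pp_ext[of r g])
          (use e0 r11[of "Id S H10"] pq_eq in \<open>simp_all add: box_in interchange\<close>)
      thus "\<epsilon> \<in> squares S" unfolding \<epsilon>_def using e0 by (intro squareI) simp_all
    qed (simp_all add: \<epsilon>_def)
    have e_chain: "?e0 \<bullet> (pp_in1 S r g \<bullet> k) = e10 \<bullet> k" if "k \<in> Ar S" "Cod S k = H10 \<odot> Cod S g" for k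
      by (rule comp_chain[OF e0(4)]) (use that e0 in simp_all)
    have e_chain': "?e0 \<bullet> (pp_in2 S r g \<bullet> k) = e00 \<bullet> ((q \<rhd> Dom S g) \<bullet> k)"
      if "k \<in> Ar S" "Cod S k = Dom S p \<odot> Dom S g" for k
      using comp_chain[OF e0(5), of k] that e0 by simp
    have comps: "sqc (\<epsilon> \<cdot> arr_tensor S \<sigma> (Id (Arr S) g)) True =
        e11 \<bullet> ((p \<bullet> sqc \<sigma> True) \<rhd> Cod S g)"
      "sqc (\<epsilon> \<cdot> arr_tensor S \<sigma> (Id (Arr S) g)) False \<bullet> pp_in1 S f g =
        e10 \<bullet> (sqc \<sigma> False \<rhd> Cod S g)"
      "sqc (\<epsilon> \<cdot> arr_tensor S \<sigma> (Id (Arr S) g)) False \<bullet> pp_in2 S f g =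
        e00 \<bullet> ((q \<bullet> sqc \<sigma> True) \<rhd> Dom S g)"
      if [simp]: "f \<in> Ar S" and \<sigma>: "\<sigma> \<in> squares S" "sq_src \<sigma> = f" "sq_trg \<sigma> = r" for f \<sigma>
    proof -
      have [simp]: "sqc \<epsilon> True = e11 \<bullet> (p \<rhd> Cod S g)" "sqc \<epsilon> False = ?e0"
        by (simp_all add: \<epsilon>_def)
      note d = squareD[OF \<sigma>(1)]
      note T = arr_tensor_pin[OF \<sigma>(1) Id_sq, of False True] arr_tensor_pin[OF \<sigma>(1) Id_sq, of True False]
        arr_tensor_pin[OF \<sigma>(1) Id_sq, of True True]
      have tens: "sqc (arr_tensor S \<sigma> (Id (Arr S) g)) True = sqc \<sigma> True \<rhd> Cod S g"
        by (simp add: arr_tensor_eq)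
      show "sqc (\<epsilon> \<cdot> arr_tensor S \<sigma> (Id (Arr S) g)) True = e11 \<bullet> ((p \<bullet> sqc \<sigma> True) \<rhd> Cod S g)"
        using \<sigma> d by (simp add: tens interchange)
      have dd: "sqc (arr_tensor S \<sigma> (Id (Arr S) g)) False \<in> Ar S"
        "Dom S (sqc (arr_tensor S \<sigma> (Id (Arr S) g)) False) = pp_dom S f g"
        "Cod S (sqc (arr_tensor S \<sigma> (Id (Arr S) g)) False) = pp_dom S r g"
        using squareD[OF arr_tensor_square[OF \<sigma>(1) Id_sq]] \<sigma> by simp_all
      show "sqc (\<epsilon> \<cdot> arr_tensor S \<sigma> (Id (Arr S) g)) False \<bullet> pp_in1 S f g =
          e10 \<bullet> (sqc \<sigma> False \<rhd> Cod S g)"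
        using T(1) \<sigma> d dd e0(1-3) by (simp add: e_chain)
      show "sqc (\<epsilon> \<cdot> arr_tensor S \<sigma> (Id (Arr S) g)) False \<bullet> pp_in2 S f g =
          e00 \<bullet> ((q \<bullet> sqc \<sigma> True) \<rhd> Dom S g)"
        using T(2) \<sigma> d dd e0(1-3) by (simp add: e_chain' interchange)
    qed
    have "\<exists>!\<sigma>. \<sigma> \<in> hom (Arr S) f r \<and> \<epsilon> \<cdot> arr_tensor S \<sigma> (Id (Arr S) g) = \<kappa>"
      if f: "f \<in> Ob (Arr S)" and \<kappa>0: "\<kappa> \<in> hom (Arr S) (f \<box> g) t" for f \<kappa>
    proof (rule ex_ex1I)
      have f [simp]: "f \<in> Ar S" using f by simp
      have \<kappa>: "\<kappa> \<in> squares S" "sq_src \<kappa> = f \<box> g" "sq_trg \<kappa> = t" using \<kappa>0 by (auto simp: hom_iff)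
      have d [simp]: "sqc \<kappa> False \<in> Ar S" "sqc \<kappa> True \<in> Ar S" "Dom S (sqc \<kappa> False) = pp_dom S f g"
        "Dom S (sqc \<kappa> True) = Cod S f \<odot> Cod S g" "Cod S (sqc \<kappa> False) = Dom S t" "Cod S (sqc \<kappa> True) = Cod S t"
        using squareD[OF \<kappa>(1)] \<kappa> by simp_all
      have c: "t \<bullet> sqc \<kappa> False = sqc \<kappa> True \<bullet> (f \<box> g)" using square_commutes[OF \<kappa>(1)] \<kappa> by simp
      have c1: "t \<bullet> (sqc \<kappa> False \<bullet> pp_in1 S f g) = sqc \<kappa> True \<bullet> (f \<rhd> Cod S g)"
        using comp_chain[OF c, of "pp_in1 S f g"] by (simp add: box_in)
      have c2: "t \<bullet> (sqc \<kappa> False \<bullet> pp_in2 S f g) = sqc \<kappa> True \<bullet> (Cod S f \<lhd> g)"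
        using comp_chain[OF c, of "pp_in2 S f g"] by (simp add: box_in)
      let ?s0 = "t10 (Dom S f) (sqc \<kappa> False \<bullet> pp_in1 S f g)"
      let ?u = "t11 (Cod S f) (sqc \<kappa> True)" and ?v = "t00 (Cod S f) (sqc \<kappa> False \<bullet> pp_in2 S f g)"
      have s0: "?s0 \<in> Ar S" "Dom S ?s0 = Dom S f" "Cod S ?s0 = H10"
        "e10 \<bullet> (?s0 \<rhd> Cod S g) = sqc \<kappa> False \<bullet> pp_in1 S f g"
        using t10[of "Dom S f" "sqc \<kappa> False \<bullet> pp_in1 S f g"] by simp_all
      have u: "?u \<in> Ar S" "Dom S ?u = Cod S f" "Cod S ?u = H11" "e11 \<bullet> (?u \<rhd> Cod S g) = sqc \<kappa> True"
        using t11[of "Cod S f" "sqc \<kappa> True"] by simp_all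
      have v: "?v \<in> Ar S" "Dom S ?v = Cod S f" "Cod S ?v = H00"
        "e00 \<bullet> (?v \<rhd> Dom S g) = sqc \<kappa> False \<bullet> pp_in2 S f g"
        using t00[of "Cod S f" "sqc \<kappa> False \<bullet> pp_in2 S f g"] by simp_all
      have "e11 \<bullet> (?u \<otimes> g) = (e11 \<bullet> (?u \<rhd> Cod S g)) \<bullet> (Cod S f \<lhd> g)"
        using u(1-3) by (simp add: interchange)
      hence "e11 \<bullet> (?u \<otimes> g) = t \<bullet> (e00 \<bullet> (?v \<rhd> Dom S g))" unfolding u(4) v(4) c2 .
      hence muv': "m1 \<bullet> ?u = m2 \<bullet> ?v" using m[of ?u ?v] u(1-3) v(1-3) by simp
      obtain s1 where s1: "s1 \<in> Ar S" "Dom S s1 = Cod S f" "Cod S s1 = Dom S p" "p \<bullet> s1 = ?u" "q \<bullet> s1 = ?v"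
        by (rule pullback_desc[OF pq _ _ _ _ _ muv']) (use u v m1 m2 in simp_all)
      have rs: "r \<bullet> ?s0 = s1 \<bullet> f"
      proof (rule pullback_ext[OF pq])
        show "p \<bullet> (r \<bullet> ?s0) = p \<bullet> (s1 \<bullet> f)"
        proof (rule u11)
          have "e11 \<bullet> ((p \<bullet> (s1 \<bullet> f)) \<rhd> Cod S g) = (e11 \<bullet> ((p \<bullet> s1) \<rhd> Cod S g)) \<bullet> (f \<rhd> Cod S g)"
            using s1(1-3) by (simp add: interchange)
          also have "\<dots> = e11 \<bullet> ((p \<bullet> (r \<bullet> ?s0)) \<rhd> Cod S g)"
            unfolding s1(4) u(4) r11[OF s0(1,3)] s0(4) c1 ..
          finally show "e11 \<bullet> ((p \<bullet> (r \<bullet> ?s0)) \<rhd> Cod S g) = e11 \<bullet> ((p \<bullet> (s1 \<bullet> f)) \<rhd> Cod S g)" ..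
        qed (use s0(1-3) s1(1-3) in simp_all)
        show "q \<bullet> (r \<bullet> ?s0) = q \<bullet> (s1 \<bullet> f)"
        proof (rule u00)
          have "e00 \<bullet> ((q \<bullet> (s1 \<bullet> f)) \<rhd> Dom S g) = (e00 \<bullet> ((q \<bullet> s1) \<rhd> Dom S g)) \<bullet> (f \<rhd> Dom S g)"
            using s1(1-3) by (simp add: interchange)
          also have "\<dots> = sqc \<kappa> False \<bullet> (pp_in2 S f g \<bullet> (f \<rhd> Dom S g))"
            unfolding s1(5) v(4) by simp
          also have "\<dots> = (sqc \<kappa> False \<bullet> pp_in1 S f g) \<bullet> (Dom S f \<lhd> g)"
            using pp_commutes[of f g] by simp
          also have "\<dots> = (e10 \<bullet> (?s0 \<rhd> Cod S g)) \<bullet> (Dom S f \<lhd> g)"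
            by (simp only: s0(4))
          also have "\<dots> = e10 \<bullet> (?s0 \<otimes> g)" using s0(1-3) by (simp add: interchange)
          finally show "e00 \<bullet> ((q \<bullet> (r \<bullet> ?s0)) \<rhd> Dom S g) = e00 \<bullet> ((q \<bullet> (s1 \<bullet> f)) \<rhd> Dom S g)"
            unfolding r00[OF s0(1,3)] ..
        qed (use s0(1-3) s1(1-3) in simp_all)
      qed (use s0(1-3) s1(1-3) in simp_all)
      define \<sigma> where "\<sigma> = (f, r, ?s0, s1)"
      have \<sigma>: "\<sigma> \<in> squares S" "sq_src \<sigma> = f" "sq_trg \<sigma> = r" "sqc \<sigma> False = ?s0" "sqc \<sigma> True = s1"
        unfolding \<sigma>_def using rs s0(1-3) s1(1-3) by (auto intro!: squareI)
      have "\<epsilon> \<cdot> arr_tensor S \<sigma> (Id (Arr S) g) = \<kappa>"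
      proof (rule square_ext_pin[of _ _ f g])
        fix a b :: bool assume "a \<or> b"
        thus "sqc (\<epsilon> \<cdot> arr_tensor S \<sigma> (Id (Arr S) g)) (a \<and> b) \<bullet> pin f g a b = sqc \<kappa> (a \<and> b) \<bullet> pin f g a b"
          using comps[OF f \<sigma>(1-3)] \<sigma>(4,5) s1(4,5) s0(4) u(4) v(4)
          by (cases a; cases b) (simp_all del: sqc_comp)
      qed (use \<kappa> \<sigma> \<epsilon> in \<open>simp_all add: Arr_comp_square\<close>)
      thus "\<exists>\<sigma>. \<sigma> \<in> hom (Arr S) f r \<and> \<epsilon> \<cdot> arr_tensor S \<sigma> (Id (Arr S) g) = \<kappa>"
        using \<sigma>(1-3) by (intro exI[of _ \<sigma>]) (simp add: hom_iff)
      fix \<sigma> \<sigma>' assume *: "\<sigma> \<in> hom (Arr S) f r \<and> \<epsilon> \<cdot> arr_tensor S \<sigma> (Id (Arr S) g) = \<kappa>"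
        "\<sigma>' \<in> hom (Arr S) f r \<and> \<epsilon> \<cdot> arr_tensor S \<sigma>' (Id (Arr S) g) = \<kappa>"
      hence a: "\<sigma> \<in> squares S" "sq_src \<sigma> = f" "sq_trg \<sigma> = r" and b: "\<sigma>' \<in> squares S" "sq_src \<sigma>' = f" "sq_trg \<sigma>' = r"
        by (auto simp: hom_iff)
      note ca = comps[OF f a] and cb = comps[OF f b]
      have E: "\<epsilon> \<cdot> arr_tensor S \<sigma> (Id (Arr S) g) = \<kappa>" "\<epsilon> \<cdot> arr_tensor S \<sigma>' (Id (Arr S) g) = \<kappa>"
        using * by auto
      note ca = ca[unfolded E] and cb = cb[unfolded E]
      note da = squareD[OF a(1)] and db = squareD[OF b(1)]
      have "sqc \<sigma> False = sqc \<sigma>' False"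
        by (rule u10) (use ca(2) cb(2) a b da db in simp_all)
      moreover have "sqc \<sigma> True = sqc \<sigma>' True"
      proof (rule pullback_ext[OF pq])
        show "p \<bullet> sqc \<sigma> True = p \<bullet> sqc \<sigma>' True"
          by (rule u11) (use ca(1) cb(1) a b da db in simp_all)
        show "q \<bullet> sqc \<sigma> True = q \<bullet> sqc \<sigma>' True"
          by (rule u00) (use ca(3) cb(3) a b da db in simp_all)
      qed (use a b da db in simp_all)
      ultimately have "sqc \<sigma> c = sqc \<sigma>' c" for c by (cases c) simp_all
      thus "\<sigma> = \<sigma>'" using a b by (intro square_eqI) simp_all
    qed
    thus "\<exists>r \<epsilon>. r \<in> Ob (Arr S) \<and> \<epsilon> \<in> hom (Arr S) (r \<box> g) t \<and> (\<forall>f\<in>Ob (Arr S). \<forall>\<kappa>\<in>hom (Arr S) (f \<box> g) t.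
        \<exists>!\<sigma>. \<sigma> \<in> hom (Arr S) f r \<and> \<epsilon> \<cdot> arr_tensor S \<sigma> (Id (Arr S) g) = \<kappa>)"
      using \<epsilon> by (intro exI[of _ r] exI[of _ \<epsilon>]) (simp add: hom_iff)
  qed
qed

lemma Arr_symmetric_monoidal_closed: "symmetric_monoidal_closed_category (Arr S)"
proof -
  interpret A: symmetric_monoidal_category "Arr S" by (rule Arr_symmetric_monoidal)
  show ?thesis
  proof
    show "\<exists>Go Ga \<phi>. adjunction (Arr S) (Arr S) (\<lambda>x. TensOb (Arr S) x y)
        (\<lambda>f. TensAr (Arr S) f (Id (Arr S) y)) Go Ga \<phi>" if "y \<in> Ob (Arr S)" for y
      using left_adjoint.has_right_adjoint[OF Arr_closed[of y]] that by simp
  qed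
qed

end

section \<open>The projective model structure\<close>

lemma lifts_againstI:
  assumes "\<And>u v. u \<in> Ar C \<Longrightarrow> v \<in> Ar C \<Longrightarrow> Dom C u = Dom C i \<Longrightarrow> Cod C u = Dom C p \<Longrightarrow>
      Dom C v = Cod C i \<Longrightarrow> Cod C v = Cod C p \<Longrightarrow> p \<bullet>\<^bsub>C\<^esub> u = v \<bullet>\<^bsub>C\<^esub> i \<Longrightarrow>
      \<exists>h \<in> Ar C. Dom C h = Cod C i \<and> Cod C h = Dom C p \<and> h \<bullet>\<^bsub>C\<^esub> i = u \<and> p \<bullet>\<^bsub>C\<^esub> h = v"
  shows "lifts_against C i p"
  unfolding lifts_against_def
proof (intro ballI impI)
  fix u v assume "u \<in> hom C (Dom C i) (Dom C p)" "v \<in> hom C (Cod C i) (Cod C p)" "p \<bullet>\<^bsub>C\<^esub> u = v \<bullet>\<^bsub>C\<^esub> i"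
  with assms[of u v] show "\<exists>h\<in>hom C (Cod C i) (Dom C p). h \<bullet>\<^bsub>C\<^esub> i = u \<and> p \<bullet>\<^bsub>C\<^esub> h = v"
    by (auto simp: hom_iff)
qed

lemma lifts_againstE:
  assumes "lifts_against C i p" "u \<in> Ar C" "v \<in> Ar C" "Dom C u = Dom C i" "Cod C u = Dom C p"
    "Dom C v = Cod C i" "Cod C v = Cod C p" "p \<bullet>\<^bsub>C\<^esub> u = v \<bullet>\<^bsub>C\<^esub> i"
  obtains h where "h \<in> Ar C" "Dom C h = Cod C i" "Cod C h = Dom C p" "h \<bullet>\<^bsub>C\<^esub> i = u" "p \<bullet>\<^bsub>C\<^esub> h = v"
proof -
  have "\<exists>h\<in>hom C (Cod C i) (Dom C p). h \<bullet>\<^bsub>C\<^esub> i = u \<and> p \<bullet>\<^bsub>C\<^esub> h = v"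
  proof -
    have "u \<in> hom C (Dom C i) (Dom C p)" "v \<in> hom C (Cod C i) (Cod C p)"
      using assms by (auto simp: hom_iff)
    thus ?thesis using assms(1,8) unfolding lifts_against_def by blast
  qed
  thus thesis using that by (auto simp: hom_iff)
qed

lemma is_retractE:
  assumes "is_retract C f g"
  obtains s0 s1 r0 r1 where "f \<in> Ar C" "g \<in> Ar C"
    "s0 \<in> Ar C" "Dom C s0 = Dom C f" "Cod C s0 = Dom C g"
    "s1 \<in> Ar C" "Dom C s1 = Cod C f" "Cod C s1 = Cod C g"
    "r0 \<in> Ar C" "Dom C r0 = Dom C g" "Cod C r0 = Dom C f"
    "r1 \<in> Ar C" "Dom C r1 = Cod C g" "Cod C r1 = Cod C f"
    "g \<bullet>\<^bsub>C\<^esub> s0 = s1 \<bullet>\<^bsub>C\<^esub> f" "f \<bullet>\<^bsub>C\<^esub> r0 = r1 \<bullet>\<^bsub>C\<^esub> g"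
    "r0 \<bullet>\<^bsub>C\<^esub> s0 = Id C (Dom C f)" "r1 \<bullet>\<^bsub>C\<^esub> s1 = Id C (Cod C f)"
  using assms by (auto simp: is_retract_def hom_iff)

lemma is_retractI:
  assumes "f \<in> Ar C" "g \<in> Ar C"
    "s0 \<in> Ar C" "Dom C s0 = Dom C f" "Cod C s0 = Dom C g"
    "s1 \<in> Ar C" "Dom C s1 = Cod C f" "Cod C s1 = Cod C g"
    "r0 \<in> Ar C" "Dom C r0 = Dom C g" "Cod C r0 = Dom C f"
    "r1 \<in> Ar C" "Dom C r1 = Cod C g" "Cod C r1 = Cod C f"
    "g \<bullet>\<^bsub>C\<^esub> s0 = s1 \<bullet>\<^bsub>C\<^esub> f" "f \<bullet>\<^bsub>C\<^esub> r0 = r1 \<bullet>\<^bsub>C\<^esub> g"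
    "r0 \<bullet>\<^bsub>C\<^esub> s0 = Id C (Dom C f)" "r1 \<bullet>\<^bsub>C\<^esub> s1 = Id C (Cod C f)"
  shows "is_retract C f g"
  unfolding is_retract_def using assms
  by (intro conjI bexI[of _ s0] bexI[of _ s1] bexI[of _ r0] bexI[of _ r1]) (auto simp: hom_iff)

lemma (in functor_between) preserves_retract:
  assumes "is_retract C f g"
  shows "is_retract D (Fa f) (Fa g)"
proof -
  obtain s0 s1 r0 r1 where [simp]: "f \<in> Ar C" "g \<in> Ar C"
    "s0 \<in> Ar C" "Dom C s0 = Dom C f" "Cod C s0 = Dom C g"
    "s1 \<in> Ar C" "Dom C s1 = Cod C f" "Cod C s1 = Cod C g"
    "r0 \<in> Ar C" "Dom C r0 = Dom C g" "Cod C r0 = Dom C f"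
    "r1 \<in> Ar C" "Dom C r1 = Cod C g" "Cod C r1 = Cod C f"
    and e: "g \<bullet>\<^bsub>C\<^esub> s0 = s1 \<bullet>\<^bsub>C\<^esub> f" "f \<bullet>\<^bsub>C\<^esub> r0 = r1 \<bullet>\<^bsub>C\<^esub> g"
    "r0 \<bullet>\<^bsub>C\<^esub> s0 = Id C (Dom C f)" "r1 \<bullet>\<^bsub>C\<^esub> s1 = Id C (Cod C f)"
    using assms by (rule is_retractE)
  show ?thesis
    by (rule is_retractI[of _ _ _ "Fa s0" "Fa s1" "Fa r0" "Fa r1"])
      (simp_all add: map_compose[symmetric] e)
qed

context category
begin

lemma lifts_comp:
  assumes "lifts_against C i p" "lifts_against C j p" and [simp]: "i \<in> Ar C" "j \<in> Ar C" "p \<in> Ar C" "Dom C j = Cod C i"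
  shows "lifts_against C (j \<bullet> i) p"
proof (rule lifts_againstI)
  fix u v assume u: "u \<in> Ar C" "v \<in> Ar C" "Dom C u = Dom C (j \<bullet> i)" "Cod C u = Dom C p"
    "Dom C v = Cod C (j \<bullet> i)" "Cod C v = Cod C p" "p \<bullet> u = v \<bullet> (j \<bullet> i)"
  obtain h where h: "h \<in> Ar C" "Dom C h = Cod C i" "Cod C h = Dom C p" "h \<bullet> i = u" "p \<bullet> h = v \<bullet> j"
    by (rule lifts_againstE[OF assms(1), of u "v \<bullet> j"]) (use u in simp_all)
  obtain k where k: "k \<in> Ar C" "Dom C k = Cod C j" "Cod C k = Dom C p" "k \<bullet> j = h" "p \<bullet> k = v"
    by (rule lifts_againstE[OF assms(2), of h v]) (use u h in simp_all)
  have "k \<bullet> (j \<bullet> i) = u" using comp_chain[OF k(4), of i] k h by simp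
  thus "\<exists>h\<in>Ar C. Dom C h = Cod C (j \<bullet> i) \<and> Cod C h = Dom C p \<and> h \<bullet> (j \<bullet> i) = u \<and> p \<bullet> h = v"
    using k by (intro bexI[of _ k]) simp_all
qed

text \<open>The lift for \<open>g\<close> of the restricted problem and the given map on the codomain of \<open>f\<close> glue along the pushout.\<close>

lemma lifts_pushout:
  assumes po: "is_pushout C f g i j" and g: "lifts_against C g p" and p [simp]: "p \<in> Ar C"
  shows "lifts_against C i p"
proof (rule lifts_againstI)
  note ar [simp] = is_pushoutD[OF po]
  fix u v assume u: "u \<in> Ar C" "v \<in> Ar C" "Dom C u = Dom C i" "Cod C u = Dom C p"
    "Dom C v = Cod C i" "Cod C v = Cod C p" "p \<bullet> u = v \<bullet> i"
  have e: "p \<bullet> (u \<bullet> f) = (v \<bullet> j) \<bullet> g"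
    using comp_chain[OF u(7), of f] u by simp
  obtain h where h: "h \<in> Ar C" "Dom C h = Cod C g" "Cod C h = Dom C p" "h \<bullet> g = u \<bullet> f" "p \<bullet> h = v \<bullet> j"
    by (rule lifts_againstE[OF g, of "u \<bullet> f" "v \<bullet> j"]) (use u e in simp_all)
  obtain k where k: "k \<in> Ar C" "Dom C k = Cod C i" "Cod C k = Dom C p" "k \<bullet> i = u" "k \<bullet> j = h"
    by (rule is_pushout_desc[OF po, of u h]) (use u h in simp_all)
  have "p \<bullet> k = v"
  proof (rule jointly_epicD[OF pushout_jointly_epic[OF po]])
    fix l assume "l \<in> {i, j}"
    thus "(p \<bullet> k) \<bullet> l = v \<bullet> l" using k u h by auto
  qed (use k u in simp_all)
  thus "\<exists>h\<in>Ar C. Dom C h = Cod C i \<and> Cod C h = Dom C p \<and> h \<bullet> i = u \<and> p \<bullet> h = v"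
    using k by (intro bexI[of _ k]) simp_all
qed

lemma retract_argument:
  assumes [simp]: "i \<in> Ar C" "p \<in> Ar C" "Dom C p = Cod C i" and "f = p \<bullet> i" "lifts_against C f p"
  shows "is_retract C f i"
proof -
  have f [simp]: "f \<in> Ar C" "Dom C f = Dom C i" "Cod C f = Cod C p" using assms(4) by simp_all
  obtain h where h: "h \<in> Ar C" "Dom C h = Cod C f" "Cod C h = Dom C p" "h \<bullet> f = i" "p \<bullet> h = Id C (Cod C p)"
    by (rule lifts_againstE[OF assms(5), of i "Id C (Cod C p)"]) (use assms(4) in simp_all)
  show ?thesis
    by (rule is_retractI[of _ _ _ "Id C (Dom C i)" h "Id C (Dom C i)" p])
      (use h assms(4) in simp_all)
qed

end

context model_structure
begin

text \<open>The model axioms determine the (trivial) cofibrations by a lifting property, through factorization and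
  the retract argument.\<close>

lemma Cof_iff_lifts: "i \<in> Cof \<longleftrightarrow> i \<in> Ar C \<and> (\<forall>p \<in> Fib \<inter> Weq. lifts_against C i p)"
proof
  show "i \<in> Cof \<Longrightarrow> i \<in> Ar C \<and> (\<forall>p \<in> Fib \<inter> Weq. lifts_against C i p)"
    using lift_cof_tfib cof_ar by blast
  assume i: "i \<in> Ar C \<and> (\<forall>p \<in> Fib \<inter> Weq. lifts_against C i p)"
  hence "i \<in> hom C (Dom C i) (Cod C i)" by (simp add: hom_iff)
  from factor_cof_tfib[OF this] obtain z j p where
    j: "j \<in> hom C (Dom C i) z" "p \<in> hom C z (Cod C i)" "j \<in> Cof" "p \<in> Fib \<inter> Weq" "i = p \<bullet> j" by blast
  have "is_retract C i j" by (rule retract_argument[of j p]) (use i j in \<open>auto simp: hom_iff\<close>)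
  thus "i \<in> Cof" using retract_cof j by blast
qed

lemma tCof_iff_lifts: "i \<in> Cof \<inter> Weq \<longleftrightarrow> i \<in> Ar C \<and> (\<forall>p \<in> Fib. lifts_against C i p)"
proof
  show "i \<in> Cof \<inter> Weq \<Longrightarrow> i \<in> Ar C \<and> (\<forall>p \<in> Fib. lifts_against C i p)"
    using lift_tcof_fib cof_ar by blast
  assume i: "i \<in> Ar C \<and> (\<forall>p \<in> Fib. lifts_against C i p)"
  hence "i \<in> hom C (Dom C i) (Cod C i)" by (simp add: hom_iff)
  from factor_tcof_fib[OF this] obtain z j p where
    j: "j \<in> hom C (Dom C i) z" "p \<in> hom C z (Cod C i)" "j \<in> Cof \<inter> Weq" "p \<in> Fib" "i = p \<bullet> j" by blast
  have "is_retract C i j" by (rule retract_argument[of j p]) (use i j in \<open>auto simp: hom_iff\<close>)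
  thus "i \<in> Cof \<inter> Weq" using retract_cof retract_weq j by blast
qed

lemma Cof_comp:
  assumes "i \<in> Cof" "j \<in> Cof" "Dom C j = Cod C i"
  shows "j \<bullet> i \<in> Cof"
  using assms lifts_comp fib_ar unfolding Cof_iff_lifts by (auto intro!: lifts_comp)

lemma Cof_pushout:
  assumes "is_pushout C f g i j" "g \<in> Cof"
  shows "i \<in> Cof"
  using lifts_pushout[OF assms(1)] is_pushoutD[OF assms(1)] assms(2) fib_ar
  unfolding Cof_iff_lifts by blast

lemma tCof_pushout:
  assumes "is_pushout C f g i j" "g \<in> Cof \<inter> Weq"
  shows "i \<in> Cof \<inter> Weq"
  using lifts_pushout[OF assms(1)] is_pushoutD[OF assms(1)] assms(2) fib_ar
  unfolding tCof_iff_lifts by blast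

end

locale model_with_pushouts = premonoidal_category S + category_with_pushouts S + model_structure S Weq Cof Fib
  for S :: "('o, 'a, 'm) premonoidal_scheme" (structure) and Weq Cof Fib :: "'a set"
begin

lemma weq_arrow [simp]: "f \<in> Weq \<Longrightarrow> f \<in> Ar S" using weq_ar by blast
lemma cof_arrow [simp]: "f \<in> Cof \<Longrightarrow> f \<in> Ar S" using cof_ar by blast
lemma fib_arrow [simp]: "f \<in> Fib \<Longrightarrow> f \<in> Ar S" using fib_ar by blast

lemma proj_weq_iff: "\<alpha> \<in> proj_weq S Weq \<longleftrightarrow> \<alpha> \<in> squares S \<and> (\<forall>a. sqc \<alpha> a \<in> Weq)"
  by (auto simp: proj_weq_def sqc_def dest: spec[of _ True] spec[of _ False])

lemma proj_fib_iff: "\<alpha> \<in> proj_fib S Fib \<longleftrightarrow> \<alpha> \<in> squares S \<and> (\<forall>a. sqc \<alpha> a \<in> Fib)"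
  by (auto simp: proj_fib_def sqc_def dest: spec[of _ True] spec[of _ False])

lemma proj_cof_iff: "\<alpha> \<in> proj_cof S Cof \<longleftrightarrow> \<alpha> \<in> squares S \<and> sqc \<alpha> False \<in> Cof \<and> corner_map S \<alpha> \<in> Cof"
  by (auto simp: proj_cof_def sqc_def)

abbreviation cin1 :: "'a square \<Rightarrow> 'a" where "cin1 \<alpha> \<equiv> po_in1 S (sq_src \<alpha>) (sqc \<alpha> False)"
abbreviation cin2 :: "'a square \<Rightarrow> 'a" where "cin2 \<alpha> \<equiv> po_in2 S (sq_src \<alpha>) (sqc \<alpha> False)"

lemma corner_pushout:
  assumes "\<alpha> \<in> squares S"
  shows "is_pushout S (sq_src \<alpha>) (sqc \<alpha> False) (cin1 \<alpha>) (cin2 \<alpha>)"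
  by (rule is_pushout_po) (use squareD[OF assms] in simp_all)

lemma corner_in:
  assumes "\<alpha> \<in> squares S"
  shows "cin1 \<alpha> \<in> Ar S" "Dom S (cin1 \<alpha>) = Cod S (sq_src \<alpha>)" "Cod S (cin1 \<alpha>) = po_ob S (sq_src \<alpha>) (sqc \<alpha> False)"
    "cin2 \<alpha> \<in> Ar S" "Dom S (cin2 \<alpha>) = Dom S (sq_trg \<alpha>)" "Cod S (cin2 \<alpha>) = po_ob S (sq_src \<alpha>) (sqc \<alpha> False)"
    "cin1 \<alpha> \<bullet> sq_src \<alpha> = cin2 \<alpha> \<bullet> sqc \<alpha> False"
  using squareD[OF assms] po_commutes[of "sq_src \<alpha>" "sqc \<alpha> False"] by simp_all

lemma corner_map:
  assumes "\<alpha> \<in> squares S"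
  shows "corner_map S \<alpha> \<in> Ar S" "Dom S (corner_map S \<alpha>) = po_ob S (sq_src \<alpha>) (sqc \<alpha> False)"
    "Cod S (corner_map S \<alpha>) = Cod S (sq_trg \<alpha>)"
    "corner_map S \<alpha> \<bullet> cin1 \<alpha> = sqc \<alpha> True" "corner_map S \<alpha> \<bullet> cin2 \<alpha> = sq_trg \<alpha>"
proof -
  have "corner_map S \<alpha> = po_desc S (sq_src \<alpha>) (sqc \<alpha> False) (sqc \<alpha> True) (sq_trg \<alpha>)"
    by (simp add: corner_map_def sqc_def)
  thus "corner_map S \<alpha> \<in> Ar S" "Dom S (corner_map S \<alpha>) = po_ob S (sq_src \<alpha>) (sqc \<alpha> False)"
    "Cod S (corner_map S \<alpha>) = Cod S (sq_trg \<alpha>)"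
    "corner_map S \<alpha> \<bullet> cin1 \<alpha> = sqc \<alpha> True" "corner_map S \<alpha> \<bullet> cin2 \<alpha> = sq_trg \<alpha>"
    using po_desc[of "sq_src \<alpha>" "sqc \<alpha> False" "sqc \<alpha> True" "sq_trg \<alpha>"] squareD[OF assms]
      square_commutes[OF assms] by simp_all
qed

lemma corner_ext:
  assumes "\<alpha> \<in> squares S" "k \<in> Ar S" "k' \<in> Ar S" "Dom S k = po_ob S (sq_src \<alpha>) (sqc \<alpha> False)"
    "Dom S k' = po_ob S (sq_src \<alpha>) (sqc \<alpha> False)" "Cod S k = Cod S k'"
    "k \<bullet> cin1 \<alpha> = k' \<bullet> cin1 \<alpha>" "k \<bullet> cin2 \<alpha> = k' \<bullet> cin2 \<alpha>"
  shows "k = k'"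
  by (rule po_ext[of "sq_src \<alpha>" "sqc \<alpha> False"]) (use assms squareD[OF assms(1)] in simp_all)

lemma corner_desc:
  assumes "\<alpha> \<in> squares S" "u \<in> Ar S" "v \<in> Ar S" "Dom S u = Cod S (sq_src \<alpha>)" "Dom S v = Dom S (sq_trg \<alpha>)"
    "Cod S u = Cod S v" "u \<bullet> sq_src \<alpha> = v \<bullet> sqc \<alpha> False"
  obtains h where "h \<in> Ar S" "Dom S h = po_ob S (sq_src \<alpha>) (sqc \<alpha> False)" "Cod S h = Cod S v"
    "h \<bullet> cin1 \<alpha> = u" "h \<bullet> cin2 \<alpha> = v"
  using po_desc[of "sq_src \<alpha>" "sqc \<alpha> False" u v] assms squareD[OF assms(1)] by auto

text \<open>A commutative square of squares induces a map between the domains of the corner maps. Its compatibility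
  with the corner maps makes retracts of squares into retracts of corner maps.\<close>

lemma corner_functorial:
  assumes \<alpha>: "\<alpha> \<in> squares S" and \<beta>: "\<beta> \<in> squares S" and \<sigma>: "\<sigma> \<in> squares S" and \<tau>: "\<tau> \<in> squares S"
    and st: "sq_src \<sigma> = sq_src \<alpha>" "sq_trg \<sigma> = sq_src \<beta>" "sq_src \<tau> = sq_trg \<alpha>" "sq_trg \<tau> = sq_trg \<beta>"
    and e: "\<And>a. sqc \<beta> a \<bullet> sqc \<sigma> a = sqc \<tau> a \<bullet> sqc \<alpha> a"
  obtains c where "c \<in> Ar S" "Dom S c = po_ob S (sq_src \<alpha>) (sqc \<alpha> False)"
    "Cod S c = po_ob S (sq_src \<beta>) (sqc \<beta> False)"
    "c \<bullet> cin1 \<alpha> = cin1 \<beta> \<bullet> sqc \<sigma> True" "c \<bullet> cin2 \<alpha> = cin2 \<beta> \<bullet> sqc \<tau> False"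
    "corner_map S \<beta> \<bullet> c = sqc \<tau> True \<bullet> corner_map S \<alpha>"
proof -
  note d = squareD[OF \<alpha>] squareD[OF \<beta>] squareD[OF \<sigma>] squareD[OF \<tau>] corner_in(1-6)[OF \<alpha>] corner_in(1-6)[OF \<beta>]
  have "(cin1 \<beta> \<bullet> sqc \<sigma> True) \<bullet> sq_src \<alpha> = (cin1 \<beta> \<bullet> sq_src \<beta>) \<bullet> sqc \<sigma> False"
    using square_commutes[OF \<sigma>] d st by simp
  also have "\<dots> = cin2 \<beta> \<bullet> (sqc \<beta> False \<bullet> sqc \<sigma> False)"
    unfolding corner_in(7)[OF \<beta>] using d st by simp
  also have "\<dots> = (cin2 \<beta> \<bullet> sqc \<tau> False) \<bullet> sqc \<alpha> False" unfolding e using d st by simp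
  finally have "(cin1 \<beta> \<bullet> sqc \<sigma> True) \<bullet> sq_src \<alpha> = (cin2 \<beta> \<bullet> sqc \<tau> False) \<bullet> sqc \<alpha> False" .
  then obtain c where c: "c \<in> Ar S" "Dom S c = po_ob S (sq_src \<alpha>) (sqc \<alpha> False)"
    "Cod S c = po_ob S (sq_src \<beta>) (sqc \<beta> False)"
    "c \<bullet> cin1 \<alpha> = cin1 \<beta> \<bullet> sqc \<sigma> True" "c \<bullet> cin2 \<alpha> = cin2 \<beta> \<bullet> sqc \<tau> False"
    using corner_desc[OF \<alpha>, of "cin1 \<beta> \<bullet> sqc \<sigma> True" "cin2 \<beta> \<bullet> sqc \<tau> False"] d st by auto
  have "corner_map S \<beta> \<bullet> c = sqc \<tau> True \<bullet> corner_map S \<alpha>"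
    by (rule corner_ext[OF \<alpha>])
      (use c d st corner_map[OF \<alpha>] corner_map[OF \<beta>] e[of True] square_commutes[OF \<tau>]
        comp_chain[OF corner_map(4)[OF \<beta>]] comp_chain[OF corner_map(5)[OF \<beta>]] in simp_all)
  with c that show thesis by blast
qed

lemma corner_retract:
  assumes "is_retract (Arr S) \<alpha> \<beta>"
  shows "is_retract S (corner_map S \<alpha>) (corner_map S \<beta>)"
proof -
  obtain s0 s1 r0 r1 where a: "\<alpha> \<in> squares S" "\<beta> \<in> squares S"
    "s0 \<in> squares S" "sq_src s0 = sq_src \<alpha>" "sq_trg s0 = sq_src \<beta>"
    "s1 \<in> squares S" "sq_src s1 = sq_trg \<alpha>" "sq_trg s1 = sq_trg \<beta>"
    "r0 \<in> squares S" "sq_src r0 = sq_src \<beta>" "sq_trg r0 = sq_src \<alpha>"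
    "r1 \<in> squares S" "sq_src r1 = sq_trg \<beta>" "sq_trg r1 = sq_trg \<alpha>"
    and e: "\<beta> \<cdot> s0 = s1 \<cdot> \<alpha>" "\<alpha> \<cdot> r0 = r1 \<cdot> \<beta>"
    "r0 \<cdot> s0 = Id (Arr S) (sq_src \<alpha>)" "r1 \<cdot> s1 = Id (Arr S) (sq_trg \<alpha>)"
    using is_retractE[OF assms] by (metis Arr_sel(2-4))
  have e': "sqc \<beta> a \<bullet> sqc s0 a = sqc s1 a \<bullet> sqc \<alpha> a" "sqc \<alpha> a \<bullet> sqc r0 a = sqc r1 a \<bullet> sqc \<beta> a"
    "sqc r0 a \<bullet> sqc s0 a = Id S (ev S (sq_src \<alpha>) a)" "sqc r1 a \<bullet> sqc s1 a = Id S (ev S (sq_trg \<alpha>) a)" for a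
    using arg_cong[OF e(1), of "\<lambda>x. sqc x a"] arg_cong[OF e(2), of "\<lambda>x. sqc x a"]
      arg_cong[OF e(3), of "\<lambda>x. sqc x a"] arg_cong[OF e(4), of "\<lambda>x. sqc x a"] by simp_all
  obtain c where c: "c \<in> Ar S" "Dom S c = po_ob S (sq_src \<alpha>) (sqc \<alpha> False)"
    "Cod S c = po_ob S (sq_src \<beta>) (sqc \<beta> False)"
    "c \<bullet> cin1 \<alpha> = cin1 \<beta> \<bullet> sqc s0 True" "c \<bullet> cin2 \<alpha> = cin2 \<beta> \<bullet> sqc s1 False"
    "corner_map S \<beta> \<bullet> c = sqc s1 True \<bullet> corner_map S \<alpha>"
    by (rule corner_functorial[OF a(1,2,3,6) a(4,5,7,8) e'(1)]) (rule that)
  obtain d where d: "d \<in> Ar S" "Dom S d = po_ob S (sq_src \<beta>) (sqc \<beta> False)"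
    "Cod S d = po_ob S (sq_src \<alpha>) (sqc \<alpha> False)"
    "d \<bullet> cin1 \<beta> = cin1 \<alpha> \<bullet> sqc r0 True" "d \<bullet> cin2 \<beta> = cin2 \<alpha> \<bullet> sqc r1 False"
    "corner_map S \<alpha> \<bullet> d = sqc r1 True \<bullet> corner_map S \<beta>"
    by (rule corner_functorial[OF a(2,1,9,12) a(10,11,13,14) e'(2)]) (rule that)
  note D = squareD[OF a(1)] squareD[OF a(2)] squareD[OF a(3)] squareD[OF a(6)] squareD[OF a(9)]
    squareD[OF a(12)] corner_in(1-6)[OF a(1)] corner_in(1-6)[OF a(2)]
  have dc: "d \<bullet> c = Id S (po_ob S (sq_src \<alpha>) (sqc \<alpha> False))"
  proof (rule corner_ext[OF a(1)])
    show "(d \<bullet> c) \<bullet> cin1 \<alpha> = Id S (po_ob S (sq_src \<alpha>) (sqc \<alpha> False)) \<bullet> cin1 \<alpha>"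
      using c d D a comp_chain[OF d(4), of "sqc s0 True"] e'(3)[of True] by simp
    show "(d \<bullet> c) \<bullet> cin2 \<alpha> = Id S (po_ob S (sq_src \<alpha>) (sqc \<alpha> False)) \<bullet> cin2 \<alpha>"
      using c d D a comp_chain[OF d(5), of "sqc s1 False"] e'(4)[of False] by simp
  qed (use c d D in simp_all)
  show ?thesis
    by (rule is_retractI[of _ _ _ c "sqc s1 True" d "sqc r1 True"])
      (simp_all add: c d dc D a corner_map(1-3)[OF a(1)] corner_map(1-3)[OF a(2)] e'(4)[of True])
qed

text \<open>The lift is built first on domains, by lifting \<open>\<alpha>\<^sub>0\<close>. Together with the given map on the codomain of the
  source this defines a map on the domain of the corner map, and lifting the corner map against \<open>p\<^sub>1\<close> extends it to
  codomains, compatibly with the lift on domains.\<close>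

lemma Arr_lifts:
  assumes \<alpha>: "\<alpha> \<in> squares S" and p: "p \<in> squares S"
    and l0: "lifts_against S (sqc \<alpha> False) (sqc p False)" and l1: "lifts_against S (corner_map S \<alpha>) (sqc p True)"
  shows "lifts_against (Arr S) \<alpha> p"
proof (rule lifts_againstI)
  fix u v assume "u \<in> Ar (Arr S)" "v \<in> Ar (Arr S)" "Dom (Arr S) u = Dom (Arr S) \<alpha>"
    "Cod (Arr S) u = Dom (Arr S) p" "Dom (Arr S) v = Cod (Arr S) \<alpha>" "Cod (Arr S) v = Cod (Arr S) p"
    and e: "p \<cdot> u = v \<cdot> \<alpha>"
  hence u: "u \<in> squares S" "sq_src u = sq_src \<alpha>" "sq_trg u = sq_src p"
    and v: "v \<in> squares S" "sq_src v = sq_trg \<alpha>" "sq_trg v = sq_trg p" by simp_all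
  note D = squareD[OF \<alpha>] squareD[OF p] squareD[OF u(1)] squareD[OF v(1)] u v
    corner_in(1-6)[OF \<alpha>] corner_map(1-3)[OF \<alpha>]
  have e': "sqc p a \<bullet> sqc u a = sqc v a \<bullet> sqc \<alpha> a" for a
    using arg_cong[OF e, of "\<lambda>x. sqc x a"] by simp
  obtain h0 where h0: "h0 \<in> Ar S" "Dom S h0 = Dom S (sq_trg \<alpha>)" "Cod S h0 = Dom S (sq_src p)"
    "h0 \<bullet> sqc \<alpha> False = sqc u False" "sqc p False \<bullet> h0 = sqc v False"
    by (rule lifts_againstE[OF l0, of "sqc u False" "sqc v False"]) (use D e' in simp_all)
  have "sqc u True \<bullet> sq_src \<alpha> = (sq_src p \<bullet> h0) \<bullet> sqc \<alpha> False"
    using square_commutes[OF u(1)] D h0 by simp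
  then obtain w where w: "w \<in> Ar S" "Dom S w = po_ob S (sq_src \<alpha>) (sqc \<alpha> False)" "Cod S w = Cod S (sq_src p)"
    "w \<bullet> cin1 \<alpha> = sqc u True" "w \<bullet> cin2 \<alpha> = sq_src p \<bullet> h0"
    using corner_desc[OF \<alpha>, of "sqc u True" "sq_src p \<bullet> h0"] D h0 by auto
  have "sqc p True \<bullet> w = sqc v True \<bullet> corner_map S \<alpha>"
  proof (rule corner_ext[OF \<alpha>])
    show "(sqc p True \<bullet> w) \<bullet> cin1 \<alpha> = (sqc v True \<bullet> corner_map S \<alpha>) \<bullet> cin1 \<alpha>"
      using w D e'[of True] corner_map(4)[OF \<alpha>] by simp
    have "sqc p True \<bullet> (sq_src p \<bullet> h0) = sq_trg p \<bullet> (sqc p False \<bullet> h0)"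
      by (rule comp_chain_eq[OF square_commutes[OF p, symmetric], THEN trans]) (use D h0 in simp_all)
    also have "\<dots> = sqc v True \<bullet> sq_trg \<alpha>" unfolding h0(5) using square_commutes[OF v(1)] D by simp
    finally show "(sqc p True \<bullet> w) \<bullet> cin2 \<alpha> = (sqc v True \<bullet> corner_map S \<alpha>) \<bullet> cin2 \<alpha>"
      using w D corner_map(5)[OF \<alpha>] by simp
  qed (use w D in simp_all)
  then obtain h1 where h1: "h1 \<in> Ar S" "Dom S h1 = Cod S (sq_trg \<alpha>)" "Cod S h1 = Cod S (sq_src p)"
    "h1 \<bullet> corner_map S \<alpha> = w" "sqc p True \<bullet> h1 = sqc v True"
    using lifts_againstE[OF l1, of w "sqc v True"] w D by auto
  have h1a: "h1 \<bullet> sqc \<alpha> True = sqc u True" "h1 \<bullet> sq_trg \<alpha> = sq_src p \<bullet> h0"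
    using comp_chain[OF h1(4), of "cin1 \<alpha>"] comp_chain[OF h1(4), of "cin2 \<alpha>"] corner_map(4,5)[OF \<alpha>] w h1 D
    by simp_all
  define h where "h = (sq_trg \<alpha>, sq_src p, h0, h1)"
  have h: "h \<in> squares S" "sq_src h = sq_trg \<alpha>" "sq_trg h = sq_src p" "sqc h False = h0" "sqc h True = h1"
    unfolding h_def using h0 h1 h1a D by (auto intro!: squareI)
  have "h \<cdot> \<alpha> = u"
  proof (rule square_eqI)
    fix a show "sqc (h \<cdot> \<alpha>) a = sqc u a" using h h0 h1a by (cases a) simp_all
  qed (use h u in simp_all)
  moreover have "p \<cdot> h = v"
  proof (rule square_eqI)
    fix a show "sqc (p \<cdot> h) a = sqc v a" using h h0 h1 by (cases a) simp_all
  qed (use h v in simp_all)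
  ultimately show "\<exists>h\<in>Ar (Arr S). Dom (Arr S) h = Cod (Arr S) \<alpha> \<and> Cod (Arr S) h = Dom (Arr S) p \<and>
      h \<cdot> \<alpha> = u \<and> p \<cdot> h = v"
    using h by (intro bexI[of _ h]) simp_all
qed

text \<open>The codomain component of \<open>\<alpha>\<close> is the corner map after a pushout of \<open>\<alpha>\<^sub>0\<close>. That pushout is a trivial
  cofibration, so two-out-of-three applies to the corner map.\<close>

lemma proj_tcof_corner:
  assumes "\<alpha> \<in> proj_cof S Cof" "\<alpha> \<in> proj_weq S Weq"
  shows "sqc \<alpha> False \<in> Cof \<inter> Weq" "corner_map S \<alpha> \<in> Cof \<inter> Weq"
proof -
  have \<alpha>: "\<alpha> \<in> squares S" "sqc \<alpha> False \<in> Cof" "corner_map S \<alpha> \<in> Cof" "\<And>a. sqc \<alpha> a \<in> Weq"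
    using assms by (auto simp: proj_cof_iff proj_weq_iff)
  thus t: "sqc \<alpha> False \<in> Cof \<inter> Weq" by simp
  have "cin1 \<alpha> \<in> Cof \<inter> Weq" by (rule tCof_pushout[OF corner_pushout[OF \<alpha>(1)] t])
  moreover have "corner_map S \<alpha> \<bullet> cin1 \<alpha> \<in> Weq" using corner_map(4)[OF \<alpha>(1)] \<alpha> by simp
  ultimately have "corner_map S \<alpha> \<in> Weq"
    using two_of_three_left[of "cin1 \<alpha>" _ _ "corner_map S \<alpha>"] corner_map(1-3)[OF \<alpha>(1)] corner_in(1-3)[OF \<alpha>(1)]
    by (auto simp: hom_iff)
  thus "corner_map S \<alpha> \<in> Cof \<inter> Weq" using \<alpha> by simp
qed

text \<open>Given a factorization of \<open>\<alpha>\<^sub>0\<close> through \<open>Z\<^sub>0\<close>, the map from the pushout of the source with \<open>Z\<^sub>0\<close> to the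
  codomain of the target is factored as \<open>p1 \<bullet> j\<close>. Then \<open>j\<close> is the corner map of the first square. The
  predicate \<open>P\<close> stands for either pair of classes in the factorization axioms.\<close>

lemma Arr_factor:
  assumes \<alpha>: "\<alpha> \<in> squares S"
    and i0: "i0 \<in> Ar S" "p0 \<in> Ar S" "Dom S p0 = Cod S i0" "sqc \<alpha> False = p0 \<bullet> i0"
    and fac: "\<And>c. c \<in> Ar S \<Longrightarrow> \<exists>j p1. j \<in> Ar S \<and> p1 \<in> Ar S \<and> Dom S p1 = Cod S j \<and> c = p1 \<bullet> j \<and> P j p1"
  obtains \<iota> \<pi> where "\<iota> \<in> squares S" "\<pi> \<in> squares S" "sq_src \<iota> = sq_src \<alpha>" "sq_trg \<iota> = sq_src \<pi>"
    "sq_trg \<pi> = sq_trg \<alpha>" "\<alpha> = \<pi> \<cdot> \<iota>" "sqc \<iota> False = i0" "sqc \<pi> False = p0"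
    "P (corner_map S \<iota>) (sqc \<pi> True)"
proof -
  note D = squareD[OF \<alpha>] i0
  have i0d [simp]: "Dom S i0 = Dom S (sq_src \<alpha>)" "Cod S p0 = Dom S (sq_trg \<alpha>)"
    using D(4,5)[of False] i0 by auto
  let ?f = "sq_src \<alpha>" and ?g = "sq_trg \<alpha>"
  let ?in1 = "po_in1 S ?f i0" and ?in2 = "po_in2 S ?f i0"
  let ?c = "po_desc S ?f i0 (sqc \<alpha> True) (?g \<bullet> p0)"
  have "sqc \<alpha> True \<bullet> ?f = (?g \<bullet> p0) \<bullet> i0"
    using square_commutes[OF \<alpha>] D by simp
  note * = po_desc[of ?f i0 "sqc \<alpha> True" "?g \<bullet> p0", OF _ _ _ _ _ _ _ _ this]
  have c: "?c \<in> Ar S" "Dom S ?c = po_ob S ?f i0" "Cod S ?c = Cod S ?g" "?c \<bullet> ?in1 = sqc \<alpha> True"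
    "?c \<bullet> ?in2 = ?g \<bullet> p0" using * D by simp_all
  obtain j p1 where j: "j \<in> Ar S" "p1 \<in> Ar S" "Dom S p1 = Cod S j" "?c = p1 \<bullet> j" "P j p1"
    using fac[OF c(1)] by blast
  have jd: "Dom S j = po_ob S ?f i0" "Cod S p1 = Cod S ?g" using j c by auto
  define \<iota> where "\<iota> = (?f, j \<bullet> ?in2, i0, j \<bullet> ?in1)"
  define \<pi> where "\<pi> = (j \<bullet> ?in2, ?g, p0, p1)"
  have pc: "?in1 \<bullet> ?f = ?in2 \<bullet> i0" by (rule po_commutes) (use D in simp_all)
  have \<iota>: "\<iota> \<in> squares S" unfolding \<iota>_def
    by (rule squareI) (use D j jd pc in simp_all)
  have "?g \<bullet> p0 = p1 \<bullet> (j \<bullet> ?in2)" using c(5) unfolding j(4) using D j jd by simp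
  hence \<pi>: "\<pi> \<in> squares S" unfolding \<pi>_def
    by (intro squareI) (use D j jd in simp_all)
  have "corner_map S \<iota> = j"
    by (rule corner_ext[OF \<iota>])
      (use corner_map[OF \<iota>] D j jd in \<open>simp_all add: \<iota>_def\<close>)
  hence P: "P (corner_map S \<iota>) (sqc \<pi> True)" using j(5) by (simp add: \<pi>_def)
  have "\<alpha> = \<pi> \<cdot> \<iota>"
  proof (rule square_eqI)
    fix a
    have "p1 \<bullet> (j \<bullet> ?in1) = sqc \<alpha> True" using c(4) unfolding j(4) using D j jd by simp
    thus "sqc \<alpha> a = sqc (\<pi> \<cdot> \<iota>) a" using i0(4) by (cases a) (simp_all add: \<iota>_def \<pi>_def)
  qed (simp_all add: \<iota>_def \<pi>_def)
  from that[OF \<iota> \<pi> _ _ _ this _ _ P] show thesis by (simp add: \<iota>_def \<pi>_def)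
qed

lemma Arr_model_structure: "model_structure (Arr S) (proj_weq S Weq) (proj_cof S Cof) (proj_fib S Fib)"
proof -
  interpret A: category "Arr S" by (rule Arr_category)
  interpret E: functor_between "Arr S" S "\<lambda>f. ev S f a" "\<lambda>\<alpha>. sqc \<alpha> a" for a by (rule ev_functor)
  show ?thesis
  proof
    show "proj_weq S Weq \<subseteq> Ar (Arr S)" "proj_cof S Cof \<subseteq> Ar (Arr S)" "proj_fib S Fib \<subseteq> Ar (Arr S)"
      by (auto simp: proj_weq_def proj_cof_def proj_fib_def)
    fix \<alpha> \<beta> x y z
    have h: "sqc \<alpha> a \<in> hom S (ev S x a) (ev S y a)" if "\<alpha> \<in> hom (Arr S) x y" for \<alpha> x y a
      using E.map_hom[OF that] .
    show "\<beta> \<cdot> \<alpha> \<in> proj_weq S Weq"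
      if "\<alpha> \<in> hom (Arr S) x y" "\<beta> \<in> hom (Arr S) y z" "\<alpha> \<in> proj_weq S Weq" "\<beta> \<in> proj_weq S Weq"
      using that two_of_three_comp[OF h[OF that(1)] h[OF that(2)]] A.comp_in_hom[OF that(1,2)]
      by (auto simp: proj_weq_iff hom_iff)
    show "\<beta> \<in> proj_weq S Weq"
      if "\<alpha> \<in> hom (Arr S) x y" "\<beta> \<in> hom (Arr S) y z" "\<alpha> \<in> proj_weq S Weq" "\<beta> \<cdot> \<alpha> \<in> proj_weq S Weq"
      using that two_of_three_left[OF h[OF that(1)] h[OF that(2)]] by (auto simp: proj_weq_iff hom_iff)
    show "\<alpha> \<in> proj_weq S Weq"
      if "\<alpha> \<in> hom (Arr S) x y" "\<beta> \<in> hom (Arr S) y z" "\<beta> \<in> proj_weq S Weq" "\<beta> \<cdot> \<alpha> \<in> proj_weq S Weq"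
      using that two_of_three_right[OF h[OF that(1)] h[OF that(2)]] by (auto simp: proj_weq_iff hom_iff)
    show "\<alpha> \<in> proj_weq S Weq" if r: "is_retract (Arr S) \<alpha> \<beta>" and "\<beta> \<in> proj_weq S Weq"
      using retract_weq[OF E.preserves_retract[OF r]] that by (auto simp: proj_weq_iff is_retract_def)
    show "\<alpha> \<in> proj_fib S Fib" if r: "is_retract (Arr S) \<alpha> \<beta>" and "\<beta> \<in> proj_fib S Fib"
      using retract_fib[OF E.preserves_retract[OF r]] that by (auto simp: proj_fib_iff is_retract_def)
    show "\<alpha> \<in> proj_cof S Cof" if r: "is_retract (Arr S) \<alpha> \<beta>" and "\<beta> \<in> proj_cof S Cof"
      using retract_cof[OF E.preserves_retract[OF r]] retract_cof[OF corner_retract[OF r]] that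
      by (auto simp: proj_cof_iff is_retract_def)
    show "lifts_against (Arr S) \<alpha> \<beta>" if "\<alpha> \<in> proj_cof S Cof" "\<beta> \<in> proj_fib S Fib \<inter> proj_weq S Weq"
      by (rule Arr_lifts) (use that in \<open>auto simp: proj_cof_iff proj_fib_iff proj_weq_iff intro!: lift_cof_tfib\<close>)
    show "lifts_against (Arr S) \<alpha> \<beta>" if "\<alpha> \<in> proj_cof S Cof \<inter> proj_weq S Weq" "\<beta> \<in> proj_fib S Fib"
    proof (rule Arr_lifts)
      show "lifts_against S (sqc \<alpha> False) (sqc \<beta> False)" "lifts_against S (corner_map S \<alpha>) (sqc \<beta> True)"
        using proj_tcof_corner[of \<alpha>] that lift_tcof_fib by (auto simp: proj_fib_iff)
    qed (use that in \<open>auto simp: proj_cof_iff proj_fib_iff\<close>)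
    show "\<exists>z i p. i \<in> hom (Arr S) x z \<and> p \<in> hom (Arr S) z y \<and> i \<in> proj_cof S Cof \<and>
        p \<in> proj_fib S Fib \<inter> proj_weq S Weq \<and> \<alpha> = p \<cdot> i" if xy: "\<alpha> \<in> hom (Arr S) x y"
    proof -
      have \<alpha>: "\<alpha> \<in> squares S" "sq_src \<alpha> = x" "sq_trg \<alpha> = y" using xy by (auto simp: hom_iff)
      obtain z i0 p0 where i0: "i0 \<in> hom S (ev S x False) z" "p0 \<in> hom S z (ev S y False)"
        "i0 \<in> Cof" "p0 \<in> Fib \<inter> Weq" "sqc \<alpha> False = p0 \<bullet> i0"
        using factor_cof_tfib[OF h[OF xy]] by blast
      have fac: "\<exists>j p1. j \<in> Ar S \<and> p1 \<in> Ar S \<and> Dom S p1 = Cod S j \<and> c = p1 \<bullet> j \<and> (j \<in> Cof \<and> p1 \<in> Fib \<inter> Weq)"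
        if "c \<in> Ar S" for c
        using factor_cof_tfib[of c "Dom S c" "Cod S c"] that by (auto simp: hom_iff)
      have i0a: "i0 \<in> Ar S" "p0 \<in> Ar S" "Dom S p0 = Cod S i0" using i0 by (auto simp: hom_iff)
      obtain \<iota> \<pi> where "\<iota> \<in> squares S" "\<pi> \<in> squares S" "sq_src \<iota> = sq_src \<alpha>" "sq_trg \<iota> = sq_src \<pi>"
        "sq_trg \<pi> = sq_trg \<alpha>" "\<alpha> = \<pi> \<cdot> \<iota>" "sqc \<iota> False = i0" "sqc \<pi> False = p0"
        "corner_map S \<iota> \<in> Cof \<and> sqc \<pi> True \<in> Fib \<inter> Weq" 
        by (rule Arr_factor[OF \<alpha>(1) i0a i0(5) fac], assumption, rule that)
      thus ?thesis using i0 \<alpha>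
        by (intro exI[of _ "sq_src \<pi>"] exI[of _ \<iota>] exI[of _ \<pi>])
          (auto simp: hom_iff proj_cof_iff proj_fib_def proj_weq_def sqc_def)
    qed
    show "\<exists>z i p. i \<in> hom (Arr S) x z \<and> p \<in> hom (Arr S) z y \<and> i \<in> proj_cof S Cof \<inter> proj_weq S Weq \<and>
        p \<in> proj_fib S Fib \<and> \<alpha> = p \<cdot> i" if xy: "\<alpha> \<in> hom (Arr S) x y"
    proof -
      have \<alpha>: "\<alpha> \<in> squares S" "sq_src \<alpha> = x" "sq_trg \<alpha> = y" using xy by (auto simp: hom_iff)
      obtain z i0 p0 where i0: "i0 \<in> hom S (ev S x False) z" "p0 \<in> hom S z (ev S y False)"
        "i0 \<in> Cof \<inter> Weq" "p0 \<in> Fib" "sqc \<alpha> False = p0 \<bullet> i0"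
        using factor_tcof_fib[OF h[OF xy]] by blast
      have fac: "\<exists>j p1. j \<in> Ar S \<and> p1 \<in> Ar S \<and> Dom S p1 = Cod S j \<and> c = p1 \<bullet> j \<and> (j \<in> Cof \<inter> Weq \<and> p1 \<in> Fib)"
        if "c \<in> Ar S" for c
        using factor_tcof_fib[of c "Dom S c" "Cod S c"] that by (auto simp: hom_iff)
      have i0a: "i0 \<in> Ar S" "p0 \<in> Ar S" "Dom S p0 = Cod S i0" using i0 by (auto simp: hom_iff)
      obtain \<iota> \<pi> where \<iota>: "\<iota> \<in> squares S" "\<pi> \<in> squares S" "sq_src \<iota> = sq_src \<alpha>" "sq_trg \<iota> = sq_src \<pi>"
        "sq_trg \<pi> = sq_trg \<alpha>" "\<alpha> = \<pi> \<cdot> \<iota>" "sqc \<iota> False = i0" "sqc \<pi> False = p0"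
        "corner_map S \<iota> \<in> Cof \<inter> Weq \<and> sqc \<pi> True \<in> Fib" 
        by (rule Arr_factor[OF \<alpha>(1) i0a i0(5) fac], assumption, rule that)
      have "cin1 \<iota> \<in> Cof \<inter> Weq"
        by (rule tCof_pushout[OF corner_pushout[OF \<iota>(1)]]) (use \<iota> i0 in simp)
      hence "corner_map S \<iota> \<bullet> cin1 \<iota> \<in> Weq"
        using two_of_three_comp[of "cin1 \<iota>" _ _ "corner_map S \<iota>"] \<iota>(9) corner_map(1-3)[OF \<iota>(1)]
          corner_in(1-3)[OF \<iota>(1)] by (simp add: hom_iff)
      hence "sqc \<iota> True \<in> Weq" using corner_map(4)[OF \<iota>(1)] by simp
      hence "\<iota> \<in> proj_cof S Cof \<inter> proj_weq S Weq" "\<pi> \<in> proj_fib S Fib"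
        using i0(3,4) \<iota>(1,2,7-9) by (auto simp: proj_cof_iff proj_fib_def proj_weq_def sqc_def)
      thus ?thesis using \<iota>(1-6) \<alpha>
        by (intro exI[of _ "sq_src \<pi>"] exI[of _ \<iota>] exI[of _ \<pi>]) (simp add: hom_iff)
    qed
  qed
qed

end

section \<open>The pushout product axiom\<close>

text \<open>Lifting of the pushout product of \<open>i\<close> and \<open>j\<close> against \<open>p\<close>, with the map out of the pushout replaced by its
  two restrictions \<open>u\<close> and \<open>v\<close>.\<close>

definition lifts2 :: "('o, 'a, 'm) premonoidal_scheme \<Rightarrow> 'a \<Rightarrow> 'a \<Rightarrow> 'a \<Rightarrow> bool" where
  "lifts2 S i j p \<longleftrightarrow> (\<forall>u \<in> Ar S. \<forall>v \<in> Ar S. \<forall>w \<in> Ar S.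
     Dom S u = Dom S i \<odot>\<^bsub>S\<^esub> Cod S j \<and> Cod S u = Dom S p \<and>
     Dom S v = Cod S i \<odot>\<^bsub>S\<^esub> Dom S j \<and> Cod S v = Dom S p \<and>
     Dom S w = Cod S i \<odot>\<^bsub>S\<^esub> Cod S j \<and> Cod S w = Cod S p \<and>
     u \<bullet>\<^bsub>S\<^esub> (Id S (Dom S i) \<otimes>\<^bsub>S\<^esub> j) = v \<bullet>\<^bsub>S\<^esub> (i \<otimes>\<^bsub>S\<^esub> Id S (Dom S j)) \<and>
     p \<bullet>\<^bsub>S\<^esub> u = w \<bullet>\<^bsub>S\<^esub> (i \<otimes>\<^bsub>S\<^esub> Id S (Cod S j)) \<and>
     p \<bullet>\<^bsub>S\<^esub> v = w \<bullet>\<^bsub>S\<^esub> (Id S (Cod S i) \<otimes>\<^bsub>S\<^esub> j) \<longrightarrow>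
     (\<exists>h \<in> Ar S. Dom S h = Cod S i \<odot>\<^bsub>S\<^esub> Cod S j \<and> Cod S h = Dom S p \<and>
        h \<bullet>\<^bsub>S\<^esub> (i \<otimes>\<^bsub>S\<^esub> Id S (Cod S j)) = u \<and> h \<bullet>\<^bsub>S\<^esub> (Id S (Cod S i) \<otimes>\<^bsub>S\<^esub> j) = v \<and> p \<bullet>\<^bsub>S\<^esub> h = w))"

lemma lifts2E:
  assumes "lifts2 S i j p" "u \<in> Ar S" "v \<in> Ar S" "w \<in> Ar S"
     "Dom S u = Dom S i \<odot>\<^bsub>S\<^esub> Cod S j" "Cod S u = Dom S p"
     "Dom S v = Cod S i \<odot>\<^bsub>S\<^esub> Dom S j" "Cod S v = Dom S p"
     "Dom S w = Cod S i \<odot>\<^bsub>S\<^esub> Cod S j" "Cod S w = Cod S p"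
     "u \<bullet>\<^bsub>S\<^esub> (Id S (Dom S i) \<otimes>\<^bsub>S\<^esub> j) = v \<bullet>\<^bsub>S\<^esub> (i \<otimes>\<^bsub>S\<^esub> Id S (Dom S j))"
     "p \<bullet>\<^bsub>S\<^esub> u = w \<bullet>\<^bsub>S\<^esub> (i \<otimes>\<^bsub>S\<^esub> Id S (Cod S j))"
     "p \<bullet>\<^bsub>S\<^esub> v = w \<bullet>\<^bsub>S\<^esub> (Id S (Cod S i) \<otimes>\<^bsub>S\<^esub> j)"
  obtains h where "h \<in> Ar S" "Dom S h = Cod S i \<odot>\<^bsub>S\<^esub> Cod S j" "Cod S h = Dom S p"
    "h \<bullet>\<^bsub>S\<^esub> (i \<otimes>\<^bsub>S\<^esub> Id S (Cod S j)) = u" "h \<bullet>\<^bsub>S\<^esub> (Id S (Cod S i) \<otimes>\<^bsub>S\<^esub> j) = v" "p \<bullet>\<^bsub>S\<^esub> h = w"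
  using assms unfolding lifts2_def by blast

context smcc
begin

lemma box_lifts_iff:
  assumes [simp]: "i \<in> Ar S" "j \<in> Ar S" "p \<in> Ar S"
  shows "lifts_against S (i \<box> j) p \<longleftrightarrow> lifts2 S i j p"
proof
  assume L: "lifts_against S (i \<box> j) p"
  show "lifts2 S i j p"
    unfolding lifts2_def
  proof (intro ballI impI, elim conjE)
    fix u v w assume a [simp]: "u \<in> Ar S" "v \<in> Ar S" "w \<in> Ar S" "Dom S u = Dom S i \<odot> Cod S j" "Cod S u = Dom S p"
      "Dom S v = Cod S i \<odot> Dom S j" "Cod S v = Dom S p" "Dom S w = Cod S i \<odot> Cod S j" "Cod S w = Cod S p"
      and e: "u \<bullet> (Dom S i \<lhd> j) = v \<bullet> (i \<rhd> Dom S j)"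
      "p \<bullet> u = w \<bullet> (i \<rhd> Cod S j)" "p \<bullet> v = w \<bullet> (Cod S i \<lhd> j)"
    let ?D = "pp_desc S i j u v"
    have D [simp]: "?D \<in> Ar S" "Dom S ?D = pp_dom S i j" "Cod S ?D = Dom S p"
      and D': "?D \<bullet> pp_in1 S i j = u" "?D \<bullet> pp_in2 S i j = v"
      using pp_desc[of i j u v, OF _ _ _ _ _ _ _ e(1)] by simp_all
    have "p \<bullet> ?D = w \<bullet> (i \<box> j)"
      by (rule pp_ext[of i j]) (simp_all add: D' box_in e)
    then obtain h where h: "h \<in> Ar S" "Dom S h = Cod S i \<odot> Cod S j" "Cod S h = Dom S p"
      "h \<bullet> (i \<box> j) = ?D" "p \<bullet> h = w"
      using lifts_againstE[OF L, of ?D w] by auto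
    have "h \<bullet> (i \<rhd> Cod S j) = u" "h \<bullet> (Cod S i \<lhd> j) = v"
      using comp_chain[OF h(4), of "pp_in1 S i j"] comp_chain[OF h(4), of "pp_in2 S i j"] h(1-3)
      by (simp_all add: D' box_in)
    thus "\<exists>h\<in>Ar S. Dom S h = Cod S i \<odot> Cod S j \<and> Cod S h = Dom S p \<and>
        h \<bullet> (i \<rhd> Cod S j) = u \<and> h \<bullet> (Cod S i \<lhd> j) = v \<and> p \<bullet> h = w"
      using h by blast
  qed
next
  assume L: "lifts2 S i j p"
  show "lifts_against S (i \<box> j) p"
  proof (rule lifts_againstI)
    fix u v assume a [simp]: "u \<in> Ar S" "v \<in> Ar S" "Dom S u = Dom S (i \<box> j)" "Cod S u = Dom S p"
      "Dom S v = Cod S (i \<box> j)" "Cod S v = Cod S p" and e: "p \<bullet> u = v \<bullet> (i \<box> j)"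
    have "(u \<bullet> pp_in1 S i j) \<bullet> (Dom S i \<lhd> j) = (u \<bullet> pp_in2 S i j) \<bullet> (i \<rhd> Dom S j)"
      by (simp add: pp_commutes)
    moreover have "p \<bullet> (u \<bullet> pp_in1 S i j) = v \<bullet> (i \<rhd> Cod S j)"
      "p \<bullet> (u \<bullet> pp_in2 S i j) = v \<bullet> (Cod S i \<lhd> j)"
      using comp_chain[OF e, of "pp_in1 S i j"] comp_chain[OF e, of "pp_in2 S i j"]
      by (simp_all add: box_in)
    ultimately obtain h where h: "h \<in> Ar S" "Dom S h = Cod S i \<odot> Cod S j" "Cod S h = Dom S p"
      "h \<bullet> (i \<rhd> Cod S j) = u \<bullet> pp_in1 S i j" "h \<bullet> (Cod S i \<lhd> j) = u \<bullet> pp_in2 S i j" "p \<bullet> h = v"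
      using lifts2E[OF L, of "u \<bullet> pp_in1 S i j" "u \<bullet> pp_in2 S i j" v] by auto
    have "h \<bullet> (i \<box> j) = u"
      by (rule pp_ext[of i j]) (simp_all add: h box_in)
    thus "\<exists>h\<in>Ar S. Dom S h = Cod S (i \<box> j) \<and> Cod S h = Dom S p \<and> h \<bullet> (i \<box> j) = u \<and> p \<bullet> h = v"
      using h by (intro bexI[of _ h]) simp_all
  qed
qed

lemma whisker_swap:
  assumes "x \<in> Ar S" "y \<in> Ar S" "k \<in> Ar S" "Dom S k = Cod S x \<odot> Cod S y"
    "a = Cod S x" "b = Dom S y" "c = Dom S x" "d = Cod S y"
  shows "(k \<bullet> (a \<lhd> y)) \<bullet> (x \<rhd> b) = (k \<bullet> (x \<rhd> d)) \<bullet> (c \<lhd> y)"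
  using assms by (simp add: interchange)

text \<open>The two-variable lifting problem for squares \<open>\<alpha>\<close>, \<open>\<beta>\<close> against \<open>p\<close>, with everything in components. Here
  \<open>\<alpha> = (a0, a1) : f \<rightarrow> g\<close> and \<open>\<beta> = (b0, b1) : h \<rightarrow> k\<close> have corner maps \<open>ca\<close> and \<open>cb\<close>, and \<open>p = (p0, p1) : r \<rightarrow> s\<close>.
  The given maps are \<open>u\<close> on \<open>f \<box> k\<close>, \<open>v\<close> on \<open>g \<box> h\<close> and \<open>w\<close> on \<open>g \<box> k\<close>, each with one map for every pair of component
  indices except \<open>00\<close>; the hypotheses \<open>un\<close>, \<open>vn\<close>, \<open>wn\<close> are their naturality in the indices. The lift on \<open>g \<box> k\<close> is
  found in the order \<open>h01\<close>, \<open>h10\<close>, \<open>h11\<close>, each step using the earlier maps as boundary data.\<close>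

lemma two_variable_lift:
  assumes po\<alpha>: "is_pushout S f a0 i1 i2" and po\<beta>: "is_pushout S h b0 j1 j2"
    and ca [simp]: "ca \<in> Ar S" "Dom S ca = Cod S i1" and cb [simp]: "cb \<in> Ar S" "Dom S cb = Cod S j1"
    and a1: "ca \<bullet> i1 = a1" and g: "ca \<bullet> i2 = g" and b1: "cb \<bullet> j1 = b1" and k: "cb \<bullet> j2 = k"
    and p [simp]: "p0 \<in> Ar S" "p1 \<in> Ar S" "r \<in> Ar S" "s \<in> Ar S" "Dom S r = Dom S p0" "Cod S r = Dom S p1"
      "Dom S s = Cod S p0" "Cod S s = Cod S p1" and sp: "s \<bullet> p0 = p1 \<bullet> r"
    and l01: "lifts2 S a0 b1 p0" and l10: "lifts2 S ca b0 p0" and l11: "lifts2 S ca cb p1"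
    and u [simp]: "u01 \<in> Ar S" "u10 \<in> Ar S" "u11 \<in> Ar S"
      "Dom S u01 = Dom S f \<odot> Cod S cb" "Dom S u10 = Cod S f \<odot> Cod S b0" "Dom S u11 = Cod S f \<odot> Cod S cb"
      "Cod S u01 = Dom S p0" "Cod S u10 = Dom S p0" "Cod S u11 = Dom S p1"
    and v [simp]: "v01 \<in> Ar S" "v10 \<in> Ar S" "v11 \<in> Ar S"
      "Dom S v01 = Cod S a0 \<odot> Cod S h" "Dom S v10 = Cod S ca \<odot> Dom S b0" "Dom S v11 = Cod S ca \<odot> Cod S h"
      "Cod S v01 = Dom S p0" "Cod S v10 = Dom S p0" "Cod S v11 = Dom S p1"
    and w [simp]: "w01 \<in> Ar S" "w10 \<in> Ar S" "w11 \<in> Ar S"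
      "Dom S w01 = Cod S a0 \<odot> Cod S cb" "Dom S w10 = Cod S ca \<odot> Cod S b0" "Dom S w11 = Cod S ca \<odot> Cod S cb"
      "Cod S w01 = Cod S p0" "Cod S w10 = Cod S p0" "Cod S w11 = Cod S p1"
    and un: "u01 \<bullet> (Dom S f \<lhd> k) = u10 \<bullet> (f \<rhd> Cod S b0)"
      "r \<bullet> u01 = u11 \<bullet> (f \<rhd> Cod S cb)" "r \<bullet> u10 = u11 \<bullet> (Cod S f \<lhd> k)"
    and vn: "v01 \<bullet> (Cod S a0 \<lhd> h) = v10 \<bullet> (g \<rhd> Dom S b0)"
      "r \<bullet> v01 = v11 \<bullet> (g \<rhd> Cod S h)" "r \<bullet> v10 = v11 \<bullet> (Cod S ca \<lhd> h)"
    and wn: "w01 \<bullet> (Cod S a0 \<lhd> k) = w10 \<bullet> (g \<rhd> Cod S b0)"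
      "s \<bullet> w01 = w11 \<bullet> (g \<rhd> Cod S cb)" "s \<bullet> w10 = w11 \<bullet> (Cod S ca \<lhd> k)"
    and uv: "u01 \<bullet> (Dom S f \<lhd> b1) = v01 \<bullet> (a0 \<rhd> Cod S h)"
      "u10 \<bullet> (Cod S f \<lhd> b0) = v10 \<bullet> (a1 \<rhd> Dom S b0)"
      "u11 \<bullet> (Cod S f \<lhd> b1) = v11 \<bullet> (a1 \<rhd> Cod S h)"
    and pu: "p0 \<bullet> u01 = w01 \<bullet> (a0 \<rhd> Cod S cb)" "p0 \<bullet> u10 = w10 \<bullet> (a1 \<rhd> Cod S b0)"
      "p1 \<bullet> u11 = w11 \<bullet> (a1 \<rhd> Cod S cb)"
    and pv: "p0 \<bullet> v01 = w01 \<bullet> (Cod S a0 \<lhd> b1)" "p0 \<bullet> v10 = w10 \<bullet> (Cod S ca \<lhd> b0)"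
      "p1 \<bullet> v11 = w11 \<bullet> (Cod S ca \<lhd> b1)"
  obtains h01 h10 h11 where "h01 \<in> Ar S" "Dom S h01 = Cod S a0 \<odot> Cod S cb" "Cod S h01 = Dom S p0"
    "h10 \<in> Ar S" "Dom S h10 = Cod S ca \<odot> Cod S b0" "Cod S h10 = Dom S p0"
    "h11 \<in> Ar S" "Dom S h11 = Cod S ca \<odot> Cod S cb" "Cod S h11 = Dom S p1"
    "h01 \<bullet> (Cod S a0 \<lhd> k) = h10 \<bullet> (g \<rhd> Cod S b0)"
    "r \<bullet> h01 = h11 \<bullet> (g \<rhd> Cod S cb)" "r \<bullet> h10 = h11 \<bullet> (Cod S ca \<lhd> k)"
    "h01 \<bullet> (a0 \<rhd> Cod S cb) = u01" "h10 \<bullet> (a1 \<rhd> Cod S b0) = u10" "h11 \<bullet> (a1 \<rhd> Cod S cb) = u11"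
    "h01 \<bullet> (Cod S a0 \<lhd> b1) = v01" "h10 \<bullet> (Cod S ca \<lhd> b0) = v10" "h11 \<bullet> (Cod S ca \<lhd> b1) = v11"
    "p0 \<bullet> h01 = w01" "p0 \<bullet> h10 = w10" "p1 \<bullet> h11 = w11"
proof -
  note A = is_pushoutD[OF po\<alpha>] note B = is_pushoutD[OF po\<beta>]
  note [simp] = A(1-4,6-8) B(1-4,6-8) A(5)[symmetric] B(5)[symmetric]
  have [simp]: "g \<in> Ar S" "Dom S g = Cod S a0" "Cod S g = Cod S ca" "a1 \<in> Ar S" "Dom S a1 = Cod S f" "Cod S a1 = Cod S ca"
    "k \<in> Ar S" "Dom S k = Cod S b0" "Cod S k = Cod S cb" "b1 \<in> Ar S" "Dom S b1 = Cod S h" "Cod S b1 = Cod S cb"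
    using g a1 b1 k A B ca cb by auto
  have af: "a1 \<bullet> f = g \<bullet> a0" and bh: "b1 \<bullet> h = k \<bullet> b0"
    using comp_chain[OF a1, of f] comp_chain[OF g, of a0] A(9) comp_chain[OF b1, of h] comp_chain[OF k, of b0] B(9)
    by simp_all
  have poR: "is_pushout S (f \<rhd> x) (a0 \<rhd> x) (i1 \<rhd> x) (i2 \<rhd> x)" if "x \<in> Ob S" for x
    by (rule tensor_right_pushout[OF po\<alpha> that])
  have poL: "is_pushout S (x \<lhd> h) (x \<lhd> b0) (x \<lhd> j1) (x \<lhd> j2)" if "x \<in> Ob S" for x
    by (rule tensor_left_pushout[OF po\<beta> that])
  have extR: "m = m'" if "x \<in> Ob S" "m \<in> Ar S" "m' \<in> Ar S" "Dom S m = Cod S i1 \<odot> x" "Dom S m' = Cod S i1 \<odot> x"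
      "Cod S m = Cod S m'" "m \<bullet> (i1 \<rhd> x) = m' \<bullet> (i1 \<rhd> x)" "m \<bullet> (i2 \<rhd> x) = m' \<bullet> (i2 \<rhd> x)" for m m' x
    by (rule jointly_epicD[OF pushout_jointly_epic[OF poR[OF that(1)]]]) (use that in auto)
  have extL: "m = m'" if "x \<in> Ob S" "m \<in> Ar S" "m' \<in> Ar S" "Dom S m = x \<odot> Cod S j1" "Dom S m' = x \<odot> Cod S j1"
      "Cod S m = Cod S m'" "m \<bullet> (x \<lhd> j1) = m' \<bullet> (x \<lhd> j1)" "m \<bullet> (x \<lhd> j2) = m' \<bullet> (x \<lhd> j2)" for m m' x
    by (rule jointly_epicD[OF pushout_jointly_epic[OF poL[OF that(1)]]]) (use that in auto)
  \<comment> \<open>A map out of \<open>Cod g\<close> tensored with an object, restricted along \<open>ca\<close> and then to the two parts of its domain;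
    likewise for \<open>cb\<close> in the other variable.\<close>
  have caR: "(m \<bullet> (ca \<otimes> y)) \<bullet> (i1 \<rhd> Dom S y) = m \<bullet> (a1 \<otimes> y)"
     "(m \<bullet> (ca \<otimes> y)) \<bullet> (i2 \<rhd> Dom S y) = m \<bullet> (g \<otimes> y)"
    if "m \<in> Ar S" "y \<in> Ar S" "Dom S m = Cod S ca \<odot> Cod S y" for m y
    using that by (simp_all add: interchange a1 g)
  have cbL: "(m \<bullet> (y \<otimes> cb)) \<bullet> (Dom S y \<lhd> j1) = m \<bullet> (y \<otimes> b1)"
     "(m \<bullet> (y \<otimes> cb)) \<bullet> (Dom S y \<lhd> j2) = m \<bullet> (y \<otimes> k)"
    if "m \<in> Ar S" "y \<in> Ar S" "Dom S m = Cod S y \<odot> Cod S cb" for m y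
    using that by (simp_all add: interchange b1 k)
  \<comment> \<open>The map on \<open>Dom g \<odot> Cod k\<close> has boundary data on \<open>Dom f \<odot> Cod k\<close> and \<open>Dom g \<odot> Cod h\<close> only.\<close>
  obtain h01 where h01 [simp]: "h01 \<in> Ar S" "Dom S h01 = Cod S a0 \<odot> Cod S cb" "Cod S h01 = Dom S p0"
    and H01: "h01 \<bullet> (a0 \<rhd> Cod S cb) = u01" "h01 \<bullet> (Cod S a0 \<lhd> b1) = v01" "p0 \<bullet> h01 = w01"
    using lifts2E[OF l01, of u01 v01 w01] uv(1) pu(1) pv(1) by auto
  \<comment> \<open>The map on \<open>Cod g \<odot> Dom k\<close> must also agree with \<open>h01\<close> on \<open>Dom g \<odot> Dom k\<close>. Glued with the data on
    \<open>Cod f \<odot> Dom k\<close>, this prescribes it on the domain of \<open>ca\<close> tensored with \<open>Dom k\<close>.\<close>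
  have "u10 \<bullet> (f \<rhd> Cod S b0) = (h01 \<bullet> (a0 \<rhd> Cod S cb)) \<bullet> (Dom S f \<lhd> k)"
    unfolding H01 un(1)[symmetric] ..
  also have "\<dots> = (h01 \<bullet> (Cod S a0 \<lhd> k)) \<bullet> (a0 \<rhd> Cod S b0)"
    by (rule whisker_swap[symmetric]) simp_all
  finally obtain u' where u' [simp]: "u' \<in> Ar S" "Dom S u' = Cod S i1 \<odot> Cod S b0" "Cod S u' = Dom S p0"
    and U': "u' \<bullet> (i1 \<rhd> Cod S b0) = u10" "u' \<bullet> (i2 \<rhd> Cod S b0) = h01 \<bullet> (Cod S a0 \<lhd> k)"
    using is_pushout_desc[OF poR[of "Cod S b0"], of u10 "h01 \<bullet> (Cod S a0 \<lhd> k)"] by auto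
  have uv': "u' \<bullet> (Cod S i1 \<lhd> b0) = v10 \<bullet> (ca \<rhd> Dom S b0)"
  proof (rule extR[of "Dom S b0"])
    have "(u' \<bullet> (Cod S i1 \<lhd> b0)) \<bullet> (i1 \<rhd> Dom S b0) = (u' \<bullet> (i1 \<rhd> Cod S b0)) \<bullet> (Cod S f \<lhd> b0)"
      by (rule whisker_swap) simp_all
    thus "(u' \<bullet> (Cod S i1 \<lhd> b0)) \<bullet> (i1 \<rhd> Dom S b0) = (v10 \<bullet> (ca \<rhd> Dom S b0)) \<bullet> (i1 \<rhd> Dom S b0)"
      using caR(1)[of v10 "Id S (Dom S b0)"] unfolding U' uv(2) by simp
    have "(u' \<bullet> (Cod S i1 \<lhd> b0)) \<bullet> (i2 \<rhd> Dom S b0) = (u' \<bullet> (i2 \<rhd> Cod S b0)) \<bullet> (Cod S a0 \<lhd> b0)"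
      by (rule whisker_swap) simp_all
    also have "\<dots> = (h01 \<bullet> (Cod S a0 \<lhd> b1)) \<bullet> (Cod S a0 \<lhd> h)"
      unfolding U' by (simp add: interchange bh)
    also have "\<dots> = v10 \<bullet> (g \<rhd> Dom S b0)" unfolding H01 by (rule vn(1))
    finally show "(u' \<bullet> (Cod S i1 \<lhd> b0)) \<bullet> (i2 \<rhd> Dom S b0) = (v10 \<bullet> (ca \<rhd> Dom S b0)) \<bullet> (i2 \<rhd> Dom S b0)"
      using caR(2)[of v10 "Id S (Dom S b0)"] by simp
  qed simp_all
  have pu': "p0 \<bullet> u' = w10 \<bullet> (ca \<rhd> Cod S b0)"
  proof (rule extR[of "Cod S b0"])
    show "(p0 \<bullet> u') \<bullet> (i1 \<rhd> Cod S b0) = (w10 \<bullet> (ca \<rhd> Cod S b0)) \<bullet> (i1 \<rhd> Cod S b0)"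
      using caR(1)[of w10 "Id S (Cod S b0)"] by (simp add: U' pu(2))
    have "(p0 \<bullet> u') \<bullet> (i2 \<rhd> Cod S b0) = (p0 \<bullet> h01) \<bullet> (Cod S a0 \<lhd> k)"
      by (simp add: U')
    thus "(p0 \<bullet> u') \<bullet> (i2 \<rhd> Cod S b0) = (w10 \<bullet> (ca \<rhd> Cod S b0)) \<bullet> (i2 \<rhd> Cod S b0)"
      using caR(2)[of w10 "Id S (Cod S b0)"] unfolding H01 wn(1) by simp
  qed simp_all
  obtain h10 where h10 [simp]: "h10 \<in> Ar S" "Dom S h10 = Cod S ca \<odot> Cod S b0" "Cod S h10 = Dom S p0"
    and H10: "h10 \<bullet> (ca \<rhd> Cod S b0) = u'" "h10 \<bullet> (Cod S ca \<lhd> b0) = v10" "p0 \<bullet> h10 = w10"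
    using lifts2E[OF l10, of u' v10 w10] uv' pu' pv(2) by auto
  have H10': "h10 \<bullet> (a1 \<rhd> Cod S b0) = u10" "h10 \<bullet> (g \<rhd> Cod S b0) = h01 \<bullet> (Cod S a0 \<lhd> k)"
    using caR[of h10 "Id S (Cod S b0)"] unfolding H10 U'[symmetric] by simp_all
  \<comment> \<open>On \<open>Cod g \<odot> Cod k\<close> both variables involve a corner map: \<open>u''\<close> glues \<open>u11\<close> with \<open>r \<bullet> h01\<close>, and \<open>v''\<close> glues
    \<open>v11\<close> with \<open>r \<bullet> h10\<close>. Their agreement is tested on the four pairs of coprojections.\<close>
  have "u11 \<bullet> (f \<rhd> Cod S cb) = (r \<bullet> h01) \<bullet> (a0 \<rhd> Cod S cb)"
    using H01(1) un(2) by simp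
  then obtain u'' where u'' [simp]: "u'' \<in> Ar S" "Dom S u'' = Cod S i1 \<odot> Cod S cb" "Cod S u'' = Dom S p1"
    and U'': "u'' \<bullet> (i1 \<rhd> Cod S cb) = u11" "u'' \<bullet> (i2 \<rhd> Cod S cb) = r \<bullet> h01"
    using is_pushout_desc[OF poR[of "Cod S cb"], of u11 "r \<bullet> h01"] by auto
  have "v11 \<bullet> (Cod S ca \<lhd> h) = (r \<bullet> h10) \<bullet> (Cod S ca \<lhd> b0)"
    using H10(2) vn(3) by simp
  then obtain v'' where v'' [simp]: "v'' \<in> Ar S" "Dom S v'' = Cod S ca \<odot> Cod S j1" "Cod S v'' = Dom S p1"
    and V'': "v'' \<bullet> (Cod S ca \<lhd> j1) = v11" "v'' \<bullet> (Cod S ca \<lhd> j2) = r \<bullet> h10"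
    using is_pushout_desc[OF poL[of "Cod S ca"], of v11 "r \<bullet> h10"] by auto
  have uv'': "u'' \<bullet> (Cod S i1 \<lhd> cb) = v'' \<bullet> (ca \<rhd> Cod S j1)"
  proof (rule extR[of "Cod S j1"])
    have swu: "(u'' \<bullet> (Cod S i1 \<lhd> cb)) \<bullet> (i \<rhd> Cod S j1) = (u'' \<bullet> (i \<rhd> Cod S cb)) \<bullet> (Dom S i \<lhd> cb)"
      if "i \<in> Ar S" "Cod S i = Cod S i1" for i
      by (rule whisker_swap) (use that in simp_all)
    have swv: "(v'' \<bullet> (x \<rhd> Cod S j1)) \<bullet> (Dom S x \<lhd> j) = (v'' \<bullet> (Cod S ca \<lhd> j)) \<bullet> (x \<rhd> Dom S j)"
      if "x \<in> Ar S" "Cod S x = Cod S ca" "j \<in> Ar S" "Cod S j = Cod S j1" for x j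
      by (rule whisker_swap[symmetric]) (use that in simp_all)
    have cax: "(v'' \<bullet> (ca \<rhd> Cod S j1)) \<bullet> (i1 \<rhd> Cod S j1) = v'' \<bullet> (a1 \<rhd> Cod S j1)"
      "(v'' \<bullet> (ca \<rhd> Cod S j1)) \<bullet> (i2 \<rhd> Cod S j1) = v'' \<bullet> (g \<rhd> Cod S j1)"
      using caR[of v'' "Id S (Cod S j1)"] by simp_all
    have "u11 \<bullet> (Cod S f \<lhd> cb) = v'' \<bullet> (a1 \<rhd> Cod S j1)"
    proof (rule extL[of "Cod S f"])
      show "(u11 \<bullet> (Cod S f \<lhd> cb)) \<bullet> (Cod S f \<lhd> j1) = (v'' \<bullet> (a1 \<rhd> Cod S j1)) \<bullet> (Cod S f \<lhd> j1)"
        using cbL(1)[of u11 "Id S (Cod S f)"] swv[of a1 j1] V''(1) uv(3) by simp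
      have "(v'' \<bullet> (a1 \<rhd> Cod S j1)) \<bullet> (Cod S f \<lhd> j2) = (r \<bullet> h10) \<bullet> (a1 \<rhd> Cod S b0)"
        using swv[of a1 j2] V''(2) by simp
      also have "\<dots> = u11 \<bullet> (Cod S f \<lhd> k)" using H10'(1) un(3) by simp
      finally show "(u11 \<bullet> (Cod S f \<lhd> cb)) \<bullet> (Cod S f \<lhd> j2) = (v'' \<bullet> (a1 \<rhd> Cod S j1)) \<bullet> (Cod S f \<lhd> j2)"
        using cbL(2)[of u11 "Id S (Cod S f)"] by simp
    qed simp_all
    thus "(u'' \<bullet> (Cod S i1 \<lhd> cb)) \<bullet> (i1 \<rhd> Cod S j1) = (v'' \<bullet> (ca \<rhd> Cod S j1)) \<bullet> (i1 \<rhd> Cod S j1)"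
      unfolding cax using swu[of i1] U''(1) by simp
    have "(r \<bullet> h01) \<bullet> (Cod S a0 \<lhd> cb) = v'' \<bullet> (g \<rhd> Cod S j1)"
    proof (rule extL[of "Cod S a0"])
      have "((r \<bullet> h01) \<bullet> (Cod S a0 \<lhd> cb)) \<bullet> (Cod S a0 \<lhd> j1) = r \<bullet> (h01 \<bullet> (Cod S a0 \<lhd> b1))"
        by (simp add: interchange b1)
      also have "\<dots> = v11 \<bullet> (g \<rhd> Cod S h)" unfolding H01 by (rule vn(2))
      finally show "((r \<bullet> h01) \<bullet> (Cod S a0 \<lhd> cb)) \<bullet> (Cod S a0 \<lhd> j1) = (v'' \<bullet> (g \<rhd> Cod S j1)) \<bullet> (Cod S a0 \<lhd> j1)"
        using swv[of g j1] V''(1) by simp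
      have "((r \<bullet> h01) \<bullet> (Cod S a0 \<lhd> cb)) \<bullet> (Cod S a0 \<lhd> j2) = r \<bullet> (h01 \<bullet> (Cod S a0 \<lhd> k))"
        by (simp add: interchange k)
      also have "\<dots> = (r \<bullet> h10) \<bullet> (g \<rhd> Cod S b0)" unfolding H10'(2)[symmetric] by simp
      finally show "((r \<bullet> h01) \<bullet> (Cod S a0 \<lhd> cb)) \<bullet> (Cod S a0 \<lhd> j2) = (v'' \<bullet> (g \<rhd> Cod S j1)) \<bullet> (Cod S a0 \<lhd> j2)"
        using swv[of g j2] V''(2) by simp
    qed simp_all
    thus "(u'' \<bullet> (Cod S i1 \<lhd> cb)) \<bullet> (i2 \<rhd> Cod S j1) = (v'' \<bullet> (ca \<rhd> Cod S j1)) \<bullet> (i2 \<rhd> Cod S j1)"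
      unfolding cax using swu[of i2] U''(2) by simp
  qed simp_all
  have pu'': "p1 \<bullet> u'' = w11 \<bullet> (ca \<rhd> Cod S cb)"
  proof (rule extR[of "Cod S cb"])
    show "(p1 \<bullet> u'') \<bullet> (i1 \<rhd> Cod S cb) = (w11 \<bullet> (ca \<rhd> Cod S cb)) \<bullet> (i1 \<rhd> Cod S cb)"
      using caR(1)[of w11 "Id S (Cod S cb)"] by (simp add: U'' pu(3))
    have "p1 \<bullet> (r \<bullet> h01) = s \<bullet> (p0 \<bullet> h01)"
      by (rule comp_chain_eq[OF sp[symmetric]]) simp_all
    thus "(p1 \<bullet> u'') \<bullet> (i2 \<rhd> Cod S cb) = (w11 \<bullet> (ca \<rhd> Cod S cb)) \<bullet> (i2 \<rhd> Cod S cb)"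
      using caR(2)[of w11 "Id S (Cod S cb)"] by (simp add: U'' H01 wn(2))
  qed simp_all
  have pv'': "p1 \<bullet> v'' = w11 \<bullet> (Cod S ca \<lhd> cb)"
  proof (rule extL[of "Cod S ca"])
    show "(p1 \<bullet> v'') \<bullet> (Cod S ca \<lhd> j1) = (w11 \<bullet> (Cod S ca \<lhd> cb)) \<bullet> (Cod S ca \<lhd> j1)"
      using cbL(1)[of w11 "Id S (Cod S ca)"] by (simp add: V'' pv(3))
    have "p1 \<bullet> (r \<bullet> h10) = s \<bullet> (p0 \<bullet> h10)"
      by (rule comp_chain_eq[OF sp[symmetric]]) simp_all
    thus "(p1 \<bullet> v'') \<bullet> (Cod S ca \<lhd> j2) = (w11 \<bullet> (Cod S ca \<lhd> cb)) \<bullet> (Cod S ca \<lhd> j2)"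
      using cbL(2)[of w11 "Id S (Cod S ca)"] by (simp add: V'' H10 wn(3))
  qed simp_all
  obtain h11 where h11 [simp]: "h11 \<in> Ar S" "Dom S h11 = Cod S ca \<odot> Cod S cb" "Cod S h11 = Dom S p1"
    and H11: "h11 \<bullet> (ca \<rhd> Cod S cb) = u''" "h11 \<bullet> (Cod S ca \<lhd> cb) = v''" "p1 \<bullet> h11 = w11"
    using lifts2E[OF l11, of u'' v'' w11] uv'' pu'' pv'' by auto
  have "h11 \<bullet> (a1 \<rhd> Cod S cb) = u11" "h11 \<bullet> (g \<rhd> Cod S cb) = r \<bullet> h01"
    using caR[of h11 "Id S (Cod S cb)"] unfolding H11 U''[symmetric] by simp_all
  moreover have "h11 \<bullet> (Cod S ca \<lhd> b1) = v11" "h11 \<bullet> (Cod S ca \<lhd> k) = r \<bullet> h10"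
    using cbL[of h11 "Id S (Cod S ca)"] unfolding H11 V''[symmetric] by simp_all
  ultimately show thesis
    using that[of h01 h10 h11] H01 H10 H10' H11(3) by simp
qed

end

locale smcc_model = smcc S + model_with_pushouts S Weq Cof Fib
  for S :: "('o, 'a, 'm) premonoidal_scheme" (structure) and Weq Cof Fib :: "'a set"
begin

lemma cell_tensor:
  assumes U: "U \<in> squares S" "\<sigma> \<in> squares S" "\<tau> \<in> squares S" "sq_src U = sq_trg \<sigma> \<box> sq_trg \<tau>" and "a \<or> b"
  shows "sqc (U \<cdot> arr_tensor S \<sigma> \<tau>) (a \<and> b) \<bullet> pin (sq_src \<sigma>) (sq_src \<tau>) a b =
    (sqc U (a \<and> b) \<bullet> pin (sq_trg \<sigma>) (sq_trg \<tau>) a b) \<bullet> (sqc \<sigma> a \<otimes> sqc \<tau> b)"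
  using assms squareD[OF U(1)] squareD[OF U(2)] squareD[OF U(3)] squareD[OF arr_tensor_square[OF U(2,3)]]
  by (simp add: arr_tensor_pin)

lemma cell_natural:
  assumes U: "U \<in> squares S" "sq_src U = f \<box> g" "sq_trg U = r" and [simp]: "f \<in> Ar S" "g \<in> Ar S"
  shows "(sqc U False \<bullet> pp_in1 S f g) \<bullet> (Dom S f \<lhd> g) = (sqc U False \<bullet> pp_in2 S f g) \<bullet> (f \<rhd> Dom S g)"
    "r \<bullet> (sqc U False \<bullet> pp_in1 S f g) = sqc U True \<bullet> (f \<rhd> Cod S g)"
    "r \<bullet> (sqc U False \<bullet> pp_in2 S f g) = sqc U True \<bullet> (Cod S f \<lhd> g)"
proof -
  note d = squareD[OF U(1)] U
  have e: "r \<bullet> sqc U False = sqc U True \<bullet> (f \<box> g)" using square_commutes[OF U(1)] U by simp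
  show "(sqc U False \<bullet> pp_in1 S f g) \<bullet> (Dom S f \<lhd> g) = (sqc U False \<bullet> pp_in2 S f g) \<bullet> (f \<rhd> Dom S g)"
    using d by (simp add: pp_commutes)
  show "r \<bullet> (sqc U False \<bullet> pp_in1 S f g) = sqc U True \<bullet> (f \<rhd> Cod S g)"
    "r \<bullet> (sqc U False \<bullet> pp_in2 S f g) = sqc U True \<bullet> (Cod S f \<lhd> g)"
    using comp_chain[OF e, of "pp_in1 S f g"] comp_chain[OF e, of "pp_in2 S f g"] d
    by (simp_all add: box_in)
qed

text \<open>Translation of \<open>two_variable_lift\<close> to the arrow category: the problem is restricted to the components
  \<open>U\<close>, \<open>V\<close>, \<open>W\<close>, and the three lifts are assembled into a square.\<close>

lemma Arr_lifts2:
  assumes \<alpha>: "\<alpha> \<in> squares S" and \<beta>: "\<beta> \<in> squares S" and p: "p \<in> squares S"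
    and l01: "lifts2 S (sqc \<alpha> False) (sqc \<beta> True) (sqc p False)"
    and l10: "lifts2 S (corner_map S \<alpha>) (sqc \<beta> False) (sqc p False)"
    and l11: "lifts2 S (corner_map S \<alpha>) (corner_map S \<beta>) (sqc p True)"
  shows "lifts2 (Arr S) \<alpha> \<beta> p"
  unfolding lifts2_def
proof (intro ballI impI, elim conjE)
  interpret A: category "Arr S" by (rule Arr_category)
  define f where "f = sq_src \<alpha>"
  define g where "g = sq_trg \<alpha>"
  define h where "h = sq_src \<beta>"
  define k where "k = sq_trg \<beta>"
  define r where "r = sq_src p"
  define s where "s = sq_trg p"
  note defs = f_def[symmetric] g_def[symmetric] h_def[symmetric] k_def[symmetric] r_def[symmetric] s_def[symmetric]
  note D\<alpha> [simp] = squareD[OF \<alpha>, unfolded defs] note D\<beta> [simp] = squareD[OF \<beta>, unfolded defs]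
  note Dp [simp] = squareD[OF p, unfolded defs]
  have Id_sq [simp]: "Id (Arr S) x \<in> squares S" if "x \<in> Ar S" for x using A.id_arrow(1)[of x] that by simp
  fix u v w assume a: "u \<in> Ar (Arr S)" "v \<in> Ar (Arr S)" "w \<in> Ar (Arr S)"
    "Dom (Arr S) u = TensOb (Arr S) (Dom (Arr S) \<alpha>) (Cod (Arr S) \<beta>)" "Cod (Arr S) u = Dom (Arr S) p"
    "Dom (Arr S) v = TensOb (Arr S) (Cod (Arr S) \<alpha>) (Dom (Arr S) \<beta>)" "Cod (Arr S) v = Dom (Arr S) p"
    "Dom (Arr S) w = TensOb (Arr S) (Cod (Arr S) \<alpha>) (Cod (Arr S) \<beta>)" "Cod (Arr S) w = Cod (Arr S) p"
    and e: "u \<cdot> TensAr (Arr S) (Id (Arr S) (Dom (Arr S) \<alpha>)) \<beta> =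
        v \<cdot> TensAr (Arr S) \<alpha> (Id (Arr S) (Dom (Arr S) \<beta>))"
      "p \<cdot> u = w \<cdot> TensAr (Arr S) \<alpha> (Id (Arr S) (Cod (Arr S) \<beta>))"
      "p \<cdot> v = w \<cdot> TensAr (Arr S) (Id (Arr S) (Cod (Arr S) \<alpha>)) \<beta>"
  have sq: "u \<in> squares S" "v \<in> squares S" "w \<in> squares S"
    and [simp]: "sq_src u = f \<box> k" "sq_trg u = r" "sq_src v = g \<box> h" "sq_trg v = r" "sq_src w = g \<box> k" "sq_trg w = s"
    using a by (simp_all add: defs)
  note Du [simp] = squareD[OF sq(1)] note Dv [simp] = squareD[OF sq(2)] note Dw [simp] = squareD[OF sq(3)]
  define U where "U x y = sqc u (x \<and> y) \<bullet> pin f k x y" for x y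
  define V where "V x y = sqc v (x \<and> y) \<bullet> pin g h x y" for x y
  define W where "W x y = sqc w (x \<and> y) \<bullet> pin g k x y" for x y
  have U [simp]: "U x y \<in> Ar S" "Dom S (U x y) = ev S f x \<odot> ev S k y" "Cod S (U x y) = ev S r (x \<and> y)"
    and V [simp]: "V x y \<in> Ar S" "Dom S (V x y) = ev S g x \<odot> ev S h y" "Cod S (V x y) = ev S r (x \<and> y)"
    and W [simp]: "W x y \<in> Ar S" "Dom S (W x y) = ev S g x \<odot> ev S k y" "Cod S (W x y) = ev S s (x \<and> y)" for x y
    using Du Dv Dw by (simp_all add: U_def V_def W_def)
  have uv: "U x y \<bullet> (ev S f x \<lhd> sqc \<beta> y) = V x y \<bullet> (sqc \<alpha> x \<rhd> ev S h y)" if "x \<or> y" for x y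
  proof -
    have "sqc (u \<cdot> arr_tensor S (Id (Arr S) f) \<beta>) (x \<and> y) \<bullet> pin f h x y =
      sqc (v \<cdot> arr_tensor S \<alpha> (Id (Arr S) h)) (x \<and> y) \<bullet> pin f h x y"
      using e(1) by (simp add: defs del: sqc_comp)
    thus ?thesis
      using cell_tensor[of u "Id (Arr S) f" \<beta> x y] cell_tensor[of v \<alpha> "Id (Arr S) h" x y] that sq \<alpha> \<beta>
      by (simp add: U_def V_def defs del: sqc_comp)
  qed
  have pu: "sqc p (x \<and> y) \<bullet> U x y = W x y \<bullet> (sqc \<alpha> x \<rhd> ev S k y)" if "x \<or> y" for x y
  proof -
    have "sqc (p \<cdot> u) (x \<and> y) \<bullet> pin f k x y =
      sqc (w \<cdot> arr_tensor S \<alpha> (Id (Arr S) k)) (x \<and> y) \<bullet> pin f k x y"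
      using e(2) by (simp add: defs del: sqc_comp)
    moreover have "sqc (p \<cdot> u) (x \<and> y) \<bullet> pin f k x y = sqc p (x \<and> y) \<bullet> U x y"
      by (simp add: U_def)
    ultimately show ?thesis
      using cell_tensor[of w \<alpha> "Id (Arr S) k" x y] that sq \<alpha> \<beta>
      by (simp add: W_def defs del: sqc_comp)
  qed
  have pv: "sqc p (x \<and> y) \<bullet> V x y = W x y \<bullet> (ev S g x \<lhd> sqc \<beta> y)" if "x \<or> y" for x y
  proof -
    have "sqc (p \<cdot> v) (x \<and> y) \<bullet> pin g h x y =
      sqc (w \<cdot> arr_tensor S (Id (Arr S) g) \<beta>) (x \<and> y) \<bullet> pin g h x y"
      using e(3) by (simp add: defs del: sqc_comp)
    moreover have "sqc (p \<cdot> v) (x \<and> y) \<bullet> pin g h x y = sqc p (x \<and> y) \<bullet> V x y"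
      by (simp add: V_def)
    ultimately show ?thesis
      using cell_tensor[of w "Id (Arr S) g" \<beta> x y] that sq \<alpha> \<beta>
      by (simp add: W_def defs del: sqc_comp)
  qed
  have un: "U False True \<bullet> (Dom S f \<lhd> k) = U True False \<bullet> (f \<rhd> Dom S k)"
    "r \<bullet> U False True = U True True \<bullet> (f \<rhd> Cod S k)" "r \<bullet> U True False = U True True \<bullet> (Cod S f \<lhd> k)"
    using cell_natural[OF sq(1), of f k r] by (simp_all add: U_def)
  have vn: "V False True \<bullet> (Dom S g \<lhd> h) = V True False \<bullet> (g \<rhd> Dom S h)"
    "r \<bullet> V False True = V True True \<bullet> (g \<rhd> Cod S h)" "r \<bullet> V True False = V True True \<bullet> (Cod S g \<lhd> h)"
    using cell_natural[OF sq(2), of g h r] by (simp_all add: V_def)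
  have wn: "W False True \<bullet> (Dom S g \<lhd> k) = W True False \<bullet> (g \<rhd> Dom S k)"
    "s \<bullet> W False True = W True True \<bullet> (g \<rhd> Cod S k)" "s \<bullet> W True False = W True True \<bullet> (Cod S g \<lhd> k)"
    using cell_natural[OF sq(3), of g k s] by (simp_all add: W_def)
  note c\<alpha> = corner_in[OF \<alpha>, unfolded defs] corner_map[OF \<alpha>, unfolded defs]
  note c\<beta> = corner_in[OF \<beta>, unfolded defs] corner_map[OF \<beta>, unfolded defs]
  note po\<alpha> = corner_pushout[OF \<alpha>, unfolded defs] and po\<beta> = corner_pushout[OF \<beta>, unfolded defs]
  obtain h01 h10 h11 where H [simp]: "h01 \<in> Ar S" "Dom S h01 = Dom S g \<odot> Cod S k" "Cod S h01 = Dom S r"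
    "h10 \<in> Ar S" "Dom S h10 = Cod S g \<odot> Dom S k" "Cod S h10 = Dom S r"
    "h11 \<in> Ar S" "Dom S h11 = Cod S g \<odot> Cod S k" "Cod S h11 = Cod S r"
    and Hn: "h01 \<bullet> (Dom S g \<lhd> k) = h10 \<bullet> (g \<rhd> Dom S k)"
    "r \<bullet> h01 = h11 \<bullet> (g \<rhd> Cod S k)" "r \<bullet> h10 = h11 \<bullet> (Cod S g \<lhd> k)"
    and Hu: "h01 \<bullet> (sqc \<alpha> False \<rhd> Cod S k) = U False True" "h10 \<bullet> (sqc \<alpha> True \<rhd> Dom S k) = U True False"
    "h11 \<bullet> (sqc \<alpha> True \<rhd> Cod S k) = U True True"
    and Hv: "h01 \<bullet> (Dom S g \<lhd> sqc \<beta> True) = V False True" "h10 \<bullet> (Cod S g \<lhd> sqc \<beta> False) = V True False"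
    "h11 \<bullet> (Cod S g \<lhd> sqc \<beta> True) = V True True"
    and Hw: "sqc p False \<bullet> h01 = W False True" "sqc p False \<bullet> h10 = W True False" "sqc p True \<bullet> h11 = W True True"
  proof (rule two_variable_lift[OF po\<alpha> po\<beta> _ _ _ _ _ _ _ _ _ _ _ _ _ _ _ _ _ l01 l10 l11,
      where ?a1.0 = "sqc \<alpha> True" and g = g and k = k and r = r and s = s
        and ?u01.0 = "U False True" and ?u10.0 = "U True False" and ?u11.0 = "U True True"
        and ?v01.0 = "V False True" and ?v10.0 = "V True False" and ?v11.0 = "V True True"
        and ?w01.0 = "W False True" and ?w10.0 = "W True False" and ?w11.0 = "W True True"])
    show "s \<bullet> sqc p False = sqc p True \<bullet> r" using square_commutes[OF p] by (simp add: defs)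
  qed (use un vn wn uv[of False True] uv[of True False] uv[of True True] pu[of False True] pu[of True False] pu[of True True]
      pv[of False True] pv[of True False] pv[of True True] c\<alpha> c\<beta> in simp_all)
  let ?h0 = "pp_desc S g k h01 h10"
  have h0 [simp]: "?h0 \<in> Ar S" "Dom S ?h0 = pp_dom S g k" "Cod S ?h0 = Dom S r"
    and h0i: "?h0 \<bullet> pp_in1 S g k = h01" "?h0 \<bullet> pp_in2 S g k = h10"
    using pp_desc[of g k h01 h10] Hn(1) by simp_all
  define \<eta> where "\<eta> = (g \<box> k, r, ?h0, h11)"
  have "r \<bullet> ?h0 = h11 \<bullet> (g \<box> k)"
    by (rule pp_ext[of g k]) (simp_all add: h0i box_in Hn)
  hence \<eta>: "\<eta> \<in> squares S" unfolding \<eta>_def by (intro squareI) simp_all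
  have [simp]: "sq_src \<eta> = g \<box> k" "sq_trg \<eta> = r" by (simp_all add: \<eta>_def)
  have \<eta>c: "sqc \<eta> (x \<and> y) \<bullet> pin g k x y = (if x then if y then h11 else h10 else h01)" if "x \<or> y" for x y
    using that by (cases x; cases y) (simp_all add: \<eta>_def h0i)
  have "\<eta> \<cdot> arr_tensor S \<alpha> (Id (Arr S) k) = u"
  proof (rule square_ext_pin[of _ _ f k])
    fix x y :: bool assume xy: "x \<or> y"
    show "sqc (\<eta> \<cdot> arr_tensor S \<alpha> (Id (Arr S) k)) (x \<and> y) \<bullet> pin f k x y = sqc u (x \<and> y) \<bullet> pin f k x y"
      using cell_tensor[of \<eta> \<alpha> "Id (Arr S) k" x y] \<eta> \<alpha> xy \<eta>c[OF xy] Hu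
      unfolding U_def[symmetric] by (cases x; cases y) (simp_all add: defs del: sqc_comp)
  qed (use \<eta> \<alpha> sq in \<open>simp_all add: Arr_comp_square defs\<close>)
  moreover have "\<eta> \<cdot> arr_tensor S (Id (Arr S) g) \<beta> = v"
  proof (rule square_ext_pin[of _ _ g h])
    fix x y :: bool assume xy: "x \<or> y"
    show "sqc (\<eta> \<cdot> arr_tensor S (Id (Arr S) g) \<beta>) (x \<and> y) \<bullet> pin g h x y = sqc v (x \<and> y) \<bullet> pin g h x y"
      using cell_tensor[of \<eta> "Id (Arr S) g" \<beta> x y] \<eta> \<beta> xy \<eta>c[OF xy] Hv
      unfolding V_def[symmetric] by (cases x; cases y) (simp_all add: defs del: sqc_comp)
  qed (use \<eta> \<beta> sq in \<open>simp_all add: Arr_comp_square defs\<close>)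
  moreover have "p \<cdot> \<eta> = w"
  proof (rule square_ext_pin[of _ _ g k])
    fix x y :: bool assume xy: "x \<or> y"
    have "sqc (p \<cdot> \<eta>) (x \<and> y) \<bullet> pin g k x y = sqc p (x \<and> y) \<bullet> (sqc \<eta> (x \<and> y) \<bullet> pin g k x y)"
      using squareD[OF \<eta>] by simp
    thus "sqc (p \<cdot> \<eta>) (x \<and> y) \<bullet> pin g k x y = sqc w (x \<and> y) \<bullet> pin g k x y"
      using xy \<eta>c[OF xy] Hw
      unfolding W_def[symmetric] by (cases x; cases y) (simp_all del: sqc_comp)
  qed (use \<eta> p sq in \<open>simp_all add: Arr_comp_square defs\<close>)
  ultimately show "\<exists>h\<in>Ar (Arr S). Dom (Arr S) h = TensOb (Arr S) (Cod (Arr S) \<alpha>) (Cod (Arr S) \<beta>) \<and>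
      Cod (Arr S) h = Dom (Arr S) p \<and>
      h \<cdot> TensAr (Arr S) \<alpha> (Id (Arr S) (Cod (Arr S) \<beta>)) = u \<and>
      h \<cdot> TensAr (Arr S) (Id (Arr S) (Cod (Arr S) \<alpha>)) \<beta> = v \<and> p \<cdot> h = w"
    using \<eta> by (intro bexI[of _ \<eta>]) (simp_all add: defs)
qed

end

lemma smcc_of_bicomplete:
  assumes "symmetric_monoidal_closed_category S" "bicomplete small S"
  shows "smcc S"
proof -
  interpret symmetric_monoidal_closed_category S by fact
  show ?thesis
    by unfold_locales (use bicomplete_has_pushouts[OF assms(2)] bicomplete_has_initial[OF assms(2)]
      bicomplete_has_pullbacks[OF assms(2)] in blast)+
qed

theorem theorem1:
  fixes small :: "'i::infinite itself"
    and M :: "('o, 'a, 'm) premonoidal_scheme"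
    and Weq Cof Fib :: "'a set"
  assumes "monoidal_model_category small M Weq Cof Fib"
  shows "monoidal_model_category small (Arr M) (proj_weq M Weq) (proj_cof M Cof) (proj_fib M Fib)"
proof -
  interpret M: monoidal_model_category small M Weq Cof Fib by fact
  interpret B: smcc M
    by (rule smcc_of_bicomplete[OF M.symmetric_monoidal_closed_category_axioms M.bicomplete])
  interpret S: smcc_model M Weq Cof Fib by unfold_locales
  have bc: "bicomplete small (Arr M)" by (rule M.Arr_bicomplete[OF M.bicomplete])
  have smc: "symmetric_monoidal_closed_category (Arr M)" by (rule B.Arr_symmetric_monoidal_closed)
  interpret A: smcc "Arr M" by (rule smcc_of_bicomplete[OF smc bc])
  interpret P: model_structure "Arr M" "proj_weq M Weq" "proj_cof M Cof" "proj_fib M Fib"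
    by (rule S.Arr_model_structure)
  \<comment> \<open>In two-variable form, the pushout product axiom of \<open>M\<close>.\<close>
  have cof2: "lifts2 M i j p" if "i \<in> Cof" "j \<in> Cof" "p \<in> Fib \<inter> Weq" for i j p
    using M.pushout_product_cof[OF that(1,2)] M.lift_cof_tfib[OF _ that(3)] B.box_lifts_iff[of i j p] that
    by simp
  have tcof2: "lifts2 M i j p" if "i \<in> Cof" "j \<in> Cof" "i \<in> Weq \<or> j \<in> Weq" "p \<in> Fib" for i j p
    using M.pushout_product_tcof[OF that(1-3)] M.lift_tcof_fib[OF _ that(4)] B.box_lifts_iff[of i j p] that
    by simp
  \<comment> \<open>The codomain component is the corner map after a pushout of the domain component.\<close>
  have top: "sqc \<alpha> True \<in> Cof" if "\<alpha> \<in> proj_cof M Cof" for \<alpha>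
  proof -
    have \<alpha>: "\<alpha> \<in> squares M" "sqc \<alpha> False \<in> Cof" "corner_map M \<alpha> \<in> Cof"
      using that by (auto simp: S.proj_cof_iff)
    have "po_in1 M (sq_src \<alpha>) (sqc \<alpha> False) \<in> Cof"
      by (rule M.Cof_pushout[OF S.corner_pushout[OF \<alpha>(1)] \<alpha>(2)])
    thus ?thesis
      using M.Cof_comp[OF _ \<alpha>(3)] S.corner_in(3)[OF \<alpha>(1)] S.corner_map(2,4)[OF \<alpha>(1)] by metis
  qed
  have box_ar: "pushout_product (Arr M) \<alpha> \<beta> \<in> Ar (Arr M)" if "\<alpha> \<in> squares M" "\<beta> \<in> squares M" for \<alpha> \<beta>
    using A.box_arrow(1)[of \<alpha> \<beta>] that by simp
  show ?thesis
  proof (intro monoidal_model_category.intro monoidal_model_category_axioms.intro smc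
      S.Arr_model_structure bc)
    fix \<alpha> \<beta> assume c: "\<alpha> \<in> proj_cof M Cof" "\<beta> \<in> proj_cof M Cof"
    have sq: "\<alpha> \<in> squares M" "\<beta> \<in> squares M" using c by (auto simp: S.proj_cof_iff)
    have "lifts_against (Arr M) (pushout_product (Arr M) \<alpha> \<beta>) p"
      if "p \<in> proj_fib M Fib \<inter> proj_weq M Weq" for p
    proof -
      have p: "p \<in> squares M" "\<And>a. sqc p a \<in> Fib \<inter> Weq"
        using that by (auto simp: S.proj_fib_iff S.proj_weq_iff)
      have "lifts2 (Arr M) \<alpha> \<beta> p"
        by (rule S.Arr_lifts2[OF sq p(1)]; rule cof2) (use c top[OF c(2)] p in \<open>auto simp: S.proj_cof_iff\<close>)
      thus ?thesis using A.box_lifts_iff[of \<alpha> \<beta> p] sq p by simp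
    qed
    thus "pushout_product (Arr M) \<alpha> \<beta> \<in> proj_cof M Cof"
      unfolding P.Cof_iff_lifts using box_ar[OF sq] by blast
    assume t: "\<alpha> \<in> proj_weq M Weq \<or> \<beta> \<in> proj_weq M Weq"
    have t\<alpha>: "sqc \<alpha> False \<in> Weq \<and> corner_map M \<alpha> \<in> Weq" if "\<alpha> \<in> proj_weq M Weq"
      using S.proj_tcof_corner[OF c(1) that] by blast
    have t\<beta>: "sqc \<beta> True \<in> Weq \<and> sqc \<beta> False \<in> Weq \<and> corner_map M \<beta> \<in> Weq" if "\<beta> \<in> proj_weq M Weq"
      using S.proj_tcof_corner[OF c(2) that] that by (auto simp: S.proj_weq_iff)
    have "lifts_against (Arr M) (pushout_product (Arr M) \<alpha> \<beta>) p" if "p \<in> proj_fib M Fib" for p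
    proof -
      have p: "p \<in> squares M" "\<And>a. sqc p a \<in> Fib" using that by (auto simp: S.proj_fib_iff)
      have "lifts2 (Arr M) \<alpha> \<beta> p"
        by (rule S.Arr_lifts2[OF sq p(1)]; rule tcof2)
          (use c t t\<alpha> t\<beta> top[OF c(2)] p in \<open>auto simp: S.proj_cof_iff\<close>)
      thus ?thesis using A.box_lifts_iff[of \<alpha> \<beta> p] sq p by simp
    qed
    thus "pushout_product (Arr M) \<alpha> \<beta> \<in> proj_cof M Cof \<inter> proj_weq M Weq"
      unfolding P.tCof_iff_lifts using box_ar[OF sq] by blast
  qed
qed

end
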